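(* Let $(S,d)$ be a separable metric space such that every finite Borel measure on $S$ is inner regular, let $\pi$ be a finite positive Borel measure on $S$, and let $(\kappa(x,\cdot))_{x\in S}$ be a Borel family of positive $\sigma$-finite Borel measures on $S$ with $\kappa(x,\{x\})=0$ for all $x$, such that $x\mapsto\int_{S\setminus\{x\}}f(y)(1\wedge d^2(x,y))\,\kappa(x,\mathrm dy)$ is measurable for every bounded Borel $f:S\to\mathbb R$, $c_\kappa:=\sup_{x\in S}\int_S(1\wedge d^2(x,y))\,\kappa(x,\mathrm dy)<\infty$, and the measure $\pi(\mathrm dx)\kappa(x,\mathrm dy)$ on $S\times S$ is invariant under $(x,y)\mapsto(y,x)$ (detailed balance). Fix $N\ge2$ and let $\boldsymbol V=\mathcal P(S)$, $\boldsymbol d=W_2$, $\widehat{\boldsymbol\pi}$, $\widehat{\boldsymbol\kappa}$ be the lifted objects defined in the context. Then the collection $(\boldsymbol V,\boldsymbol d,\widehat{\boldsymbol\pi},\widehat{\boldsymbol\kappa})$ satisfies the same structural assumptions, namely: (i) $(\boldsymbol V,\boldsymbol d)$ is a separable metric space and $\widehat{\boldsymbol\pi}$ is a finite positive Borel measure on $\boldsymbol V$; (ii) for each $\nu\in\boldsymbol V$, $\widehat{\boldsymbol\kappa}(\nu,\cdot)$ is a positive $\sigma$-finite Borel measure on $\boldsymbol V\setminus\{\nu\}$ (extended by $\widehat{\boldsymbol\kappa}(\nu,\{\nu\})=0$), and for every bounded Borel $f:\boldsymbol V\to\mathbb R$ the map $\nu\mapsto\int_{\boldsymbol V\setminus\{\nu\}}f(\eta)(1\wedge\boldsymbol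 d^2(\nu,\eta))\,\widehat{\boldsymbol\kappa}(\nu,\mathrm d\eta)$ is measurable; (iii) the measure $\widehat{\boldsymbol\pi}(\mathrm d\nu)\,\widehat{\boldsymbol\kappa}(\nu,\mathrm d\eta)$ on $\boldsymbol V\times\boldsymbol V$ is invariant under $(\nu,\eta)\mapsto(\eta,\nu)$ (detailed balance); (iv) $\sup_{\nu\in\boldsymbol V}\int_{\boldsymbol V}(1\wedge\boldsymbol d^2(\nu,\eta))\,\widehat{\boldsymbol\kappa}(\nu,\mathrm d\eta)<\infty$. Moreover, $$\sup_{\nu\in\boldsymbol V}\int_{\boldsymbol V}(1\wedge\boldsymbol d^2(\nu,\eta))\,\widehat{\boldsymbol\kappa}(\nu,\mathrm d\eta)\le c_\kappa.$$
   Context: $\boldsymbol V:=\mathcal P(S)$ is the set of Borel probability measures on $S$, equipped with $\boldsymbol d:=W_2$, the 2-Wasserstein distance induced by $d$: for any $\mu_1,\mu_2\in\mathcal P(S)$, $W_2^2(\mu_1,\mu_2):=\min\{\iint_{S\times S} d^2(x,y)\,\boldsymbol\gamma(\mathrm dx\,\mathrm dy):\boldsymbol\gamma\in\Gamma(\mu_1,\mu_2)\}$, where $\Gamma(\mu_1,\mu_2)$ is the set of Borel probability measures on $S\times S$ with first marginal $\mu_1$ and second marginal $\mu_2$. $\Lambda_N:S^N\to\boldsymbol V$, $\Lambda_N(z_1,\dots,z_N):=\frac1N\sum_{i=1}^N\delta_{z_i}$, and $\widehat{\boldsymbol\pi}:=(\Lambda_N)_\#\pi^{\otimes N}$ is the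 push-forward of the $N$-fold product measure. For $\nu\in\Lambda_N(S^N)$, $\widehat{\boldsymbol\kappa}(\nu,\mathrm d\eta):=\int_S\Big(\int_S\delta_{\nu+\frac1N(\delta_y-\delta_x)}(\mathrm d\eta)\,\kappa(x,\mathrm dy)\Big)\nu(\mathrm dx)$; for $\nu\in\boldsymbol V\setminus\Lambda_N(S^N)$, $\widehat{\boldsymbol\kappa}(\nu,\cdot):=0$. Thus for $\nu=\frac1N\sum_i\delta_{z_i}$, $\widehat{\boldsymbol\kappa}(\nu,\mathrm d\eta)=\frac1N\sum_{i=1}^N\int_{S\setminus\{z_i\}}\delta_{\frac1N\sum_{j\ne i}\delta_{z_j}+\frac1N\delta_y}(\mathrm d\eta)\,\kappa(z_i,\mathrm dy)$.
   Formalization: In (i), W_2 is infinite for some pairs in P(S) if d is unbounded, so "separable metric space" is proved for P(S) when d is bounded; in general W_2 is shown to be a [0,∞]-valued metric on P(S) and a separable metric on the measures with finite second moment. *)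

theory Defs
  imports "HOL-Probability.Probability"
begin

text \<open>
  Distances are taken with values in \<open>[0, \<infinity>]\<close>, because \<open>W\<^sub>2\<close> is infinite for some pairs of
  probability measures as soon as the underlying metric is unbounded.
\<close>

definition ext_metric :: "'x set \<Rightarrow> ('x \<Rightarrow> 'x \<Rightarrow> ennreal) \<Rightarrow> bool" where
  "ext_metric X d \<longleftrightarrow>
     (\<forall>x\<in>X. \<forall>y\<in>X. d x y = 0 \<longleftrightarrow> x = y) \<and>
     (\<forall>x\<in>X. \<forall>y\<in>X. d x y = d y x) \<and>
     (\<forall>x\<in>X. \<forall>y\<in>X. \<forall>z\<in>X. d x z \<le> d x y + d y z)"

definition separable_metric :: "'x set \<Rightarrow> ('x \<Rightarrow> 'x \<Rightarrow> real) \<Rightarrow> bool" where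
  "separable_metric X d \<longleftrightarrow> Metric_space X d \<and> separable_space (Metric_space.mtopology X d)"

text \<open>The Borel \<open>\<sigma>\<close>-algebra of the topology induced by \<open>d\<close> on \<open>X\<close>.\<close>

definition metric_borel :: "'x set \<Rightarrow> ('x \<Rightarrow> 'x \<Rightarrow> ennreal) \<Rightarrow> 'x measure" where
  "metric_borel X d = sigma X {U. U \<subseteq> X \<and> (\<forall>x\<in>U. \<exists>r>0. \<forall>y\<in>X. d x y < r \<longrightarrow> y \<in> U)}"

lemma metric_borel_Metric_space:
  assumes "Metric_space X d"
  shows "metric_borel X (\<lambda>x y. ennreal (d x y)) =
    sigma X {U. openin (Metric_space.mtopology X d) U}"
proof -
  interpret Metric_space X d by fact
  have "(\<exists>r>0. \<forall>y\<in>X. ennreal (d x y) < r \<longrightarrow> y \<in> U) \<longleftrightarrow> (\<exists>r>0. mball x r \<subseteq> U)"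
    (is "?L \<longleftrightarrow> ?R") if "U \<subseteq> X" "x \<in> U" for U x
  proof
    assume ?L
    then obtain r where r: "r > 0" "\<forall>y\<in>X. ennreal (d x y) < r \<longrightarrow> y \<in> U" by blast
    obtain s where s: "s > 0" "ennreal s \<le> r"
    proof (cases r)
      case (real s)
      then show thesis using r(1) that[of s] by simp
    next
      case top
      then show thesis using that[of 1] by simp
    qed
    have "y \<in> U" if "y \<in> mball x s" for y
    proof -
      have "y \<in> X" "d x y < s" using that by simp_all
      moreover from this have "ennreal (d x y) < r"
        using s by (meson ennreal_lessI less_le_trans)
      ultimately show ?thesis using r(2) by blast
    qed
    then show ?R using s(1) by blast
  next
    assume ?R
    then obtain r where r: "r > 0" "mball x r \<subseteq> U" by blast
    have "y \<in> U" if "y \<in> X" "ennreal (d x y) < ennreal r" for y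
    proof -
      have "d x y < r" using that(2) by (simp add: ennreal_less_iff)
      then have "y \<in> mball x r" using that(1) \<open>U \<subseteq> X\<close> \<open>x \<in> U\<close> by (simp add: subsetD)
      then show ?thesis using r(2) by blast
    qed
    moreover have "ennreal r > 0" using r(1) by simp
    ultimately show ?L by blast
  qed
  then have "{U. U \<subseteq> X \<and> (\<forall>x\<in>U. \<exists>r>0. \<forall>y\<in>X. ennreal (d x y) < r \<longrightarrow> y \<in> U)}
      = {U. openin mtopology U}"
    unfolding openin_mtopology by (intro Collect_cong) (meson subsetD)
  then show ?thesis
    unfolding metric_borel_def by (rule arg_cong)
qed

lemma metric_borel_dist:
  "metric_borel UNIV (\<lambda>x y. ennreal (dist x y)) = (borel :: 'a::metric_space measure)"
  using metric_borel_Metric_space[OF Met_TC.Metric_space_axioms] by (simp add: borel_def)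

text \<open>
  Finiteness of \<open>\<integral> (1 \<and> d\<^sup>2(x, y)) \<kappa>(x, dy)\<close>, uniformly in \<open>x\<close>, makes the Bochner integral below
  a genuine integral for bounded \<open>f\<close>.
\<close>

definition rate_bound :: "'x set \<Rightarrow> ('x \<Rightarrow> 'x \<Rightarrow> ennreal) \<Rightarrow> ('x \<Rightarrow> 'x measure) \<Rightarrow> ennreal" where
  "rate_bound X d \<kappa> = (SUP x\<in>X. \<integral>\<^sup>+ y. min 1 ((d x y)\<^sup>2) \<partial>\<kappa> x)"

definition jump_structure ::
    "'x set \<Rightarrow> ('x \<Rightarrow> 'x \<Rightarrow> ennreal) \<Rightarrow> 'x measure \<Rightarrow> ('x \<Rightarrow> 'x measure) \<Rightarrow> bool" where
  "jump_structure X d \<pi> \<kappa> \<longleftrightarrow>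
     sets \<pi> = sets (metric_borel X d) \<and> finite_measure \<pi> \<and>
     (\<forall>x\<in>X. sets (\<kappa> x) = sets (metric_borel X d) \<and> sigma_finite_measure (\<kappa> x) \<and>
        {x} \<in> sets (metric_borel X d) \<and> emeasure (\<kappa> x) {x} = 0) \<and>
     (\<forall>E\<in>sets (metric_borel X d). (\<lambda>x. emeasure (\<kappa> x) E) \<in> borel_measurable (metric_borel X d)) \<and>
     (\<forall>f::'x \<Rightarrow> real. f \<in> borel_measurable (metric_borel X d) \<longrightarrow> bounded (f ` X) \<longrightarrow>
        (\<lambda>x. set_lebesgue_integral (\<kappa> x) (X - {x}) (\<lambda>y. f y * enn2real (min 1 ((d x y)\<^sup>2))))
          \<in> borel_measurable (metric_borel X d)) \<and>
     rate_bound X d \<kappa> < \<infinity> \<and>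
     (\<forall>E\<in>sets (metric_borel X d \<Otimes>\<^sub>M metric_borel X d).
        (\<integral>\<^sup>+ x. emeasure (\<kappa> x) {y\<in>X. (x, y) \<in> E} \<partial>\<pi>) =
        (\<integral>\<^sup>+ x. emeasure (\<kappa> x) {y\<in>X. (y, x) \<in> E} \<partial>\<pi>))"

definition inner_regular_measure :: "'a::topological_space measure \<Rightarrow> bool" where
  "inner_regular_measure M \<longleftrightarrow>
     (\<forall>A\<in>sets M. emeasure M A = (SUP K\<in>{K. K \<subseteq> A \<and> compact K}. emeasure M K))"

definition prob_measures :: "'a::topological_space measure set" where
  "prob_measures = {\<mu>. prob_space \<mu> \<and> sets \<mu> = sets borel}"

definition couplings :: "'a::topological_space measure \<Rightarrow> 'a measure \<Rightarrow> ('a \<times> 'a) measure set" where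
  "couplings \<mu> \<nu> =
     {\<gamma>. prob_space \<gamma> \<and> sets \<gamma> = sets borel \<and> distr \<gamma> borel fst = \<mu> \<and> distr \<gamma> borel snd = \<nu>}"

text \<open>
  The infimum is a minimum when every finite Borel measure is inner regular (the couplings of two
  given measures are then tight and the cost is lower semicontinuous).
\<close>

definition transport_cost :: "'a::metric_space measure \<Rightarrow> 'a measure \<Rightarrow> ennreal" where
  "transport_cost \<mu> \<nu> = (INF \<gamma>\<in>couplings \<mu> \<nu>. \<integral>\<^sup>+ (x, y). ennreal ((dist x y)\<^sup>2) \<partial>\<gamma>)"

definition W2 :: "'a::metric_space measure \<Rightarrow> 'a measure \<Rightarrow> ennreal" where
  "W2 \<mu> \<nu> = (if transport_cost \<mu> \<nu> = \<infinity> then \<infinity>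
              else ennreal (sqrt (enn2real (transport_cost \<mu> \<nu>))))"

lemma W2_squared: "(W2 \<mu> \<nu>)\<^sup>2 = transport_cost \<mu> \<nu>"
  by (cases "transport_cost \<mu> \<nu>") (auto simp: W2_def ennreal_power)

definition prob_measures2 :: "'a::metric_space measure set" where
  "prob_measures2 = {\<mu>\<in>prob_measures. \<exists>a. (\<integral>\<^sup>+ x. ennreal ((dist a x)\<^sup>2) \<partial>\<mu>) < \<infinity>}"

text \<open>The points of \<open>S\<^sup>N\<close> are the functions on \<open>{..<N}\<close>; \<open>empirical N\<close> is the map \<open>\<Lambda>\<^sub>N\<close>.\<close>

definition empirical :: "nat \<Rightarrow> (nat \<Rightarrow> 'a::topological_space) \<Rightarrow> 'a measure" where
  "empirical N z =
     measure_of UNIV (sets borel) (\<lambda>A. (\<Sum>i<N. emeasure (return borel (z i)) A) / of_nat N)"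

definition empirical_measures :: "nat \<Rightarrow> 'a::topological_space measure set" where
  "empirical_measures N = range (empirical N)"

text \<open>
  The measure \<open>\<nu> + (\<delta>\<^sub>y - \<delta>\<^sub>x) / N\<close>. The subtraction is the truncated one on \<open>[0, \<infinity>]\<close>; it is used for
  \<open>\<nu>\<close> in the range of \<open>\<Lambda>\<^sub>N\<close> and \<open>\<nu>\<close>-almost all \<open>x\<close>, where \<open>\<nu>{x} \<ge> 1/N\<close> and nothing is truncated.
\<close>

definition move_mass :: "nat \<Rightarrow> 'a::topological_space measure \<Rightarrow> 'a \<Rightarrow> 'a \<Rightarrow> 'a measure" where
  "move_mass N \<nu> x y =
     measure_of UNIV (sets borel)
       (\<lambda>A. (emeasure \<nu> A + emeasure (return borel y) A / of_nat N)
              - emeasure (return borel x) A / of_nat N)"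

definition lifted_measure :: "nat \<Rightarrow> 'a::metric_space measure \<Rightarrow> 'a measure measure" where
  "lifted_measure N \<pi> =
     distr (\<Pi>\<^sub>M i\<in>{..<N}. \<pi>) (metric_borel prob_measures W2) (empirical N)"

definition lifted_rate ::
    "nat \<Rightarrow> ('a::metric_space \<Rightarrow> 'a measure) \<Rightarrow> 'a measure \<Rightarrow> 'a measure set \<Rightarrow> ennreal" where
  "lifted_rate N \<kappa> \<nu> E =
     (if \<nu> \<in> empirical_measures N
      then \<integral>\<^sup>+ x. (\<integral>\<^sup>+ y. indicator E (move_mass N \<nu> x y) \<partial>\<kappa> x) \<partial>\<nu> else 0)"

definition lifted_kernel ::
    "nat \<Rightarrow> ('a::metric_space \<Rightarrow> 'a measure) \<Rightarrow> 'a measure \<Rightarrow> 'a measure measure" where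
  "lifted_kernel N \<kappa> \<nu> =
     measure_of prob_measures (sets (metric_borel prob_measures W2)) (lifted_rate N \<kappa> \<nu>)"

lemma sets_empirical [simp]: "sets (empirical N z) = sets borel"
  using sets.sigma_sets_eq[of "borel :: 'a measure"]
  by (simp add: empirical_def sets_measure_of_conv)

lemma emeasure_empirical:
  fixes z :: "nat \<Rightarrow> 'a::topological_space"
  assumes A: "A \<in> sets borel"
  shows "emeasure (empirical N z) A = (\<Sum>i<N. emeasure (return borel (z i)) A) / of_nat N"
proof (rule emeasure_measure_of[OF empirical_def])
  show "countably_additive (sets (empirical N z))
     (\<lambda>A. (\<Sum>i<N. emeasure (return borel (z i)) A) / of_nat N)"
  proof (rule countably_additiveI)
    fix F :: "nat \<Rightarrow> 'a set"
    assume F: "range F \<subseteq> sets (empirical N z)" "disjoint_family F"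
    have "(\<Sum>k. (\<Sum>i<N. emeasure (return borel (z i)) (F k)) / of_nat N)
        = (\<Sum>i<N. \<Sum>k. emeasure (return borel (z i)) (F k)) / of_nat N"
      by (simp add: divide_ennreal_def suminf_sum)
    also have "\<dots> = (\<Sum>i<N. emeasure (return borel (z i)) (\<Union>k. F k)) / of_nat N"
      using F by (intro arg_cong[where f = "\<lambda>x. x / of_nat N"] sum.cong suminf_emeasure) auto
    finally show "(\<Sum>k. (\<Sum>i<N. emeasure (return borel (z i)) (F k)) / of_nat N)
        = (\<Sum>i<N. emeasure (return borel (z i)) (\<Union>k. F k)) / of_nat N" .
  qed
qed (use A in \<open>auto simp: positive_def\<close>)

lemma move_mass_empirical:
  fixes z :: "nat \<Rightarrow> 'a::topological_space"
  assumes i: "i < N"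
  shows "move_mass N (empirical N z) (z i) y = empirical N (z(i := y))"
proof -
  have "(emeasure (empirical N z) A + emeasure (return borel y) A / of_nat N)
            - emeasure (return borel (z i)) A / of_nat N
      = (\<Sum>j<N. emeasure (return borel ((z(i := y)) j)) A) / of_nat N"
    if A: "A \<in> sets borel" for A
  proof -
    have s: "(\<Sum>j<N. f j) = f i + (\<Sum>j\<in>{..<N} - {i}. f j)" for f :: "nat \<Rightarrow> ennreal"
      using i by (intro sum.remove) auto
    have d: "(a + b) / c = a / c + b / c" for a b c :: ennreal
      by (simp add: divide_ennreal_def distrib_right)
    have c: "((a + r) + b) - a = b + r" if "a \<noteq> \<infinity>" for a b r :: ennreal
      using that ennreal_add_diff_cancel_left[of a "r + b"] by (simp add: ac_simps)
    have fin: "emeasure (return borel (z i)) A / of_nat N \<noteq> \<infinity>"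
      using A i by (auto simp: indicator_def ennreal_divide_eq_top_iff)
    have "(\<Sum>j\<in>{..<N} - {i}. emeasure (return borel ((z(i := y)) j)) A)
        = (\<Sum>j\<in>{..<N} - {i}. emeasure (return borel (z j)) A)"
      by (intro sum.cong) auto
    then show ?thesis
      unfolding emeasure_empirical[OF A] s d using c[OF fin] by simp
  qed
  then show ?thesis
    unfolding move_mass_def empirical_def[of N "z(i := y)"]
    by (intro measure_of_eq) (use sets.sigma_sets_eq[of "borel :: 'a measure"] in auto)
qed

end

theory Submission
  imports Defs
begin

text \<open>
  \<open>W2\<close> is an infimum of costs, so the triangle inequality only needs couplings glued up to a small
  error, and this can be done cell by cell on a countable partition, without disintegration.

  Measurability on \<open>\<P>(S)\<close> is delicate because \<open>W2\<close> need not be separable. It becomes harmless on the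
  set of empirical measures, which carries \<open>\<kappa>\<close>-hat: that set is measurable, and there the Borel sets
  of \<open>W2\<close> coincide with those generated by the evaluations \<open>\<nu> \<mapsto> \<nu> A\<close>. So the lifted kernel can be
  handled by the Giry monad, where \<open>\<nu>\<close> is itself a kernel and moving mass is visibly measurable.
  The rate bound comes from transporting only the moved atom, at cost \<open>d\<^sup>2 / N\<close>, and detailed balance
  from that of \<open>\<kappa>\<close> applied to one coordinate at a time.
\<close>

section \<open>Couplings\<close>

text \<open>What makes general measures hard: on an unbounded space \<open>W2\<close> can be
  infinite, P(S) then breaks into pieces at infinite distance from one another, and without
  separability the product sigma-algebra need not contain the open sets of the product. So
  \<open>W2\<close> is shown measurable in each argument separately, and jointly only when one
  argument is empirical. Empirical measures escape the difficulty because they consist of N atoms of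
  mass 1/N: closeness can be expressed by counting atoms in finitely many members of a countable
  basis, and atoms in a countable dense set already give a dense family. A second obstacle is that
  the rates are only sigma-finite, while the Giry monad needs subprobability kernels; the truncated
  rate \<open>min 1 (d\<^sup>2)\<close> times \<open>\<kappa>\<close>, divided by its bound plus
  one, stands in for \<open>\<kappa>\<close>. Separability is a statement about the measures of
  finite second moment, where \<open>W2\<close> is a finite metric. Its source is quantization: cell
  masses are rounded down to multiples of 1/n, and the mass lost in rounding is sent to one fixed
  point, at a cost that vanishes by dominated convergence.\<close>

definition coupling_cost :: "('a::metric_space \<times> 'a) measure \<Rightarrow> ennreal" where
  "coupling_cost \<gamma> = (\<integral>\<^sup>+ p. ennreal ((dist (fst p) (snd p))\<^sup>2) \<partial>\<gamma>)"

text \<open>A strict bound on an infimum yields an actual coupling below it, so the proof never has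
  to produce an optimal one.\<close>

lemma W2_less_iff:
  assumes "r \<ge> 0"
  shows "W2 \<mu> \<nu> < ennreal r \<longleftrightarrow> (\<exists>\<gamma>\<in>couplings \<mu> \<nu>. coupling_cost \<gamma> < ennreal (r\<^sup>2))"
proof -
  have "W2 \<mu> \<nu> < ennreal r \<longleftrightarrow> (W2 \<mu> \<nu>)\<^sup>2 < ennreal (r\<^sup>2)"
  proof (cases "W2 \<mu> \<nu>")
    case (real w)
    then show ?thesis
      using assms by (auto simp: ennreal_power ennreal_less_iff power_strict_mono
          dest: power_less_imp_less_base)
  qed (simp add: power2_eq_square ennreal_mult_top)
  also have "\<dots> \<longleftrightarrow> (\<exists>\<gamma>\<in>couplings \<mu> \<nu>. coupling_cost \<gamma> < ennreal (r\<^sup>2))"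
    by (simp add: W2_squared transport_cost_def INF_less_iff coupling_cost_def case_prod_beta')
  finally show ?thesis .
qed

lemma W2_lessI:
  "\<gamma> \<in> couplings \<mu> \<nu> \<Longrightarrow> coupling_cost \<gamma> < ennreal (r\<^sup>2) \<Longrightarrow> r \<ge> 0 \<Longrightarrow> W2 \<mu> \<nu> < ennreal r"
  using W2_less_iff by blast

lemma W2_squared_le: "\<gamma> \<in> couplings \<mu> \<nu> \<Longrightarrow> (W2 \<mu> \<nu>)\<^sup>2 \<le> coupling_cost \<gamma>"
  unfolding W2_squared transport_cost_def
  by (rule INF_lower2) (auto simp: coupling_cost_def case_prod_beta')

context
  fixes \<mu> \<nu> :: "'a::{metric_space, second_countable_topology} measure" and \<gamma>
  assumes \<gamma>: "\<gamma> \<in> couplings \<mu> \<nu>"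
begin

lemma coupling_prob_space: "prob_space \<gamma>"
  and sets_coupling: "sets \<gamma> = sets (borel \<Otimes>\<^sub>M borel)"
  using \<gamma> unfolding couplings_def borel_prod by simp_all

lemma nn_integral_coupling_fst:
  assumes "f \<in> borel_measurable borel"
  shows "(\<integral>\<^sup>+ p. f (fst p) \<partial>\<gamma>) = (\<integral>\<^sup>+ x. f x \<partial>\<mu>)"
proof -
  have "\<mu> = distr \<gamma> borel fst" using \<gamma> by (simp add: couplings_def)
  moreover have "fst \<in> \<gamma> \<rightarrow>\<^sub>M borel" by (simp cong: measurable_cong_sets add: sets_coupling)
  ultimately show ?thesis using assms by (simp add: nn_integral_distr)
qed

lemma nn_integral_coupling_snd:
  assumes "f \<in> borel_measurable borel"
  shows "(\<integral>\<^sup>+ p. f (snd p) \<partial>\<gamma>) = (\<integral>\<^sup>+ x. f x \<partial>\<nu>)"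
proof -
  have "\<nu> = distr \<gamma> borel snd" using \<gamma> by (simp add: couplings_def)
  moreover have "snd \<in> \<gamma> \<rightarrow>\<^sub>M borel" by (simp cong: measurable_cong_sets add: sets_coupling)
  ultimately show ?thesis using assms by (simp add: nn_integral_distr)
qed

lemma emeasure_coupling_fst: "A \<in> sets borel \<Longrightarrow> emeasure \<gamma> (A \<times> UNIV) = emeasure \<mu> A"
  and emeasure_coupling_snd: "A \<in> sets borel \<Longrightarrow> emeasure \<gamma> (UNIV \<times> A) = emeasure \<nu> A"
proof -
  have "\<mu> = distr \<gamma> borel fst" "\<nu> = distr \<gamma> borel snd" using \<gamma> by (simp_all add: couplings_def)
  then have s: "sets \<mu> = sets borel" "sets \<nu> = sets borel" by simp_all
  assume A: "A \<in> sets borel"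
  have "emeasure \<gamma> (A \<times> UNIV) = (\<integral>\<^sup>+ p. indicator A (fst p) \<partial>\<gamma>)"
    using A sets_coupling
    by (simp add: nn_integral_indicator[symmetric] indicator_times del: nn_integral_indicator)
  then show "emeasure \<gamma> (A \<times> UNIV) = emeasure \<mu> A"
    using A s by (simp add: nn_integral_coupling_fst)
  have "emeasure \<gamma> (UNIV \<times> A) = (\<integral>\<^sup>+ p. indicator A (snd p) \<partial>\<gamma>)"
    using A sets_coupling
    by (simp add: nn_integral_indicator[symmetric] indicator_times del: nn_integral_indicator)
  then show "emeasure \<gamma> (UNIV \<times> A) = emeasure \<nu> A"
    using A s by (simp add: nn_integral_coupling_snd)
qed

end

lemma measurable_cost [measurable]:
  "(\<lambda>p. ennreal ((dist (fst p) (snd p))\<^sup>2))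
    \<in> borel_measurable (borel :: ('a::{metric_space, second_countable_topology} \<times> 'a) measure)"
  unfolding borel_prod[symmetric] by measurable

lemma Times_in_borel:
  fixes A B :: "'a::second_countable_topology set"
  assumes "A \<in> sets borel" "B \<in> sets borel"
  shows "A \<times> B \<in> sets borel"
  using assms unfolding borel_prod[symmetric] by simp

lemma couplingsI:
  fixes \<mu> \<nu> :: "'a::{metric_space, second_countable_topology} measure"
  assumes "sets \<gamma> = sets borel" "sets \<mu> = sets borel" "sets \<nu> = sets borel" "prob_space \<mu>"
    and fst: "\<And>A. A \<in> sets borel \<Longrightarrow> emeasure \<gamma> (A \<times> UNIV) = emeasure \<mu> A"
    and snd: "\<And>A. A \<in> sets borel \<Longrightarrow> emeasure \<gamma> (UNIV \<times> A) = emeasure \<nu> A"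
  shows "\<gamma> \<in> couplings \<mu> \<nu>"
proof -
  have sp: "space \<gamma> = UNIV" "space \<mu> = UNIV" "space \<nu> = UNIV"
    using assms(1-3)[THEN sets_eq_imp_space_eq] by auto
  have m: "fst \<in> \<gamma> \<rightarrow>\<^sub>M borel" "snd \<in> \<gamma> \<rightarrow>\<^sub>M borel"
    using assms(1) by (simp_all add: borel_prod[symmetric] cong: measurable_cong_sets)
  have "emeasure \<gamma> (space \<gamma>) = 1"
    using fst[of UNIV] prob_space.emeasure_space_1[OF assms(4)] sp by simp
  then have "prob_space \<gamma>" by (rule prob_spaceI)
  moreover have "distr \<gamma> borel fst = \<mu>"
  proof (rule measure_eqI)
    fix A assume "A \<in> sets (distr \<gamma> borel fst)"
    then show "emeasure (distr \<gamma> borel fst) A = emeasure \<mu> A"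
      using m fst[of A] by (simp add: emeasure_distr sp vimage_fst)
  qed (simp add: assms)
  moreover have "distr \<gamma> borel snd = \<nu>"
  proof (rule measure_eqI)
    fix A assume "A \<in> sets (distr \<gamma> borel snd)"
    then show "emeasure (distr \<gamma> borel snd) A = emeasure \<nu> A"
      using m snd[of A] by (simp add: emeasure_distr sp vimage_snd)
  qed (simp add: assms)
  ultimately show ?thesis using assms(1) by (simp add: couplings_def)
qed

lemma prob_measuresD:
  assumes "\<mu> \<in> prob_measures"
  shows "prob_space \<mu>" "sets \<mu> = sets borel" "space \<mu> = UNIV"
  using assms sets_eq_imp_space_eq[of \<mu> borel] by (auto simp: prob_measures_def)

lemma W2_refl:
  fixes \<mu> :: "'a::{metric_space, second_countable_topology} measure"
  assumes "\<mu> \<in> prob_measures"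
  shows "W2 \<mu> \<mu> = 0"
proof -
  note \<mu> = prob_measuresD[OF assms]
  define \<gamma> where "\<gamma> = distr \<mu> borel (\<lambda>x. (x, x))"
  have m: "(\<lambda>x. (x, x)) \<in> \<mu> \<rightarrow>\<^sub>M borel"
    unfolding measurable_cong_sets[OF \<mu>(2) refl] unfolding borel_prod[symmetric] by simp
  have "\<gamma> \<in> couplings \<mu> \<mu>"
  proof (rule couplingsI)
    show "emeasure \<gamma> (A \<times> UNIV) = emeasure \<mu> A" if "A \<in> sets borel" for A
      using that m Times_in_borel[of A UNIV] \<mu> by (simp add: \<gamma>_def emeasure_distr vimage_def)
    show "emeasure \<gamma> (UNIV \<times> A) = emeasure \<mu> A" if "A \<in> sets borel" for A
      using that m Times_in_borel[of UNIV A] \<mu> by (simp add: \<gamma>_def emeasure_distr vimage_def)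
  qed (simp_all add: \<gamma>_def \<mu>)
  moreover have "coupling_cost \<gamma> = 0"
    unfolding coupling_cost_def \<gamma>_def by (subst nn_integral_distr[OF m]) (simp_all only: measurable_distr_eq1 measurable_cost, simp)
  ultimately show ?thesis
    using W2_squared_le[of \<gamma> \<mu> \<mu>] by simp
qed

text \<open>Exchanging the coordinates turns a coupling into one of equal cost. The measures can be
  arbitrary: without couplings the right side is infinite, and a coupling forces both of its
  marginals to be Borel probability measures.\<close>

lemma W2_sym_le:
  fixes \<mu> \<nu> :: "'a::{metric_space, second_countable_topology} measure"
  shows "W2 \<nu> \<mu> \<le> W2 \<mu> \<nu>"
proof (rule dense_ge)
  fix c assume c: "W2 \<mu> \<nu> < c"
  show "W2 \<nu> \<mu> \<le> c"
  proof (cases c)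
    case (real r)
    then obtain \<gamma> where \<gamma>: "\<gamma> \<in> couplings \<mu> \<nu>" "coupling_cost \<gamma> < ennreal (r\<^sup>2)"
      using c W2_less_iff by blast
    have s: "sets \<gamma> = sets (borel \<Otimes>\<^sub>M borel)" using sets_coupling[OF \<gamma>(1)] .
    define \<gamma>' where "\<gamma>' = distr \<gamma> borel prod.swap"
    have m: "prod.swap \<in> \<gamma> \<rightarrow>\<^sub>M borel"
      unfolding measurable_cong_sets[OF s refl] unfolding borel_prod[symmetric] prod.swap_def by measurable
    have \<mu>\<nu>: "\<mu> = distr \<gamma> borel fst" "\<nu> = distr \<gamma> borel snd" using \<gamma>(1) by (simp_all add: couplings_def)
    have ms: "snd \<in> \<gamma> \<rightarrow>\<^sub>M borel" using s by (simp cong: measurable_cong_sets)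
    have v: "prod.swap -` (A \<times> B) \<inter> space \<gamma> = B \<times> A" for A B
      using sets_eq_imp_space_eq[OF s] by (auto simp: space_pair_measure)
    have "\<gamma>' \<in> couplings \<nu> \<mu>"
    proof (rule couplingsI)
      show "emeasure \<gamma>' (A \<times> UNIV) = emeasure \<nu> A" if "A \<in> sets borel" for A
        using that m Times_in_borel[of A UNIV] emeasure_coupling_snd[OF \<gamma>(1)]
        by (simp add: \<gamma>'_def emeasure_distr v)
      show "emeasure \<gamma>' (UNIV \<times> A) = emeasure \<mu> A" if "A \<in> sets borel" for A
        using that m Times_in_borel[of UNIV A] emeasure_coupling_fst[OF \<gamma>(1)]
        by (simp add: \<gamma>'_def emeasure_distr v)
      show "prob_space \<nu>"
        unfolding \<mu>\<nu>(2) by (rule prob_space.prob_space_distr[OF coupling_prob_space[OF \<gamma>(1)] ms])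
    qed (simp_all add: \<gamma>'_def \<mu>\<nu>)
    moreover have "coupling_cost \<gamma>' = coupling_cost \<gamma>"
      unfolding coupling_cost_def \<gamma>'_def
      by (subst nn_integral_distr[OF m]) (simp_all only: measurable_distr_eq1 measurable_cost, simp add: dist_commute)
    ultimately show ?thesis using \<gamma>(2) real W2_lessI[of \<gamma>' \<nu> \<mu> r] by (simp add: less_imp_le)
  qed simp
qed

lemma W2_commute:
  fixes \<mu> \<nu> :: "'a::{metric_space, second_countable_topology} measure"
  shows "W2 \<nu> \<mu> = W2 \<mu> \<nu>"
  using W2_sym_le by (rule antisym) (rule W2_sym_le)

text \<open>Under a coupling of small cost, mass starting in \<open>A\<close> either moves by less
  than \<open>e\<close> and ends in the thickening, or moves by at least \<open>e\<close>; Markov's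
  inequality for the squared distance bounds the latter by
  \<open>r\<^sup>2 / e\<^sup>2\<close>.\<close>

lemma emeasure_le_emeasure_thickening:
  fixes \<mu> \<nu> :: "'a::{metric_space, second_countable_topology} measure"
  assumes W: "W2 \<mu> \<nu> < ennreal r" and r: "r \<ge> 0" and e: "e > 0" and A: "A \<in> sets borel"
  shows "emeasure \<mu> A \<le> emeasure \<nu> (\<Union>x\<in>A. ball x e) + ennreal (r\<^sup>2 / e\<^sup>2)"
proof -
  obtain \<gamma> where \<gamma>: "\<gamma> \<in> couplings \<mu> \<nu>" "coupling_cost \<gamma> < ennreal (r\<^sup>2)"
    using W r W2_less_iff by blast
  note s = sets_coupling[OF \<gamma>(1)]
  have sp: "space \<gamma> = UNIV" using sets_eq_imp_space_eq[OF s] by (simp add: space_pair_measure)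
  let ?U = "\<Union>x\<in>A. ball x e" and ?D = "{p. e\<^sup>2 \<le> (dist (fst p) (snd p))\<^sup>2}"
  have U: "?U \<in> sets borel" by (intro borel_open) auto
  have D: "{p \<in> space \<gamma>. 1 \<le> ennreal (1 / e\<^sup>2) * ennreal ((dist (fst p) (snd p))\<^sup>2)} = ?D"
    using e by (auto simp: sp ennreal_mult[symmetric] field_simps simp flip: ennreal_1)
  have mD: "?D \<in> sets \<gamma>"
  proof -
    have "{p \<in> space (borel \<Otimes>\<^sub>M borel). e\<^sup>2 \<le> (dist (fst p) (snd p :: 'a))\<^sup>2} \<in> sets (borel \<Otimes>\<^sub>M borel)"
      by measurable
    then show ?thesis by (simp add: s space_pair_measure)
  qed
  have m: "(\<lambda>p. ennreal ((dist (fst p) (snd p))\<^sup>2)) \<in> borel_measurable \<gamma>"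
    using s by (simp cong: measurable_cong_sets)
  have "emeasure \<mu> A = emeasure \<gamma> (A \<times> UNIV)"
    using emeasure_coupling_fst[OF \<gamma>(1) A] by simp
  also have "\<dots> \<le> emeasure \<gamma> (UNIV \<times> ?U \<union> ?D)"
  proof (rule emeasure_mono)
    have "y \<in> ?U" if "x \<in> A" "\<not> e\<^sup>2 \<le> (dist x y)\<^sup>2" for x y
      using that e by (auto simp: not_le intro: power_less_imp_less_base)
    then show "A \<times> UNIV \<subseteq> UNIV \<times> ?U \<union> ?D" by auto
  qed (use U mD in \<open>auto simp: s\<close>)
  also have "\<dots> \<le> emeasure \<gamma> (UNIV \<times> ?U) + emeasure \<gamma> ?D"
    by (rule emeasure_subadditive) (use U mD in \<open>auto simp: s\<close>)
  also have "emeasure \<gamma> (UNIV \<times> ?U) = emeasure \<nu> ?U"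
    by (rule emeasure_coupling_snd[OF \<gamma>(1) U])
  also have "emeasure \<gamma> ?D \<le> ennreal (1 / e\<^sup>2) * coupling_cost \<gamma>"
  proof -
    have "emeasure \<gamma> {p \<in> space \<gamma>. 1 \<le> ennreal (1 / e\<^sup>2) * ennreal ((dist (fst p) (snd p))\<^sup>2)}
        \<le> ennreal (1 / e\<^sup>2) * (\<integral>\<^sup>+ p. ennreal ((dist (fst p) (snd p))\<^sup>2) * indicator (space \<gamma>) p \<partial>\<gamma>)"
      by (rule nn_integral_Markov_inequality) (use m sets.top[of \<gamma>] in \<open>simp_all add: sp\<close>)
    then show ?thesis unfolding D by (simp add: coupling_cost_def sp)
  qed
  also have "\<dots> \<le> ennreal (1 / e\<^sup>2) * ennreal (r\<^sup>2)"
    using \<gamma>(2) by (intro mult_left_mono) auto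
  also have "\<dots> = ennreal (r\<^sup>2 / e\<^sup>2)"
    by (simp add: ennreal_mult[symmetric])
  finally show ?thesis by (simp add: add_left_mono)
qed

section \<open>Gluing and the triangle inequality\<close>

text \<open>\<open>T x\<close> is the index of the first point of a dense sequence within
  \<open>e\<close> of \<open>x\<close>. One sequence serves all meshes, so that the empirical
  measures supported on it form a single countable family when separability is proved.\<close>

lemma small_partition:
  "\<exists>D :: nat \<Rightarrow> 'a::{metric_space, second_countable_topology}. \<forall>e>0. \<exists>T.
    T \<in> borel \<rightarrow>\<^sub>M count_space UNIV \<and> (\<forall>x. dist x (D (T x)) < e)"
proof -
  obtain D0 :: "'a set" where D0: "countable D0" "\<And>X. open X \<Longrightarrow> X \<noteq> {} \<Longrightarrow> \<exists>d\<in>D0. d \<in> X"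
    using countable_dense_setE by blast
  define D where "D = from_nat_into D0"
  have "\<exists>T. T \<in> borel \<rightarrow>\<^sub>M count_space UNIV \<and> (\<forall>x. dist x (D (T x)) < e)" if e: "e > 0" for e
  proof (intro exI conjI allI)
    show "(\<lambda>x. LEAST n. dist x (D n) < e) \<in> borel \<rightarrow>\<^sub>M count_space UNIV" by measurable
    fix x
    obtain d where "d \<in> D0" "d \<in> ball x e" using D0(2)[of "ball x e"] e by auto
    then have "\<exists>n. dist x (D n) < e"
      using from_nat_into_surj[OF D0(1)] unfolding D_def by (metis mem_ball)
    then show "dist x (D (LEAST n. dist x (D n) < e)) < e" by (rule LeastI_ex)
  qed
  then show ?thesis by blast
qed

text \<open>Cauchy-Schwarz with weights \<open>a\<close>, \<open>e\<close>, \<open>b\<close>; the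
  middle term is \<open>e\<^sup>2 / e\<close>. The right side is linear in the squares
  \<open>u\<^sup>2\<close> and \<open>v\<^sup>2\<close>, so it can be integrated term by term, and
  for costs at most \<open>a\<^sup>2\<close> and \<open>b\<^sup>2\<close> it becomes
  \<open>(a + e + b)\<^sup>2\<close>. This takes the place of Minkowski's inequality.\<close>

lemma weighted_square_le:
  fixes u v w a b e :: real
  assumes "0 < a" "0 < b" "0 < e" "0 \<le> u" "0 \<le> v" "0 \<le> w" "w \<le> u + e + v"
  shows "w\<^sup>2 \<le> (a + e + b) * (u\<^sup>2 / a + e + v\<^sup>2 / b)"
proof -
  have *: "2 * u * v \<le> b / a * u\<^sup>2 + a / b * v\<^sup>2" "2 * u * e \<le> e / a * u\<^sup>2 + a * e"
    "2 * v * e \<le> e / b * v\<^sup>2 + b * e"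
  proof -
    have "0 \<le> (b * u - a * v)\<^sup>2 / (a * b)" using assms by auto
    also have "\<dots> = b / a * u\<^sup>2 + a / b * v\<^sup>2 - 2 * u * v"
      using assms by (simp add: power2_eq_square field_simps)
    finally show "2 * u * v \<le> b / a * u\<^sup>2 + a / b * v\<^sup>2" by simp
    have "0 \<le> (u - a)\<^sup>2 * (e / a)" using assms by auto
    also have "\<dots> = e / a * u\<^sup>2 + a * e - 2 * u * e"
      using assms by (simp add: power2_eq_square field_simps)
    finally show "2 * u * e \<le> e / a * u\<^sup>2 + a * e" by simp
    have "0 \<le> (v - b)\<^sup>2 * (e / b)" using assms by auto
    also have "\<dots> = e / b * v\<^sup>2 + b * e - 2 * v * e"
      using assms by (simp add: power2_eq_square field_simps)
    finally show "2 * v * e \<le> e / b * v\<^sup>2 + b * e" by simp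
  qed
  have "w\<^sup>2 \<le> (u + e + v)\<^sup>2" using assms by (intro power_mono) auto
  also have "\<dots> = u\<^sup>2 + e\<^sup>2 + v\<^sup>2 + 2 * u * v + 2 * u * e + 2 * v * e"
    by (simp add: power2_eq_square algebra_simps)
  also have "\<dots> \<le> u\<^sup>2 + e\<^sup>2 + v\<^sup>2 + (b / a * u\<^sup>2 + a / b * v\<^sup>2) + (e / a * u\<^sup>2 + a * e) + (e / b * v\<^sup>2 + b * e)"
    using * by linarith
  also have "\<dots> = (a + e + b) * (u\<^sup>2 / a + e + v\<^sup>2 / b)"
    using assms by (simp add: power2_eq_square field_simps)
  finally show ?thesis .
qed

text \<open>Exact gluing of couplings would need disintegration. Since only infima of costs matter, it is
  enough to identify the two middle coordinates up to \<open>e\<close>, by making them conditionally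
  independent given the cell of a countable partition of small mesh.\<close>

lemma approximate_gluing:
  fixes \<mu> \<nu> \<rho> :: "'a::{metric_space, second_countable_topology} measure"
  assumes \<gamma>1: "\<gamma>1 \<in> couplings \<mu> \<nu>" and \<gamma>2: "\<gamma>2 \<in> couplings \<nu> \<rho>"
    and pos: "0 < a" "0 < b" "0 < e"
    and c1: "coupling_cost \<gamma>1 \<le> ennreal (a\<^sup>2)" and c2: "coupling_cost \<gamma>2 \<le> ennreal (b\<^sup>2)"
  shows "\<exists>\<gamma>\<in>couplings \<mu> \<rho>. coupling_cost \<gamma> \<le> ennreal ((a + e + b)\<^sup>2)"
proof -
  let ?B2 = "borel \<Otimes>\<^sub>M borel :: ('a \<times> 'a) measure"
  interpret g1: prob_space \<gamma>1 by (rule coupling_prob_space[OF \<gamma>1])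
  interpret g2: prob_space \<gamma>2 by (rule coupling_prob_space[OF \<gamma>2])
  interpret pair_sigma_finite \<gamma>1 \<gamma>2 ..
  have s1 [measurable_cong]: "sets \<gamma>1 = sets ?B2" by (rule sets_coupling[OF \<gamma>1])
  have s2 [measurable_cong]: "sets \<gamma>2 = sets ?B2" by (rule sets_coupling[OF \<gamma>2])
  have \<mu>: "\<mu> = distr \<gamma>1 borel fst" and \<nu>: "\<nu> = distr \<gamma>1 borel snd"
    and \<rho>: "\<rho> = distr \<gamma>2 borel snd"
    using \<gamma>1 \<gamma>2 by (simp_all add: couplings_def)
  have s\<nu> [measurable_cong]: "sets \<nu> = sets borel" by (simp add: \<nu>)
  have prob: "prob_space \<mu>" "prob_space \<nu>"
    unfolding \<mu> \<nu> by (rule g1.prob_space_distr; measurable)+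
  interpret n: prob_space \<nu> by (rule prob(2))
  obtain D :: "nat \<Rightarrow> 'a" where
    "\<forall>e>0. \<exists>T. T \<in> borel \<rightarrow>\<^sub>M count_space UNIV \<and> (\<forall>x. dist x (D (T x)) < e)"
    using small_partition by blast
  with half_gt_zero[OF pos(3)] obtain T where T [measurable]: "T \<in> borel \<rightarrow>\<^sub>M count_space UNIV"
    and DT: "\<And>x. dist x (D (T x)) < e / 2"
    by blast
  define m where "m k = emeasure \<nu> (T -` {k})" for k
  \<comment> \<open>Density with respect to the product of the two couplings. It charges only pairs
    whose middle points share a cell, and dividing by the mass of that cell restores both couplings
    as marginals.\<close>
  define w where "w p = (if T (snd (fst p)) = T (fst (snd p)) then 1 / m (T (snd (fst p))) else 0)"
    for p :: "('a \<times> 'a) \<times> ('a \<times> 'a)"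
  have mw [measurable]: "w \<in> borel_measurable (?B2 \<Otimes>\<^sub>M ?B2)"
  proof -
    have [measurable]: "m \<in> borel_measurable (count_space UNIV)" by simp
    have "Measurable.pred (?B2 \<Otimes>\<^sub>M ?B2) (\<lambda>p. \<exists>k. T (snd (fst p)) = k \<and> T (fst (snd p)) = k)"
      by measurable
    then have [measurable]: "Measurable.pred (?B2 \<Otimes>\<^sub>M ?B2) (\<lambda>p. T (snd (fst p)) = T (fst (snd p)))"
      by (simp add: eq_commute)
    show ?thesis unfolding w_def by measurable
  qed
  have mTk: "T -` {k} \<in> sets borel" for k
    using measurable_sets[OF T, of "{k}"] by simp
  have m_fin: "m k \<noteq> \<infinity>" for k unfolding m_def by (simp add: n.emeasure_finite)
  \<comment> \<open>On a null cell \<open>1 / m k\<close> is infinite, so such cells must be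
    discarded before the normalisation \<open>inv\<close> applies.\<close>
  have m_pos: "AE x in \<nu>. m (T x) \<noteq> 0"
  proof -
    have "AE x in \<nu>. \<forall>k. m k = 0 \<longrightarrow> T x \<noteq> k"
      unfolding AE_all_countable
    proof
      fix k
      show "AE x in \<nu>. m k = 0 \<longrightarrow> T x \<noteq> k"
      proof (cases "m k = 0")
        case True
        then have "T -` {k} \<in> null_sets \<nu>" using mTk by (simp add: m_def null_sets_def s\<nu>)
        from AE_not_in[OF this] show ?thesis by auto
      qed simp
    qed
    then show ?thesis by auto
  qed
  have m_pos1: "AE p in \<gamma>1. m (T (snd p)) \<noteq> 0"
    by (rule AE_distrD[of snd \<gamma>1 borel, folded \<nu>, OF _ m_pos]) measurable
  have m_pos2: "AE p in \<gamma>2. m (T (fst p)) \<noteq> 0"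
  proof -
    have "\<nu> = distr \<gamma>2 borel fst" using \<gamma>2 by (simp add: couplings_def)
    from AE_distrD[of fst \<gamma>2 borel, folded this, OF _ m_pos] show ?thesis by measurable
  qed
  define M where "M = density (\<gamma>1 \<Otimes>\<^sub>M \<gamma>2) w"
  have sM [measurable_cong]: "sets M = sets (?B2 \<Otimes>\<^sub>M ?B2)"
    by (simp add: M_def s1 s2 cong: sets_pair_measure_cong)
  have inv: "m k * (1 / m k) = 1" if "m k \<noteq> 0" for k
    using that m_fin[of k] by (simp add: ennreal_times_divide top.not_eq_extremum)
  have M1: "(\<integral>\<^sup>+ p. h (fst p) \<partial>M) = (\<integral>\<^sup>+ p. h p \<partial>\<gamma>1)" if [measurable]: "h \<in> borel_measurable ?B2" for h :: "'a \<times> 'a \<Rightarrow> ennreal"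
  proof -
    have "(\<integral>\<^sup>+ p. h (fst p) \<partial>M) = (\<integral>\<^sup>+ p. w p * h (fst p) \<partial>(\<gamma>1 \<Otimes>\<^sub>M \<gamma>2))"
      unfolding M_def by (rule nn_integral_density) measurable
    also have "\<dots> = (\<integral>\<^sup>+ p. \<integral>\<^sup>+ q. w (p, q) * h p \<partial>\<gamma>2 \<partial>\<gamma>1)"
      by (subst g2.nn_integral_fst[symmetric]) (auto, measurable)
    also have "\<dots> = (\<integral>\<^sup>+ p. h p \<partial>\<gamma>1)"
    proof (rule nn_integral_cong_AE, use m_pos1 in eventually_elim)
      fix p :: "'a \<times> 'a" assume p: "m (T (snd p)) \<noteq> 0"
      define A where "A = T -` {T (snd p)}"
      have A [measurable]: "A \<in> sets borel" and mA: "emeasure \<nu> A = m (T (snd p))"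
        by (simp_all add: A_def mTk m_def)
      have "(\<integral>\<^sup>+ q. w (p, q) * h p \<partial>\<gamma>2) = (\<integral>\<^sup>+ q. (h p * (1 / m (T (snd p)))) * indicator A (fst q) \<partial>\<gamma>2)"
        by (intro nn_integral_cong) (auto simp: w_def A_def indicator_def mult.commute)
      also have "\<dots> = (\<integral>\<^sup>+ y. (h p * (1 / m (T (snd p)))) * indicator A y \<partial>\<nu>)"
        by (intro nn_integral_coupling_fst[OF \<gamma>2]) measurable
      also have "\<dots> = h p * (m (T (snd p)) * (1 / m (T (snd p))))"
        using A by (subst nn_integral_cmult_indicator) (simp_all add: s\<nu> mA mult.commute mult.left_commute)
      finally show "(\<integral>\<^sup>+ q. w (p, q) * h p \<partial>\<gamma>2) = h p" using inv[OF p] by simp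
    qed
    finally show ?thesis .
  qed
  have M2: "(\<integral>\<^sup>+ p. h (snd p) \<partial>M) = (\<integral>\<^sup>+ p. h p \<partial>\<gamma>2)" if [measurable]: "h \<in> borel_measurable ?B2" for h :: "'a \<times> 'a \<Rightarrow> ennreal"
  proof -
    have "(\<integral>\<^sup>+ p. h (snd p) \<partial>M) = (\<integral>\<^sup>+ p. w p * h (snd p) \<partial>(\<gamma>1 \<Otimes>\<^sub>M \<gamma>2))"
      unfolding M_def by (rule nn_integral_density) measurable
    also have "\<dots> = (\<integral>\<^sup>+ q. \<integral>\<^sup>+ p. w (p, q) * h q \<partial>\<gamma>1 \<partial>\<gamma>2)"
      by (subst nn_integral_snd[symmetric]) (auto, measurable)
    also have "\<dots> = (\<integral>\<^sup>+ p. h p \<partial>\<gamma>2)"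
    proof (rule nn_integral_cong_AE, use m_pos2 in eventually_elim)
      fix q :: "'a \<times> 'a" assume q: "m (T (fst q)) \<noteq> 0"
      define A where "A = T -` {T (fst q)}"
      have A [measurable]: "A \<in> sets borel" and mA: "emeasure \<nu> A = m (T (fst q))"
        by (simp_all add: A_def mTk m_def)
      have "(\<integral>\<^sup>+ p. w (p, q) * h q \<partial>\<gamma>1) = (\<integral>\<^sup>+ p. (h q * (1 / m (T (fst q)))) * indicator A (snd p) \<partial>\<gamma>1)"
        by (intro nn_integral_cong) (auto simp: w_def A_def indicator_def mult.commute)
      also have "\<dots> = (\<integral>\<^sup>+ y. (h q * (1 / m (T (fst q)))) * indicator A y \<partial>\<nu>)"
        by (intro nn_integral_coupling_snd[OF \<gamma>1]) measurable
      also have "\<dots> = h q * (m (T (fst q)) * (1 / m (T (fst q))))"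
        using A by (subst nn_integral_cmult_indicator) (simp_all add: s\<nu> mA mult.commute mult.left_commute)
      finally show "(\<integral>\<^sup>+ p. w (p, q) * h q \<partial>\<gamma>1) = h q" using inv[OF q] by simp
    qed
    finally show ?thesis .
  qed
  define \<gamma> where "\<gamma> = distr M borel (\<lambda>p. (fst (fst p), snd (snd p)))"
  have mpr: "(\<lambda>p. (fst (fst p), snd (snd p))) \<in> M \<rightarrow>\<^sub>M borel"
    unfolding borel_prod[symmetric] by measurable
  have \<gamma>_int: "(\<integral>\<^sup>+ q. h q \<partial>\<gamma>) = (\<integral>\<^sup>+ p. h (fst (fst p), snd (snd p)) \<partial>M)"
    if "h \<in> borel_measurable borel" for h
    unfolding \<gamma>_def using mpr that by (intro nn_integral_distr) simp_all
  have "\<gamma> \<in> couplings \<mu> \<rho>"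
  proof (rule couplingsI)
    fix A :: "'a set" assume A [measurable]: "A \<in> sets borel"
    have "emeasure \<gamma> (A \<times> UNIV) = (\<integral>\<^sup>+ q. indicator (A \<times> UNIV) q \<partial>\<gamma>)"
      using Times_in_borel[OF A, of UNIV] by (simp add: \<gamma>_def)
    also have "\<dots> = (\<integral>\<^sup>+ p. indicator A (fst (fst p)) \<partial>M)"
      using Times_in_borel[OF A, of UNIV] by (subst \<gamma>_int) (simp_all add: indicator_times)
    also have "\<dots> = (\<integral>\<^sup>+ p. indicator A (fst p) \<partial>\<gamma>1)" by (rule M1) measurable
    also have "\<dots> = emeasure \<mu> A"
      using A by (subst nn_integral_coupling_fst[OF \<gamma>1]) (simp_all add: \<mu>)
    finally show "emeasure \<gamma> (A \<times> UNIV) = emeasure \<mu> A" .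
    have "emeasure \<gamma> (UNIV \<times> A) = (\<integral>\<^sup>+ q. indicator (UNIV \<times> A) q \<partial>\<gamma>)"
      using Times_in_borel[OF _ A, of UNIV] by (simp add: \<gamma>_def)
    also have "\<dots> = (\<integral>\<^sup>+ p. indicator A (snd (snd p)) \<partial>M)"
      using Times_in_borel[OF _ A, of UNIV] by (subst \<gamma>_int) (simp_all add: indicator_times)
    also have "\<dots> = (\<integral>\<^sup>+ p. indicator A (snd p) \<partial>\<gamma>2)" by (rule M2) measurable
    also have "\<dots> = emeasure \<rho> A"
      using A by (subst nn_integral_coupling_snd[OF \<gamma>2]) (simp_all add: \<rho>)
    finally show "emeasure \<gamma> (UNIV \<times> A) = emeasure \<rho> A" .
  qed (simp_all add: \<gamma>_def \<mu> \<rho> prob[unfolded \<mu>])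
  moreover have "coupling_cost \<gamma> \<le> ennreal ((a + e + b)\<^sup>2)"
  proof -
    let ?c = "\<lambda>q :: 'a \<times> 'a. ennreal ((dist (fst q) (snd q))\<^sup>2)"
    let ?s = "ennreal (a + e + b)"
    \<comment> \<open>The density \<open>w\<close> vanishes off the pairs with a common cell, so the
      two middle points are within \<open>e\<close> of each other almost everywhere.\<close>
    have AE: "AE p in M. T (snd (fst p)) = T (fst (snd p))"
      unfolding M_def by (subst AE_density) (auto simp: w_def split: if_splits)
    have "prob_space M"
      using M1[of "\<lambda>_. 1"] g1.emeasure_space_1 by (intro prob_spaceI) simp
    then have M_1: "emeasure M (space M) = 1" by (rule prob_space.emeasure_space_1)
    have "coupling_cost \<gamma> = (\<integral>\<^sup>+ p. ?c (fst (fst p), snd (snd p)) \<partial>M)"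
      unfolding coupling_cost_def by (rule \<gamma>_int) measurable
    also have "\<dots> \<le> (\<integral>\<^sup>+ p. ?s * (ennreal (1 / a) * ?c (fst p) + ennreal e + ennreal (1 / b) * ?c (snd p)) \<partial>M)"
    proof (rule nn_integral_mono_AE, use AE in eventually_elim)
      fix p :: "('a \<times> 'a) \<times> ('a \<times> 'a)" assume p: "T (snd (fst p)) = T (fst (snd p))"
      obtain x y y' z where q: "p = ((x, y), (y', z))" by (metis surj_pair)
      have "dist y y' \<le> dist y (D (T y)) + dist y' (D (T y))" by (rule dist_triangle2)
      also have "\<dots> \<le> e" using DT[of y] DT[of y'] p q by simp
      finally have "dist y y' \<le> e" .
      then have "dist x z \<le> dist x y + e + dist y' z"
        using dist_triangle[of x z y] dist_triangle[of y z y'] by linarith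
      then have "(dist x z)\<^sup>2 \<le> (a + e + b) * ((dist x y)\<^sup>2 / a + e + (dist y' z)\<^sup>2 / b)"
        using pos by (intro weighted_square_le) auto
      then have "ennreal ((dist x z)\<^sup>2) \<le> ennreal ((a + e + b) * ((dist x y)\<^sup>2 / a + e + (dist y' z)\<^sup>2 / b))"
        by (rule ennreal_leI)
      also have "\<dots> = ?s * (ennreal (1 / a) * ennreal ((dist x y)\<^sup>2) + ennreal e + ennreal (1 / b) * ennreal ((dist y' z)\<^sup>2))"
        using pos by (simp add: ennreal_mult ennreal_plus flip: ennreal_mult')
      finally show "?c (fst (fst p), snd (snd p)) \<le> ?s * (ennreal (1 / a) * ?c (fst p) + ennreal e + ennreal (1 / b) * ?c (snd p))"
        by (simp add: q)
    qed
    also have "\<dots> = ?s * (ennreal (1 / a) * coupling_cost \<gamma>1 + ennreal e + ennreal (1 / b) * coupling_cost \<gamma>2)"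
      using M1[of ?c] M2[of ?c] M_1
      by (simp add: nn_integral_cmult nn_integral_add coupling_cost_def)
    also have "\<dots> \<le> ?s * (ennreal (1 / a) * ennreal (a\<^sup>2) + ennreal e + ennreal (1 / b) * ennreal (b\<^sup>2))"
      using c1 c2 by (intro mult_left_mono add_mono) auto
    also have "\<dots> = ennreal ((a + e + b)\<^sup>2)"
      using pos by (simp add: power2_eq_square flip: ennreal_mult' ennreal_plus)
    finally show ?thesis .
  qed
  ultimately show ?thesis by blast
qed

lemma W2_triangle:
  fixes \<mu> \<nu> \<rho> :: "'a::{metric_space, second_countable_topology} measure"
  shows "W2 \<mu> \<rho> \<le> W2 \<mu> \<nu> + W2 \<nu> \<rho>"
proof (rule ennreal_le_epsilon)
  fix e :: real
  assume fin: "W2 \<mu> \<nu> + W2 \<nu> \<rho> < top" and e: "0 < e"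
  obtain u where u: "W2 \<mu> \<nu> = ennreal u" "u \<ge> 0" using fin by (cases "W2 \<mu> \<nu>") auto
  obtain v where v: "W2 \<nu> \<rho> = ennreal v" "v \<ge> 0" using fin by (cases "W2 \<nu> \<rho>") auto
  \<comment> \<open>The extra \<open>e / 4\<close> keeps the weights positive even at distance 0.
    Together with the mesh \<open>e / 4\<close> it spends three quarters of \<open>e\<close>, which
    leaves the final inequality strict.\<close>
  define a where "a = u + e / 4"
  define b where "b = v + e / 4"
  have ab: "a > 0" "b > 0" "u < a" "v < b" using e u v by (auto simp: a_def b_def)
  obtain \<gamma>1 where \<gamma>1: "\<gamma>1 \<in> couplings \<mu> \<nu>" "coupling_cost \<gamma>1 < ennreal (a\<^sup>2)"
    using W2_less_iff[of a \<mu> \<nu>] ab u by (auto simp: ennreal_less_iff)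
  obtain \<gamma>2 where \<gamma>2: "\<gamma>2 \<in> couplings \<nu> \<rho>" "coupling_cost \<gamma>2 < ennreal (b\<^sup>2)"
    using W2_less_iff[of b \<nu> \<rho>] ab v by (auto simp: ennreal_less_iff)
  obtain \<gamma> where \<gamma>: "\<gamma> \<in> couplings \<mu> \<rho>" "coupling_cost \<gamma> \<le> ennreal ((a + e / 4 + b)\<^sup>2)"
    using approximate_gluing[OF \<gamma>1(1) \<gamma>2(1) ab(1,2), of "e / 4"] \<gamma>1(2) \<gamma>2(2) e
    by (auto simp: less_imp_le)
  note \<gamma>(2)
  also have "ennreal ((a + e / 4 + b)\<^sup>2) < ennreal ((u + v + e)\<^sup>2)"
    using ab e u v by (intro ennreal_lessI power_strict_mono) (auto simp: a_def b_def)
  finally have "W2 \<mu> \<rho> < ennreal (u + v + e)"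
    using u v e by (intro W2_lessI[OF \<gamma>(1)]) auto
  then show "W2 \<mu> \<rho> \<le> W2 \<mu> \<nu> + W2 \<nu> \<rho> + ennreal e"
    using u v e by simp
qed

section \<open>Upper semicontinuity of masses of closed sets, and separation of measures\<close>

lemma INT_thickenings:
  fixes F :: "'a::metric_space set"
  assumes "closed F"
  shows "(\<Inter>n. \<Union>x\<in>F. ball x (1 / Suc n)) = F"
proof
  show "(\<Inter>n. \<Union>x\<in>F. ball x (1 / Suc n)) \<subseteq> F"
  proof
    fix y assume y: "y \<in> (\<Inter>n. \<Union>x\<in>F. ball x (1 / Suc n))"
    have "\<exists>x\<in>F. dist x y < e" if e: "e > 0" for e
    proof -
      obtain n where "1 / Suc n < e" by (rule nat_approx_posE[OF e])
      moreover obtain x where "x \<in> F" "dist x y < 1 / Suc n" using y by (force simp del: of_nat_Suc)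
      ultimately show ?thesis using less_trans by blast
    qed
    then show "y \<in> F" using closure_approachable[of y F] assms by auto
  qed
  show "F \<subseteq> (\<Inter>n. \<Union>x\<in>F. ball x (1 / Suc n))"
    by (intro INT_greatest subsetI UN_I) (assumption, simp)
qed

lemma emeasure_thickening_tendsto:
  fixes \<nu> :: "'a::metric_space measure"
  assumes "\<nu> \<in> prob_measures" "closed F"
  shows "(\<lambda>n. emeasure \<nu> (\<Union>x\<in>F. ball x (1 / Suc n))) \<longlonglongrightarrow> emeasure \<nu> F"
proof -
  note \<nu> = prob_measuresD[OF assms(1)]
  interpret prob_space \<nu> by fact
  have "(\<lambda>n. emeasure \<nu> (\<Union>x\<in>F. ball x (1 / Suc n))) \<longlonglongrightarrow>
      emeasure \<nu> (\<Inter>n. \<Union>x\<in>F. ball x (1 / Suc n))"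
  proof (rule Lim_emeasure_decseq)
    show "range (\<lambda>n. \<Union>x\<in>F. ball x (1 / Suc n)) \<subseteq> sets \<nu>"
      unfolding \<nu> by (auto intro!: borel_open)
    show "decseq (\<lambda>n. \<Union>x\<in>F. ball x (1 / Suc n))"
      by (intro decseq_SucI UN_mono subset_ball frac_le) auto
  qed (simp add: emeasure_finite)
  then show ?thesis by (simp only: INT_thickenings[OF assms(2)])
qed

text \<open>The mass of a closed set is the limit of the masses of its thickenings, and a thickening
  absorbs small displacements. Consequently the sets where a closed set has mass below
  \<open>t\<close> are \<open>W2\<close>-open.\<close>

lemma closed_emeasure_upper_semicontinuous:
  fixes \<nu> :: "'a::{metric_space, second_countable_topology} measure"
  assumes \<nu>: "\<nu> \<in> prob_measures" and F: "closed F" and t: "emeasure \<nu> F < t"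
  shows "\<exists>r>0. \<forall>\<mu>. W2 \<mu> \<nu> < ennreal r \<longrightarrow> emeasure \<mu> F < t"
proof -
  obtain s where s: "emeasure \<nu> F < s" "s < t" using t dense by blast
  obtain n where n: "emeasure \<nu> (\<Union>x\<in>F. ball x (1 / Suc n)) < s"
    using order_tendstoD(2)[OF emeasure_thickening_tendsto[OF \<nu> F] s(1)]
    by (auto dest: eventually_happens)
  obtain s' where s': "s = ennreal s'" "s' \<ge> 0"
    using s(2) by (cases s) auto
  obtain t' where t': "ennreal t' \<le> t" "s' < t'"
  proof (cases t)
    case (real t')
    then show thesis using s s' that[of t'] by (auto simp: ennreal_less_iff)
  next
    case top
    then show thesis using that[of "s' + 1"] by simp
  qed
  define e where "e = 1 / real (Suc n)"
  have e: "e > 0" by (simp add: e_def)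
  \<comment> \<open>Chosen so that the Markov error \<open>r\<^sup>2 / e\<^sup>2\<close> equals the
    available gap \<open>t' - s'\<close>.\<close>
  define r where "r = e * sqrt (t' - s')"
  have r: "r > 0" using e t' by (simp add: r_def)
  have "emeasure \<mu> F < t" if "W2 \<mu> \<nu> < ennreal r" for \<mu>
  proof -
    have "emeasure \<mu> F \<le> emeasure \<nu> (\<Union>x\<in>F. ball x e) + ennreal (r\<^sup>2 / e\<^sup>2)"
      using that r e F by (intro emeasure_le_emeasure_thickening) auto
    also have "\<dots> < ennreal s' + ennreal (r\<^sup>2 / e\<^sup>2)"
      using n s' by (subst add.commute, subst (2) add.commute) (simp add: e_def ennreal_add_left_cancel_less)
    also have "\<dots> = ennreal t'"
      using s' t' e by (simp add: r_def power_mult_distrib flip: ennreal_plus)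
    finally show ?thesis using t' by simp
  qed
  then show ?thesis using r by blast
qed

lemma W2_eq_0D:
  fixes \<mu> \<nu> :: "'a::{metric_space, second_countable_topology} measure"
  assumes \<mu>: "\<mu> \<in> prob_measures" and \<nu>: "\<nu> \<in> prob_measures" and "W2 \<mu> \<nu> = 0"
  shows "\<mu> = \<nu>"
proof -
  have le: "emeasure \<mu> F \<le> emeasure \<nu> F"
    if W: "W2 \<mu> \<nu> = 0" and \<nu>: "\<nu> \<in> prob_measures" and F: "closed F" for \<mu> \<nu> :: "'a measure" and F
  proof (rule ccontr)
    assume "\<not> ?thesis"
    \<comment> \<open>Upper semicontinuity is applied with the threshold
      \<open>emeasure \<mu> F\<close> itself: \<open>\<mu>\<close> lies in every ball about
      \<open>\<nu>\<close>, so its own mass would be strictly below itself.\<close>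
    then obtain r where "r > 0" "W2 \<mu> \<nu> < ennreal r \<Longrightarrow> emeasure \<mu> F < emeasure \<mu> F"
      using closed_emeasure_upper_semicontinuous[OF \<nu> F] by (meson not_le)
    then show False using W by simp
  qed
  show ?thesis
  proof (rule measure_eqI_generator_eq[where E = "Collect closed" and \<Omega> = UNIV and A = "\<lambda>_. UNIV"])
    fix F :: "'a set" assume "F \<in> Collect closed"
    then show "emeasure \<mu> F = emeasure \<nu> F"
      using le[of \<mu> \<nu> F] le[of \<nu> \<mu> F] assms W2_commute[of \<nu> \<mu>] by (simp add: antisym)
  next
    interpret prob_space \<mu> using prob_measuresD[OF \<mu>] by simp
    show "emeasure \<mu> UNIV \<noteq> \<infinity>" by (simp add: emeasure_finite)
  qed (use prob_measuresD[OF \<mu>] prob_measuresD[OF \<nu>] in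
      \<open>auto simp: Int_stable_def borel_eq_closed intro!: closed_Int\<close>)
qed

lemma ext_metric_W2:
  "ext_metric (prob_measures :: 'a::{metric_space, second_countable_topology} measure set) W2"
  unfolding ext_metric_def by (auto intro: W2_refl W2_eq_0D W2_commute W2_triangle)

section \<open>Empirical measures and the Borel sets of \<open>W2\<close>\<close>

abbreviation W2_borel :: "'a::metric_space measure measure" where
  "W2_borel \<equiv> metric_borel prob_measures W2"

lemma space_metric_borel [simp]: "space (metric_borel X d) = X"
  unfolding metric_borel_def by (rule space_measure_of) auto

lemma sets_metric_borel:
  "sets (metric_borel X d) =
    sigma_sets X {U. U \<subseteq> X \<and> (\<forall>x\<in>U. \<exists>r>0. \<forall>y\<in>X. d x y < r \<longrightarrow> y \<in> U)}"
  unfolding metric_borel_def by (rule sets_measure_of) auto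

lemma metric_borel_openI:
  assumes "U \<subseteq> X" "\<And>x. x \<in> U \<Longrightarrow> \<exists>r>0. \<forall>y\<in>X. d x y < r \<longrightarrow> y \<in> U"
  shows "U \<in> sets (metric_borel X d)"
  unfolding sets_metric_borel using assms by (intro sigma_sets.Basic) blast

text \<open>Sublevel sets are open by the triangle inequality, the radius
  \<open>c - W2 \<mu> \<nu>\<close> possibly being infinite. One argument is fixed on purpose:
  openness in the product would not give measurability for the product sigma-algebra.\<close>

lemma W2_measurable [measurable]:
  fixes \<nu> :: "'a::{metric_space, second_countable_topology} measure"
  shows "(\<lambda>\<mu>. W2 \<mu> \<nu>) \<in> borel_measurable W2_borel"
proof (rule borel_measurableI_less)
  fix c :: ennreal
  have "{\<mu> \<in> prob_measures. W2 \<mu> \<nu> < c} \<in> sets W2_borel"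
  proof (rule metric_borel_openI)
    fix \<mu> assume "\<mu> \<in> {\<mu> \<in> prob_measures. W2 \<mu> \<nu> < c}"
    then have \<mu>: "W2 \<mu> \<nu> < c" by simp
    show "\<exists>r>0. \<forall>y\<in>prob_measures. W2 \<mu> y < r \<longrightarrow> y \<in> {\<mu> \<in> prob_measures. W2 \<mu> \<nu> < c}"
    proof (intro exI[of _ "c - W2 \<mu> \<nu>"] conjI ballI impI CollectI)
      show "0 < c - W2 \<mu> \<nu>" using \<mu> by (simp add: diff_gr0_ennreal)
      fix y assume y: "W2 \<mu> y < c - W2 \<mu> \<nu>"
      have "W2 y \<nu> \<le> W2 \<mu> \<nu> + W2 \<mu> y"
        using W2_triangle[of y \<nu> \<mu>] W2_commute[of y \<mu>] by (simp add: add.commute)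
      also have "\<dots> < W2 \<mu> \<nu> + (c - W2 \<mu> \<nu>)"
        using y \<mu> by (simp add: ennreal_add_left_cancel_less top.not_eq_extremum less_le_trans[OF \<mu> top_greatest])
      also have "\<dots> = c" using \<mu> by (simp add: less_imp_le)
      finally show "W2 y \<nu> < c" .
    qed
  qed auto
  then show "{x \<in> space W2_borel. W2 x \<nu> < c} \<in> sets W2_borel" by simp
qed

lemma singleton_in_W2_borel:
  fixes \<nu> :: "'a::{metric_space, second_countable_topology} measure"
  assumes "\<nu> \<in> prob_measures"
  shows "{\<nu>} \<in> sets W2_borel"
proof -
  have "{\<mu> \<in> space W2_borel. W2 \<mu> \<nu> = 0} \<in> sets W2_borel" by measurable
  also have "{\<mu> \<in> space W2_borel. W2 \<mu> \<nu> = 0} = {\<nu>}"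
    using assms by (auto intro: W2_eq_0D W2_refl)
  finally show ?thesis .
qed

lemma space_prob_algebra_borel: "space (prob_algebra borel) = prob_measures"
  by (auto simp: space_prob_algebra prob_measures_def)

text \<open>The half of the comparison of sigma-algebras that is valid on all of P(S): evaluations
  at closed sets have open sublevel sets, and closed sets generate the Borel sets. The converse is
  \<open>W2_borel_Int_empirical\<close>, on empirical measures only.\<close>

lemma id_measurable_W2_prob_algebra:
  "(\<lambda>\<mu>. \<mu>) \<in> (W2_borel :: 'a::{metric_space, second_countable_topology} measure measure) \<rightarrow>\<^sub>M prob_algebra borel"
proof (rule measurable_prob_algebra_generated)
  show "sets borel = sigma_sets UNIV (Collect closed :: 'a set set)"
    by (simp add: borel_eq_closed)
  show "(\<lambda>\<mu>. emeasure \<mu> F) \<in> borel_measurable (W2_borel :: 'a measure measure)"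
    if "F \<in> Collect closed" for F
  proof (rule borel_measurableI_less)
    fix t :: ennreal
    have "{\<mu> \<in> prob_measures. emeasure \<mu> F < t} \<in> sets W2_borel"
    proof (rule metric_borel_openI)
      fix \<nu> assume "\<nu> \<in> {\<mu> \<in> prob_measures. emeasure \<mu> F < t}"
      then have \<nu>: "\<nu> \<in> prob_measures" "emeasure \<nu> F < t" by simp_all
      from that have "closed F" by simp
      from closed_emeasure_upper_semicontinuous[OF \<nu>(1) this \<nu>(2)]
      obtain r where "r > 0" "\<And>\<mu>. W2 \<mu> \<nu> < ennreal r \<Longrightarrow> emeasure \<mu> F < t"
        by blast
      then show "\<exists>r>0. \<forall>y\<in>prob_measures. W2 \<nu> y < r \<longrightarrow> y \<in> {\<mu> \<in> prob_measures. emeasure \<mu> F < t}"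
        by (intro exI[of _ "ennreal r"]) (simp add: W2_commute)
    qed auto
    then show "{x \<in> space W2_borel. emeasure x F < t} \<in> sets W2_borel" by simp
  qed
qed (auto simp: Int_stable_def prob_measures_def)

section \<open>Integrals against empirical measures and distances between them\<close>

lemma space_empirical [simp]: "space (empirical N z) = UNIV"
  using sets_eq_imp_space_eq[OF sets_empirical] by simp

lemma emeasure_empirical_indicator:
  assumes "A \<in> sets borel"
  shows "emeasure (empirical N z) A = (\<Sum>i<N. indicator A (z i)) / of_nat N"
  using assms by (simp add: emeasure_empirical)

lemma empirical_in_prob_measures:
  assumes "N > 0"
  shows "empirical N z \<in> prob_measures"
proof -
  have "emeasure (empirical N z) UNIV = 1"
    using assms by (simp add: emeasure_empirical ennreal_divide_self of_nat_less_top)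
  then show ?thesis
    by (auto simp: prob_measures_def intro!: prob_spaceI)
qed

lemma empirical_measures_subset: "N > 0 \<Longrightarrow> empirical_measures N \<subseteq> prob_measures"
  by (auto simp: empirical_measures_def intro: empirical_in_prob_measures)

text \<open>Outside the finite set of atoms the measure is null, so any \<open>f\<close> agrees
  almost everywhere with a finite combination of indicators of points. Measurability of
  \<open>f\<close> is deliberately absent: the integrand inside \<open>lifted_rate\<close> involves
  \<open>move_mass\<close> at all points, where none has been established.\<close>

lemma nn_integral_empirical:
  fixes z :: "nat \<Rightarrow> 'a::t1_space"
  shows "(\<integral>\<^sup>+ x. f x \<partial>empirical N z) = (\<Sum>i<N. f (z i)) / of_nat N"
proof -
  let ?E = "empirical N z" and ?Z = "z ` {..<N}"
  have Z: "- ?Z \<in> sets borel"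
    using finite_imp_closed[of ?Z] by (intro borel_open) (simp add: open_Compl)
  have "- ?Z \<in> null_sets ?E"
    using Z by (auto simp: null_sets_def emeasure_empirical_indicator)
  then have "AE x in ?E. x \<notin> - ?Z" by (rule AE_not_in)
  then have "AE x in ?E. f x = (\<Sum>a\<in>?Z. f a * indicator {a} x)"
  proof eventually_elim
    case (elim x)
    have "(\<Sum>a\<in>?Z. f a * indicator {a} x) = (\<Sum>a\<in>?Z. if a = x then f x else 0)"
      by (intro sum.cong) auto
    then show ?case using elim by simp
  qed
  then have "(\<integral>\<^sup>+ x. f x \<partial>?E) = (\<integral>\<^sup>+ x. (\<Sum>a\<in>?Z. f a * indicator {a} x) \<partial>?E)"
    by (rule nn_integral_cong_AE)
  also have "\<dots> = (\<Sum>a\<in>?Z. f a * emeasure ?E {a})"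
    by (subst nn_integral_sum)
      (auto simp: nn_integral_cmult_indicator intro!: borel_measurable_times_ennreal borel_measurable_indicator)
  also have "\<dots> = (\<Sum>a\<in>?Z. \<Sum>i<N. f a * indicator {a} (z i)) / of_nat N"
    by (simp add: emeasure_empirical_indicator divide_ennreal_def sum_distrib_left sum_distrib_right mult_ac)
  also have "(\<Sum>a\<in>?Z. \<Sum>i<N. f a * indicator {a} (z i)) = (\<Sum>i<N. \<Sum>a\<in>?Z. f a * indicator {a} (z i))"
    by (rule sum.swap)
  also have "\<dots> = (\<Sum>i<N. f (z i))"
  proof (rule sum.cong)
    fix i assume "i \<in> {..<N}"
    have "(\<Sum>a\<in>?Z. f a * indicator {a} (z i)) = (\<Sum>a\<in>?Z. if a = z i then f (z i) else 0)"
      by (intro sum.cong) auto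
    then show "(\<Sum>a\<in>?Z. f a * indicator {a} (z i)) = f (z i)" using \<open>i \<in> {..<N}\<close> by simp
  qed simp
  finally show ?thesis .
qed

text \<open>Matching atoms with equal index is a coupling, and that coupling is itself an empirical
  measure on the product space.\<close>

lemma W2_empirical_squared_le:
  fixes z w :: "nat \<Rightarrow> 'a::{metric_space, second_countable_topology}"
  assumes N: "N > 0"
  shows "(W2 (empirical N z) (empirical N w))\<^sup>2 \<le> (\<Sum>i<N. ennreal ((dist (z i) (w i))\<^sup>2)) / of_nat N"
proof -
  let ?\<gamma> = "empirical N (\<lambda>i. (z i, w i))"
  have "?\<gamma> \<in> couplings (empirical N z) (empirical N w)"
    using prob_measuresD(1)[OF empirical_in_prob_measures[OF N]]
    by (intro couplingsI)
      (simp_all add: emeasure_empirical_indicator Times_in_borel indicator_times)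
  from W2_squared_le[OF this] show ?thesis
    by (simp add: coupling_cost_def nn_integral_empirical)
qed

lemma W2_empirical_less:
  fixes z w :: "nat \<Rightarrow> 'a::{metric_space, second_countable_topology}"
  assumes N: "N > 0" and r: "r > 0" and d: "\<And>i. i < N \<Longrightarrow> dist (z i) (w i) < r"
  shows "W2 (empirical N z) (empirical N w) \<le> ennreal r"
proof -
  have "(W2 (empirical N z) (empirical N w))\<^sup>2 \<le> (\<Sum>i<N. ennreal ((dist (z i) (w i))\<^sup>2)) / of_nat N"
    by (rule W2_empirical_squared_le[OF N])
  also have "\<dots> \<le> (\<Sum>i<N. ennreal (r\<^sup>2)) / of_nat N"
    using d by (intro divide_right_mono_ennreal sum_mono ennreal_leI power_mono) (auto simp: less_imp_le)
  also have "\<dots> = ennreal (r\<^sup>2)"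
    using N by (simp add: mult_divide_eq_ennreal mult.commute[of "of_nat N"])
  finally have "(W2 (empirical N z) (empirical N w))\<^sup>2 \<le> (ennreal r)\<^sup>2"
    using r by (simp add: ennreal_power)
  then show ?thesis
    using r by (cases "W2 (empirical N z) (empirical N w)") (auto simp: ennreal_power abs_le_square_iff[symmetric] top_unique)
qed

section \<open>Coincidence of the two sigma-algebras on empirical measures\<close>

lemma empirical_permute:
  assumes "bij_betw h {..<N} {..<N}"
  shows "empirical N (\<lambda>i. z (h i)) = empirical N z"
  by (rule measure_eqI)
    (simp_all add: emeasure_empirical_indicator sum.reindex_bij_betw[OF assms, of "\<lambda>i. indicator _ (z i)"])

text \<open>The relabelling injects each fibre of \<open>B\<close> into the indices of the points lying in that set.\<close>

lemma empirical_relabel: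
  fixes B :: "nat \<Rightarrow> 'a::topological_space set"
  assumes disj: "\<And>i j. i < N \<Longrightarrow> j < N \<Longrightarrow> B i = B j \<or> B i \<inter> B j = {}"
    and card: "\<And>i. i < N \<Longrightarrow> card {j\<in>{..<N}. B j = B i} \<le> card {k\<in>{..<N}. w k \<in> B i}"
  shows "\<exists>v. empirical N v = empirical N w \<and> (\<forall>i<N. v i \<in> B i)"
proof -
  have "\<forall>S\<in>B ` {..<N}. \<exists>f. f ` {j\<in>{..<N}. B j = S} \<subseteq> {k\<in>{..<N}. w k \<in> S} \<and>
      inj_on f {j\<in>{..<N}. B j = S}"
    using card by (auto intro!: card_le_inj)
  from bchoice[OF this]
  obtain h where "\<forall>S\<in>B ` {..<N}. h S ` {j\<in>{..<N}. B j = S} \<subseteq> {k\<in>{..<N}. w k \<in> S} \<and>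
      inj_on (h S) {j\<in>{..<N}. B j = S}"
    by blast
  then have h: "h (B i) ` {j\<in>{..<N}. B j = B i} \<subseteq> {k\<in>{..<N}. w k \<in> B i}"
    "inj_on (h (B i)) {j\<in>{..<N}. B j = B i}" if "i < N" for i
    using that by simp_all
  define g where "g i = h (B i) i" for i
  have g: "g i < N" "w (g i) \<in> B i" if "i < N" for i
    using h(1)[OF that] that by (auto simp: g_def)
  have "inj_on g {..<N}"
  proof (rule inj_onI)
    fix i j assume ij: "i \<in> {..<N}" "j \<in> {..<N}" "g i = g j"
    then have "w (g i) \<in> B i \<inter> B j" using g(2)[of i] g(2)[of j] by simp
    then have "B i = B j" using disj[of i j] ij by auto
    then show "i = j" using h(2)[of i] ij by (auto simp: g_def inj_on_def)
  qed
  then have "bij_betw g {..<N} {..<N}"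
    using g(1) by (intro bij_betw_imageI endo_inj_surj) auto
  then show ?thesis using empirical_permute[of g N w] g(2) by blast
qed

lemma emeasure_empirical_card:
  assumes "A \<in> sets borel" "N > 0"
  shows "of_nat N * emeasure (empirical N z) A = of_nat (card {i\<in>{..<N}. z i \<in> A})"
proof -
  have "(\<Sum>i<N. indicator A (z i) :: ennreal) = of_nat (card {i\<in>{..<N}. z i \<in> A})"
    by (simp add: indicator_def sum.If_cases Int_def)
  then show ?thesis
    using assms by (simp add: emeasure_empirical_indicator ennreal_times_divide mult_divide_eq_ennreal mult.commute[of "of_nat N"])
qed


text \<open>Balls of radius at most half the least distance between distinct atoms cannot meet, and
  each contains a basic neighbourhood of its centre.\<close>

lemma separating_basis_sets:
  fixes z :: "nat \<Rightarrow> 'a::metric_space"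
  assumes basis: "topological_basis \<B>" and e: "e > 0"
  shows "\<exists>B. (\<forall>i<N. B i \<in> \<B> \<and> z i \<in> B i \<and> B i \<subseteq> ball (z i) e) \<and>
    (\<forall>i<N. \<forall>j<N. B i = B j \<or> B i \<inter> B j = {}) \<and> (\<forall>i<N. \<forall>j<N. B i = B j \<longleftrightarrow> z i = z j)"
proof -
  define \<Delta> where "\<Delta> = (\<lambda>(x, y). dist x y / 2) ` {(x, y) \<in> z ` {..<N} \<times> z ` {..<N}. x \<noteq> y}"
  define \<delta> where "\<delta> = Min (insert e \<Delta>)"
  have fin: "finite (insert e \<Delta>)"
  proof -
    have "finite {(x, y) \<in> z ` {..<N} \<times> z ` {..<N}. x \<noteq> y}"
      by (rule finite_subset[of _ "z ` {..<N} \<times> z ` {..<N}"]) auto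
    then show ?thesis by (simp add: \<Delta>_def)
  qed
  have \<delta>: "\<delta> > 0" unfolding \<delta>_def by (subst Min_gr_iff[OF fin]) (auto simp: \<Delta>_def e)
  have \<delta>e: "\<delta> \<le> e" unfolding \<delta>_def by (rule Min_le[OF fin]) simp
  have \<delta>d: "2 * \<delta> \<le> dist (z i) (z j)" if "i < N" "j < N" "z i \<noteq> z j" for i j
  proof -
    have "dist (z i) (z j) / 2 \<in> insert e \<Delta>" using that by (auto simp: \<Delta>_def)
    from Min_le[OF fin this] show ?thesis by (simp add: \<delta>_def)
  qed
  have "\<forall>x. \<exists>B. B \<in> \<B> \<and> x \<in> B \<and> B \<subseteq> ball x \<delta>"
    using topological_basisE[OF basis open_ball] \<delta> by (metis centre_in_ball)
  \<comment> \<open>The neighbourhood is a function of the point, not of the index, so coinciding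
    atoms receive the same set and multiplicities can be counted.\<close>
  then obtain f where f: "f x \<in> \<B>" "x \<in> f x" "f x \<subseteq> ball x \<delta>" for x by metis
  have disj: "f (z i) \<inter> f (z j) = {}" if "i < N" "j < N" "z i \<noteq> z j" for i j
  proof (rule ccontr)
    assume "f (z i) \<inter> f (z j) \<noteq> {}"
    then obtain y where "y \<in> f (z i)" "y \<in> f (z j)" by blast
    then have "dist (z i) y < \<delta>" "dist (z j) y < \<delta>"
      using f(3)[of "z i"] f(3)[of "z j"] by auto
    then show False using \<delta>d[OF that] dist_triangle2[of "z i" "z j" y] by linarith
  qed
  have "f (z i) = f (z j) \<longleftrightarrow> z i = z j" if "i < N" "j < N" for i j
    using disj[OF that] f(2)[of "z i"] by auto
  moreover have "f (z i) \<subseteq> ball (z i) e" for i using f(3)[of "z i"] \<delta>e by auto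
  ultimately show ?thesis
    using f disj by (intro exI[of _ "\<lambda>i. f (z i)"]) blast
qed

text \<open>Within the range of \<open>empirical N\<close>, a point of a \<open>W2\<close>-open set has a neighbourhood given by lower
  bounds on the masses of finitely many basic open sets.\<close>

lemma W2_open_Int_empirical:
  fixes U :: "'a::{metric_space, second_countable_topology} measure set"
  assumes N: "N > 0" and U: "U \<subseteq> prob_measures"
    "\<And>\<nu>. \<nu> \<in> U \<Longrightarrow> \<exists>r>0. \<forall>\<mu>\<in>prob_measures. W2 \<nu> \<mu> < r \<longrightarrow> \<mu> \<in> U"
  shows "\<exists>V\<in>sets (prob_algebra borel). U \<inter> empirical_measures N = V \<inter> empirical_measures N"
proof -
  obtain \<B> :: "'a set set" where \<B>: "countable \<B>" "topological_basis \<B>"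
    using ex_countable_basis by blast
  have \<B>_borel: "B \<in> sets borel" if "B \<in> \<B>" for B
    using topological_basis_open[OF \<B>(2) that] by simp
  \<comment> \<open>Tuples of basic sets such that every choice of one atom per set gives an element
    of \<open>U\<close>. There are only countably many, because the sets come from a countable basis
    and \<open>PiE\<close> fixes the values beyond \<open>N\<close>.\<close>
  define \<F> where "\<F> = {B \<in> {..<N} \<rightarrow>\<^sub>E \<B>. (\<forall>i<N. \<forall>j<N. B i = B j \<or> B i \<inter> B j = {}) \<and>
      (\<forall>w. (\<forall>i<N. w i \<in> B i) \<longrightarrow> empirical N w \<in> U)}"
  have "countable ({..<N} \<rightarrow>\<^sub>E \<B>)" using \<B>(1) by (intro countable_PiE) auto
  then have cF: "countable \<F>" by (rule countable_subset[rotated]) (auto simp: \<F>_def)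
  \<comment> \<open>Each basic set must carry at least as many atoms as there are indices assigned
    to it. This condition uses masses only, and for an empirical measure it permits a relabelling
    that puts the i-th atom in \<open>B i\<close>.\<close>
  define C where "C B = {\<nu> \<in> space (prob_algebra borel). \<forall>i\<in>{..<N}.
      of_nat (card {j\<in>{..<N}. B j = B i}) \<le> of_nat N * emeasure \<nu> (B i)}" for B :: "nat \<Rightarrow> 'a set"
  have C: "C B \<in> sets (prob_algebra borel)" if "B \<in> \<F>" for B
  proof -
    have "(\<lambda>\<nu>. emeasure \<nu> (B i)) \<in> borel_measurable (prob_algebra borel)" if "i \<in> {..<N}" for i
    proof -
      have "B i \<in> sets borel" using \<open>B \<in> \<F>\<close> that \<B>_borel by (auto simp: \<F>_def)
      from measurable_compose[OF measurable_prob_algebraD[OF measurable_ident] measurable_emeasure_subprob_algebra[OF this]]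
      show ?thesis by simp
    qed
    then show ?thesis unfolding C_def by measurable
  qed
  have "U \<inter> empirical_measures N = (\<Union>B\<in>\<F>. C B) \<inter> empirical_measures N"
  proof (intro equalityI subsetI)
    fix \<nu> assume "\<nu> \<in> U \<inter> empirical_measures N"
    then obtain z where z: "\<nu> = empirical N z" "\<nu> \<in> U" by (auto simp: empirical_measures_def)
    obtain r where r: "r > 0" "\<And>\<mu>. \<mu> \<in> prob_measures \<Longrightarrow> W2 \<nu> \<mu> < r \<Longrightarrow> \<mu> \<in> U"
      using U(2)[OF z(2)] by blast
    obtain e where e: "e > 0" "ennreal e < r"
    proof (cases r)
      case (real s)
      then show thesis using r(1) that[of "s / 2"] by (auto simp: ennreal_less_iff)
    next
      case top
      then show thesis using that[of 1] by simp
    qed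
    obtain B where B0: "\<forall>i<N. B i \<in> \<B> \<and> z i \<in> B i \<and> B i \<subseteq> ball (z i) e"
      "\<forall>i<N. \<forall>j<N. B i = B j \<or> B i \<inter> B j = {}" "\<forall>i<N. \<forall>j<N. B i = B j \<longleftrightarrow> z i = z j"
      using separating_basis_sets[OF \<B>(2) e(1), of N z] by (elim exE conjE)
    have B: "B i \<in> \<B> \<and> z i \<in> B i \<and> B i \<subseteq> ball (z i) e" if "i < N" for i
      using B0(1) that by simp
    define B' where "B' = restrict B {..<N}"
    have B': "B' i = B i" if "i < N" for i using that by (simp add: B'_def)
    have "B' \<in> \<F>"
      unfolding \<F>_def
    proof (intro CollectI conjI allI impI)
      show "B' \<in> {..<N} \<rightarrow>\<^sub>E \<B>" using B by (auto simp: B'_def)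
      show "B' i = B' j \<or> B' i \<inter> B' j = {}" if "i < N" "j < N" for i j
        using B0(2) that by (simp add: B' that)
      fix w assume w: "\<forall>i<N. w i \<in> B' i"
      have "dist (z i) (w i) < e" if "i < N" for i
        using w B[OF that] B'[OF that] that by (auto simp: subset_iff)
      then have "W2 \<nu> (empirical N w) \<le> ennreal e"
        unfolding z by (rule W2_empirical_less[OF N e(1)])
      then show "empirical N w \<in> U"
        using r(2) e(2) empirical_in_prob_measures[OF N] by (meson le_less_trans)
    qed
    moreover have "\<nu> \<in> C B'"
    proof -
      have "card {j\<in>{..<N}. B' j = B' i} \<le> card {k\<in>{..<N}. z k \<in> B' i}" if "i < N" for i
        proof (intro card_mono subsetI)
        fix j assume "j \<in> {j\<in>{..<N}. B' j = B' i}"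
        then show "j \<in> {k\<in>{..<N}. z k \<in> B' i}" using B[of j] B'[of j] by auto
      qed simp
      then show ?thesis
        using empirical_in_prob_measures[OF N, of z] B B' \<B>_borel
        by (simp add: C_def space_prob_algebra_borel z emeasure_empirical_card[OF _ N])
    qed
    ultimately show "\<nu> \<in> (\<Union>B\<in>\<F>. C B) \<inter> empirical_measures N"
      using z by (auto simp: empirical_measures_def)
  next
    fix \<nu> assume "\<nu> \<in> (\<Union>B\<in>\<F>. C B) \<inter> empirical_measures N"
    then obtain B w where B: "B \<in> \<F>" "\<nu> \<in> C B" "\<nu> = empirical N w" by (auto simp: empirical_measures_def)
    have Bb: "B i \<in> sets borel" if "i < N" for i using B(1) that \<B>_borel by (auto simp: \<F>_def)
    have "card {j\<in>{..<N}. B j = B i} \<le> card {k\<in>{..<N}. w k \<in> B i}" if "i < N" for i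
      using B(2,3) that by (simp add: C_def emeasure_empirical_card[OF Bb N])
    moreover have "B i = B j \<or> B i \<inter> B j = {}" if "i < N" "j < N" for i j
      using B(1) that by (auto simp: \<F>_def)
    ultimately obtain v where v: "empirical N v = empirical N w" "\<forall>i<N. v i \<in> B i"
      using empirical_relabel[of N B w] by blast
    then have "empirical N v \<in> U" using B(1) by (auto simp: \<F>_def)
    then show "\<nu> \<in> U \<inter> empirical_measures N" using v(1) B(3) by (auto simp: empirical_measures_def)
  qed
  moreover have "(\<Union>B\<in>\<F>. C B) \<in> sets (prob_algebra borel)"
    using cF C by (intro sets.countable_UN'') auto
  ultimately show ?thesis by blast
qed

text \<open>Taking traces on a fixed set commutes with complements and countable unions, so the
  agreement for open sets extends to all Borel sets.\<close>

lemma W2_borel_Int_empirical: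
  fixes E :: "'a::{metric_space, second_countable_topology} measure set"
  assumes N: "N > 0" and E: "E \<in> sets W2_borel"
  shows "\<exists>V\<in>sets (prob_algebra borel). E \<inter> empirical_measures N = V \<inter> empirical_measures N"
  using E unfolding sets_metric_borel
proof (induction E rule: sigma_sets.induct)
  case (Basic U)
  then show ?case using W2_open_Int_empirical[OF N, of U] by blast
next
  case Empty
  show ?case by auto
next
  case (Compl a)
  then obtain V where V: "V \<in> sets (prob_algebra borel)" "a \<inter> empirical_measures N = V \<inter> empirical_measures N"
    by blast
  have "(prob_measures - a) \<inter> empirical_measures N = (space (prob_algebra borel) - V) \<inter> empirical_measures N"
    using V(2) by (auto simp: space_prob_algebra_borel)
  then show ?case using V(1) by blast
next
  case (Union a)
  then have "\<forall>i. \<exists>V\<in>sets (prob_algebra borel). a i \<inter> empirical_measures N = V \<inter> empirical_measures N"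
    by blast
  then obtain V where "\<And>i. V i \<in> sets (prob_algebra borel)"
    "\<And>i. a i \<inter> empirical_measures N = V i \<inter> empirical_measures N"
    by metis
  then show ?case by (intro bexI[of _ "\<Union>i. V i"]) auto
qed

text \<open>The device by which \<open>W2\<close>-measurability is checked below: for maps with
  empirical values it follows from measurability as a kernel, which can be verified one Borel set of
  \<open>S\<close> at a time.\<close>

lemma measurable_W2_borel_empirical:
  fixes f :: "'b \<Rightarrow> 'a::{metric_space, second_countable_topology} measure"
  assumes N: "N > 0" and f: "f \<in> M \<rightarrow>\<^sub>M prob_algebra borel"
    and range: "\<And>x. x \<in> space M \<Longrightarrow> f x \<in> empirical_measures N"
  shows "f \<in> M \<rightarrow>\<^sub>M W2_borel"
proof (rule measurableI)
  show "f x \<in> space W2_borel" if "x \<in> space M" for x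
    using range[OF that] empirical_measures_subset[OF N] by auto
  fix E :: "'a measure set" assume "E \<in> sets W2_borel"
  then obtain V where V: "V \<in> sets (prob_algebra borel)" "E \<inter> empirical_measures N = V \<inter> empirical_measures N"
    using W2_borel_Int_empirical[OF N] by blast
  have "f -` E \<inter> space M = f -` V \<inter> space M" using V(2) range by blast
  then show "f -` E \<inter> space M \<in> sets M" using measurable_sets[OF f V(1)] by simp
qed


text \<open>Basic sets squeezed between a point and balls shrinking to it. Information on a basis
  thereby reaches the masses of points.\<close>

lemma measure_small_basis_sets:
  fixes \<nu> :: "'a::metric_space measure"
  assumes \<nu>: "\<nu> \<in> prob_measures" and basis: "topological_basis \<B>"
  obtains B where "\<And>n. B n \<in> \<B>" "\<And>n. x \<in> B n" "(\<lambda>n. measure \<nu> (B n)) \<longlonglongrightarrow> measure \<nu> {x}"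
proof -
  note \<nu>' = prob_measuresD[OF \<nu>]
  interpret prob_space \<nu> by fact
  have "\<forall>n. \<exists>B. B \<in> \<B> \<and> x \<in> B \<and> B \<subseteq> ball x (1 / Suc n)"
  proof
    fix n
    have "x \<in> ball x (1 / Suc n)" by simp
    from topological_basisE[OF basis open_ball this]
    show "\<exists>B. B \<in> \<B> \<and> x \<in> B \<and> B \<subseteq> ball x (1 / Suc n)" by metis
  qed
  then obtain B where B: "\<And>n. B n \<in> \<B>" "\<And>n. x \<in> B n" "\<And>n. B n \<subseteq> ball x (1 / Suc n)"
    by metis
  have B_borel: "B n \<in> sets \<nu>" for n
    using topological_basis_open[OF basis B(1)] \<nu>'(2) by simp
  have "(\<lambda>n. emeasure \<nu> (ball x (1 / Suc n))) \<longlonglongrightarrow> emeasure \<nu> {x}"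
    using emeasure_thickening_tendsto[OF \<nu>, of "{x}"] by simp
  then have "(\<lambda>n. measure \<nu> (ball x (1 / Suc n))) \<longlonglongrightarrow> measure \<nu> {x}"
    by (simp add: emeasure_eq_measure)
  then have "(\<lambda>n. measure \<nu> (B n)) \<longlonglongrightarrow> measure \<nu> {x}"
  proof (rule tendsto_sandwich[OF _ _ tendsto_const, rotated 2])
    have "measure \<nu> {x} \<le> measure \<nu> (B n)" for n
      using B(2)[of n] B_borel[of n] by (intro finite_measure_mono) simp_all
    then show "eventually (\<lambda>n. measure \<nu> {x} \<le> measure \<nu> (B n)) sequentially" by simp
    have "measure \<nu> (B n) \<le> measure \<nu> (ball x (1 / Suc n))" for n
      using B(3)[of n] by (intro finite_measure_mono) (simp_all add: \<nu>'(2))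
    then show "eventually (\<lambda>n. measure \<nu> (B n) \<le> measure \<nu> (ball x (1 / Suc n))) sequentially" by simp
  qed
  then show thesis by (rule that[OF B(1,2)])
qed

text \<open>Such a measure is purely atomic: a point of mass zero has a basic neighbourhood of mass below
  \<open>1 / N\<close>, hence a null neighbourhood.\<close>

lemma empirical_if_basis_Nats:
  fixes \<nu> :: "'a::metric_space measure"
  assumes \<nu>: "\<nu> \<in> prob_measures" and N: "N > 0" and basis: "countable \<B>" "topological_basis \<B>"
    and nat: "\<And>B. B \<in> \<B> \<Longrightarrow> real N * measure \<nu> B \<in> \<nat>"
  shows "\<nu> \<in> empirical_measures N"
proof -
  note \<nu>' = prob_measuresD[OF \<nu>]
  interpret prob_space \<nu> by fact
  have B_borel: "B \<in> sets \<nu>" if "B \<in> \<B>" for B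
    using topological_basis_open[OF basis(2) that] \<nu>'(2) by simp
  \<comment> \<open>The naturals are closed in the reals, so integrality on basic sets survives the
    limit.\<close>
  have point_nat: "real N * measure \<nu> {x} \<in> \<nat>" for x
  proof -
    obtain B where B: "\<And>n. B n \<in> \<B>" "(\<lambda>n. measure \<nu> (B n)) \<longlonglongrightarrow> measure \<nu> {x}"
      using measure_small_basis_sets[OF \<nu> basis(2), of x] by metis
    have "(\<lambda>n. real N * measure \<nu> (B n)) \<longlonglongrightarrow> real N * measure \<nu> {x}"
      using B(2) by (intro tendsto_intros)
    then show ?thesis
      by (rule closed_sequentially[OF closed_Nats nat[OF B(1)]])
  qed
  \<comment> \<open>The multiplicity of \<open>x\<close> among the \<open>N\<close> atoms; the floor
    is exact by \<open>point_nat\<close>.\<close>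
  define c where "c x = nat \<lfloor>real N * measure \<nu> {x}\<rfloor>" for x
  have c: "real N * measure \<nu> {x} = real (c x)" for x
    using point_nat[of x] by (auto simp: c_def elim!: Nats_cases)
  define P where "P = {x. c x > 0}"
  have sum_le: "(\<Sum>x\<in>F. c x) \<le> N" if "finite F" for F
  proof -
    have "real (\<Sum>x\<in>F. c x) = real N * (\<Sum>x\<in>F. measure \<nu> {x})"
      by (simp add: c[symmetric] sum_distrib_left)
    also have "(\<Sum>x\<in>F. measure \<nu> {x}) = measure \<nu> F"
      using that \<nu>'(2) by (intro finite_measure_eq_sum_singleton[symmetric]) auto
    also have "real N * measure \<nu> F \<le> real N * 1" by (intro mult_left_mono) auto
    finally show ?thesis by linarith
  qed
  have "card F \<le> N" if "F \<subseteq> P" "finite F" for F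
  proof -
    have "card F \<le> (\<Sum>x\<in>F. c x)"
      using sum_mono[of F "\<lambda>_. 1" c] that(1) by (auto simp: P_def Suc_le_eq)
    with sum_le[OF that(2)] show ?thesis by linarith
  qed
  then have finP: "finite P" using finite_if_finite_subsets_card_bdd[of P N] by blast
  have "- P \<in> null_sets \<nu>"
  proof (rule null_sets_subset)
    show "(\<Union>B\<in>{B \<in> \<B>. measure \<nu> B = 0}. B) \<in> null_sets \<nu>"
      using basis(1) B_borel by (intro null_sets_UN') (auto simp: emeasure_eq_measure intro: countable_subset[OF _ basis(1)])
    show "- P \<in> sets \<nu>" using finite_imp_closed[OF finP] \<nu>'(2) by (simp add: open_Compl)
    show "- P \<subseteq> (\<Union>B\<in>{B \<in> \<B>. measure \<nu> B = 0}. B)"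
    proof
      fix x assume "x \<in> - P"
      then have "measure \<nu> {x} = 0" using c[of x] N by (simp add: P_def)
      moreover obtain B where B: "\<And>n. B n \<in> \<B>" "\<And>n. x \<in> B n" "(\<lambda>n. measure \<nu> (B n)) \<longlonglongrightarrow> measure \<nu> {x}"
        using measure_small_basis_sets[OF \<nu> basis(2), of x] by metis
      ultimately have "eventually (\<lambda>n. measure \<nu> (B n) < 1 / real N) sequentially"
        using N by (intro order_tendstoD(2)) auto
      then obtain n where n: "measure \<nu> (B n) < 1 / real N"
        by (auto dest: eventually_happens)
      obtain k where k: "real N * measure \<nu> (B n) = real k"
        using nat[OF B(1)[of n]] by (auto elim: Nats_cases)
      have "real N * measure \<nu> (B n) < 1" using n N by (simp add: field_simps)
      then have "measure \<nu> (B n) = 0" using k N by simp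
      then show "x \<in> (\<Union>B\<in>{B \<in> \<B>. measure \<nu> B = 0}. B)" using B(1,2) by blast
    qed
  qed
  then have AE_P: "AE x in \<nu>. x \<in> P" using AE_not_in[of "- P" \<nu>] by simp
  have meas: "real N * measure \<nu> A = (\<Sum>x\<in>P. real (c x) * indicator A x)" if A: "A \<in> sets borel" for A
  proof -
    have PA: "P \<inter> A \<in> sets \<nu>" using finP by (auto intro!: borel_closed finite_imp_closed simp: \<nu>')
    have "measure \<nu> A = measure \<nu> (P \<inter> A)"
      using AE_P PA A \<nu>'(2) by (intro finite_measure_eq_AE) auto
    also have "\<dots> = (\<Sum>x\<in>P \<inter> A. measure \<nu> {x})"
      using finP \<nu>'(2) by (intro finite_measure_eq_sum_singleton) auto
    also have "real N * \<dots> = (\<Sum>x\<in>P \<inter> A. real (c x))" by (simp add: sum_distrib_left c)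
    also have "\<dots> = (\<Sum>x\<in>P. real (c x) * indicator A x)"
      using finP by (simp add: sum.inter_restrict indicator_def if_distrib cong: if_cong)
    finally show ?thesis .
  qed
  have "real (\<Sum>x\<in>P. c x) = real N"
    using meas[of UNIV] prob_space \<nu>'(3) by simp
  then have "(\<Sum>x\<in>P. c x) = N" by (simp only: of_nat_eq_iff)
  \<comment> \<open>The atoms listed with multiplicity: a point \<open>x\<close> contributes the
    pairs \<open>(x, j)\<close> with \<open>j < c x\<close>, and an enumeration of these
    \<open>N\<close> pairs supplies the required tuple.\<close>
  then have cardS: "card (Sigma P (\<lambda>x. {..<c x})) = N"
    using finP by (simp add: card_SigmaI)
  obtain h where h: "bij_betw h {0..<N} (Sigma P (\<lambda>x. {..<c x}))"
    using ex_bij_betw_nat_finite[of "Sigma P (\<lambda>x. {..<c x})"] finP cardS by auto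
  have "\<nu> = empirical N (\<lambda>i. fst (h i))"
  proof (rule measure_eqI)
    fix A assume "A \<in> sets \<nu>"
    then have A: "A \<in> sets borel" using \<nu>' by simp
    have "(\<Sum>i<N. indicator A (fst (h i))) = (\<Sum>p\<in>Sigma P (\<lambda>x. {..<c x}). indicator A (fst p) :: real)"
      using sum.reindex_bij_betw[OF h, of "\<lambda>p. indicator A (fst p)"] by (simp add: lessThan_atLeast0)
    also have "\<dots> = (\<Sum>x\<in>P. real (c x) * indicator A x)"
      using finP by (subst sum.Sigma[of P "\<lambda>x. {..<c x}" "\<lambda>x _. indicator A x", symmetric, unfolded case_prod_beta'])
        auto
    finally have *: "real N * measure \<nu> A = (\<Sum>i<N. indicator A (fst (h i)))" using meas[OF A] by simp
    have "emeasure (empirical N (\<lambda>i. fst (h i))) A = (\<Sum>i<N. ennreal (indicator A (fst (h i)))) / of_nat N"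
      using A by (simp add: emeasure_empirical_indicator ennreal_indicator)
    also have "\<dots> = ennreal (measure \<nu> A)"
      using N by (simp add: sum_ennreal *[symmetric] divide_ennreal ennreal_of_nat_eq_real_of_nat)
    finally show "emeasure \<nu> A = emeasure (empirical N (\<lambda>i. fst (h i))) A"
      by (simp add: emeasure_eq_measure)
  qed (simp add: \<nu>')
  then show ?thesis by (auto simp: empirical_measures_def)
qed

text \<open>Integrality of \<open>N\<close> times the mass characterises empirical measures, and
  asking for it on a countable basis only keeps the number of measurable conditions
  countable.\<close>

lemma empirical_measures_in_prob_algebra:
  assumes N: "N > 0"
  shows "(empirical_measures N :: 'a::{metric_space, second_countable_topology} measure set) \<in> sets (prob_algebra borel)"
proof -
  obtain \<B> :: "'a set set" where \<B>: "countable \<B>" "topological_basis \<B>"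
    using ex_countable_basis by blast
  have \<B>_borel: "B \<in> sets borel" if "B \<in> \<B>" for B
    using topological_basis_open[OF \<B>(2) that] by simp
  have "(empirical_measures N :: 'a measure set) =
    {\<nu> \<in> space (prob_algebra borel). \<forall>B\<in>\<B>. real N * measure \<nu> B \<in> \<nat>}"
  proof (intro equalityI subsetI)
    fix \<nu> :: "'a measure" assume \<nu>: "\<nu> \<in> empirical_measures N"
    then obtain z where z: "\<nu> = empirical N z" by (auto simp: empirical_measures_def)
    have "real N * measure \<nu> B \<in> \<nat>" if "B \<in> \<B>" for B
    proof -
      have "real N * measure \<nu> B = enn2real (of_nat N * emeasure \<nu> B)"
        by (simp add: measure_def enn2real_mult)
      also have "\<dots> \<in> \<nat>"
        unfolding z emeasure_empirical_card[OF \<B>_borel[OF that] N] by simp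
      finally show ?thesis .
    qed
    then show "\<nu> \<in> {\<nu> \<in> space (prob_algebra borel). \<forall>B\<in>\<B>. real N * measure \<nu> B \<in> \<nat>}"
      using \<nu> empirical_measures_subset[OF N] by (auto simp: space_prob_algebra_borel)
  next
    fix \<nu> :: "'a measure"
    assume "\<nu> \<in> {\<nu> \<in> space (prob_algebra borel). \<forall>B\<in>\<B>. real N * measure \<nu> B \<in> \<nat>}"
    then show "\<nu> \<in> empirical_measures N"
      using empirical_if_basis_Nats[OF _ N \<B>] by (simp add: space_prob_algebra_borel)
  qed
  also have "\<dots> = space (prob_algebra borel) -
      (\<Union>B\<in>\<B>. {\<nu> \<in> space (prob_algebra borel). real N * measure \<nu> B \<notin> \<nat>})"
    by auto
  also have "\<dots> \<in> sets (prob_algebra borel)"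
  proof (intro sets.Diff sets.top sets.countable_UN''[OF \<B>(1)])
    fix B assume "B \<in> \<B>"
    then have [measurable]: "B \<in> sets borel" by (rule \<B>_borel)
    have [measurable]: "(\<nat> :: real set) \<in> sets borel" by (simp add: borel_closed)
    show "{\<nu> \<in> space (prob_algebra borel). real N * measure \<nu> B \<notin> \<nat>} \<in> sets (prob_algebra borel)"
      by measurable
  qed
  finally show ?thesis .
qed

lemma empirical_measures_in_W2_borel:
  assumes "N > 0"
  shows "(empirical_measures N :: 'a::{metric_space, second_countable_topology} measure set) \<in> sets W2_borel"
  using measurable_sets[OF id_measurable_W2_prob_algebra empirical_measures_in_prob_algebra[OF assms]]
  by (simp add: Int_absorb2[OF empirical_measures_subset[OF assms]])

lemma empirical_measurable [measurable]:
  assumes N: "N > 0" and f: "\<And>i. i < N \<Longrightarrow> (\<lambda>x. f x i) \<in> M \<rightarrow>\<^sub>M (borel :: 'a::{metric_space, second_countable_topology} measure)"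
  shows "(\<lambda>x. empirical N (f x)) \<in> M \<rightarrow>\<^sub>M W2_borel"
proof (rule measurable_W2_borel_empirical[OF N])
  show "(\<lambda>x. empirical N (f x)) \<in> M \<rightarrow>\<^sub>M prob_algebra borel"
  proof (rule measurable_prob_algebraI)
    show "prob_space (empirical N (f x))" for x
      using prob_measuresD(1)[OF empirical_in_prob_measures[OF N]] .
    show "(\<lambda>x. empirical N (f x)) \<in> M \<rightarrow>\<^sub>M subprob_algebra borel"
    proof (rule measurable_subprob_algebra)
      fix A :: "'a set" assume A [measurable]: "A \<in> sets borel"
      have "(\<lambda>x. indicator A (f x i) :: ennreal) \<in> borel_measurable M" if "i < N" for i
        using f[OF that] by measurable
      then show "(\<lambda>x. emeasure (empirical N (f x)) A) \<in> borel_measurable M"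
        unfolding emeasure_empirical_indicator[OF A]
        by (intro borel_measurable_divide_ennreal borel_measurable_sum borel_measurable_const) simp
    qed (use prob_measuresD(1)[OF empirical_in_prob_measures[OF N]] in
        \<open>auto intro: prob_space_imp_subprob_space\<close>)
  qed
qed (simp add: empirical_measures_def)

section \<open>The jump kernel\<close>

text \<open>Linearity of the integral in the measure, by induction from indicators. It serves the
  lifted kernel at an empirical measure, which is the mean of \<open>N\<close> image
  measures.\<close>

lemma nn_integral_sum_measures:
  assumes I: "finite I" and L: "\<And>i. i \<in> I \<Longrightarrow> sets (L i) = sets M"
    and M: "\<And>A. A \<in> sets M \<Longrightarrow> emeasure M A = (\<Sum>i\<in>I. emeasure (L i) A) * c"
    and c: "c < top" and f: "f \<in> borel_measurable M"
  shows "(\<integral>\<^sup>+ x. f x \<partial>M) = (\<Sum>i\<in>I. \<integral>\<^sup>+ x. f x \<partial>L i) * c"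
  using f
proof (induction f rule: borel_measurable_induct)
  case (cong f g)
  have "(\<integral>\<^sup>+ x. f x \<partial>M) = (\<integral>\<^sup>+ x. g x \<partial>M)" by (rule nn_integral_cong) (rule cong)
  moreover have "(\<integral>\<^sup>+ x. f x \<partial>L i) = (\<integral>\<^sup>+ x. g x \<partial>L i)" if "i \<in> I" for i
    using cong(3) sets_eq_imp_space_eq[OF L[OF that]] by (intro nn_integral_cong) simp
  ultimately show ?case using cong(4) by simp
next
  case (set A)
  then show ?case using M L by simp
next
  case (mult u a)
  have "u \<in> borel_measurable (L i)" if "i \<in> I" for i
    using mult(2) by (simp add: measurable_cong_sets[OF L[OF that] refl])
  then show ?case
    using mult by (simp add: nn_integral_cmult mult.assoc flip: sum_distrib_left)
next
  case (add u v)
  have "u \<in> borel_measurable (L i)" "v \<in> borel_measurable (L i)" if "i \<in> I" for i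
    using add by (simp_all add: measurable_cong_sets[OF L[OF that] refl])
  then show ?case
    using add by (simp add: nn_integral_add sum.distrib distrib_right)
next
  case (seq U)
  have lim: "(\<lambda>n. \<integral>\<^sup>+ x. U n x \<partial>K) \<longlonglongrightarrow> (\<integral>\<^sup>+ x. (SUP n. U n) x \<partial>K)" if "sets K = sets M" for K
  proof (rule nn_integral_LIMSEQ[OF \<open>incseq U\<close>])
    show "U n \<in> borel_measurable K" for n
      using seq(1) by (simp add: measurable_cong_sets[OF that refl])
    show "(\<lambda>n. U n x) \<longlonglongrightarrow> (SUP n. U n) x" for x
      unfolding SUP_apply using \<open>incseq U\<close> by (intro LIMSEQ_SUP) (simp add: incseq_def le_fun_def)
  qed
  have "(\<lambda>n. (\<Sum>i\<in>I. \<integral>\<^sup>+ x. U n x \<partial>L i) * c) \<longlonglongrightarrow> (\<Sum>i\<in>I. \<integral>\<^sup>+ x. (SUP n. U n) x \<partial>L i) * c"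
    using c L unfolding mult.commute[of _ c] by (intro ennreal_tendsto_cmult tendsto_sum lim) auto
  then have "(\<lambda>n. \<integral>\<^sup>+ x. U n x \<partial>M) \<longlonglongrightarrow> (\<Sum>i\<in>I. \<integral>\<^sup>+ x. (SUP n. U n) x \<partial>L i) * c"
    using seq.IH by simp
  from LIMSEQ_unique[OF lim[OF refl] this] show ?case .
qed

text \<open>The truncated subtraction is exact because the subtracted term is finite and is one of
  the summands. The right side sees \<open>z\<close> only through its empirical measure and the
  moved atom, and this makes moving mass measurable in the measure, the atom and the target.\<close>

lemma emeasure_empirical_upd:
  fixes z :: "nat \<Rightarrow> 'a::topological_space"
  assumes A: "A \<in> sets borel" and i: "i < N"
  shows "emeasure (empirical N (z(i := y))) A =
    emeasure (empirical N z) A + indicator A y / of_nat N - indicator A (z i) / of_nat N"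
proof -
  have s: "(\<Sum>j<N. f j) = f i + (\<Sum>j\<in>{..<N} - {i}. f j)" for f :: "nat \<Rightarrow> ennreal"
    using i by (intro sum.remove) auto
  have d: "(a + b) / c = a / c + b / c" for a b c :: ennreal
    by (simp add: divide_ennreal_def distrib_right)
  have c: "((a + r) + b) - a = b + r" if "a \<noteq> \<infinity>" for a b r :: ennreal
    using that ennreal_add_diff_cancel_left[of a "r + b"] by (simp add: ac_simps)
  have fin: "indicator A (z i) / of_nat N \<noteq> (\<infinity> :: ennreal)"
    using i by (auto simp: indicator_def ennreal_divide_eq_top_iff)
  have "(\<Sum>j\<in>{..<N} - {i}. indicator A ((z(i := y)) j)) = (\<Sum>j\<in>{..<N} - {i}. indicator A (z j) :: ennreal)"
    by (intro sum.cong) auto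
  then show ?thesis
    unfolding emeasure_empirical_indicator[OF A] s d using c[OF fin] by simp
qed

lemma emeasure_empirical_pos_iff:
  fixes z :: "nat \<Rightarrow> 'a::t1_space"
  assumes N: "N > 0"
  shows "emeasure (empirical N z) {x} > 0 \<longleftrightarrow> x \<in> z ` {..<N}"
proof -
  have "emeasure (empirical N z) {x} = 0 \<longleftrightarrow> (\<forall>i<N. z i \<noteq> x)"
    using N by (auto simp: emeasure_empirical_indicator ennreal_divide_eq_0_iff indicator_def)
  then show ?thesis by (auto simp: zero_less_iff_neq_zero)
qed

text \<open>Empirical measures with atoms in a countable dense set are \<open>W2\<close>-dense among
  the empirical ones. Hence \<open>W2 \<nu> \<eta>\<close> is a countable infimum of sums
  \<open>W2 \<nu> c + W2 c \<eta>\<close>, each summand depending on one variable only;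
  \<open>\<eta>\<close> may be arbitrary.\<close>

lemma W2_empirical_joint_measurable:
  fixes N :: nat
  assumes N: "N > 0"
  shows "(\<lambda>(\<nu>, \<eta>). W2 \<nu> \<eta>) \<in> borel_measurable
    (restrict_space (W2_borel :: 'a::{metric_space, second_countable_topology} measure measure) (empirical_measures N)
      \<Otimes>\<^sub>M W2_borel)"
proof -
  obtain D0 :: "'a set" where D0: "countable D0" "\<And>X. open X \<Longrightarrow> X \<noteq> {} \<Longrightarrow> \<exists>d\<in>D0. d \<in> X"
    using countable_dense_setE by blast
  define C where "C = empirical N ` ({..<N} \<rightarrow>\<^sub>E D0)"
  have C: "countable C" unfolding C_def using D0(1) by (intro countable_image countable_PiE) auto
  have dense: "\<exists>c\<in>C. W2 \<nu> c \<le> ennreal e" if \<nu>: "\<nu> \<in> empirical_measures N" and e: "e > 0" for \<nu> :: "'a measure" and e :: real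
  proof -
    obtain z where z: "\<nu> = empirical N z" using \<nu> by (auto simp: empirical_measures_def)
    have "\<forall>i. \<exists>d\<in>D0. d \<in> ball (z i) e" using D0(2) e by (metis open_ball centre_in_ball empty_iff)
    then obtain w where w: "\<And>i. w i \<in> D0" "\<And>i. w i \<in> ball (z i) e" by metis
    have "W2 \<nu> (empirical N (restrict w {..<N})) \<le> ennreal e"
      unfolding z using w(2) by (intro W2_empirical_less N e) auto
    moreover have "restrict w {..<N} \<in> {..<N} \<rightarrow>\<^sub>E D0" using w(1) by auto
    ultimately show ?thesis unfolding C_def by blast
  qed
  let ?R = "restrict_space (W2_borel :: 'a measure measure) (empirical_measures N)"
  have INF: "W2 \<nu> \<eta> = (INF c\<in>C. W2 \<nu> c + W2 c \<eta>)" if \<nu>: "\<nu> \<in> empirical_measures N" for \<nu> \<eta> :: "'a measure"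
  proof (rule antisym)
    show "W2 \<nu> \<eta> \<le> (INF c\<in>C. W2 \<nu> c + W2 c \<eta>)" by (intro INF_greatest W2_triangle)
    show "(INF c\<in>C. W2 \<nu> c + W2 c \<eta>) \<le> W2 \<nu> \<eta>"
    proof (rule ennreal_le_epsilon)
      fix e :: real assume e: "e > 0"
      obtain c where c: "c \<in> C" "W2 \<nu> c \<le> ennreal (e / 2)" using dense[OF \<nu>, of "e / 2"] e by auto
      have "(INF c\<in>C. W2 \<nu> c + W2 c \<eta>) \<le> W2 \<nu> c + W2 c \<eta>" by (rule INF_lower[OF c(1)])
      also have "\<dots> \<le> W2 \<nu> c + (W2 \<nu> c + W2 \<nu> \<eta>)"
        using W2_triangle[of c \<eta> \<nu>] W2_commute[of c \<nu>] by (intro add_left_mono) simp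
      also have "\<dots> \<le> ennreal (e / 2) + (ennreal (e / 2) + W2 \<nu> \<eta>)" by (intro add_mono c order_refl)
      also have "\<dots> = W2 \<nu> \<eta> + ennreal e"
        using e by (simp add: ac_simps ennreal_plus[symmetric] flip: add.assoc del: ennreal_plus)
      finally show "(INF c\<in>C. W2 \<nu> c + W2 c \<eta>) \<le> W2 \<nu> \<eta> + ennreal e" .
    qed
  qed
  have 1: "(\<lambda>p. W2 (fst p) c) \<in> borel_measurable (?R \<Otimes>\<^sub>M W2_borel)" for c :: "'a measure"
    by (rule measurable_compose[OF measurable_fst measurable_restrict_space1[OF W2_measurable]])
  have 2: "(\<lambda>p. W2 c (snd p)) \<in> borel_measurable (?R \<Otimes>\<^sub>M W2_borel)" for c :: "'a measure"
    by (subst W2_commute) (rule measurable_compose[OF measurable_snd W2_measurable])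
  have "(\<lambda>p. INF c\<in>C. W2 (fst p) c + W2 c (snd p)) \<in> borel_measurable (?R \<Otimes>\<^sub>M W2_borel)"
    by (intro borel_measurable_INF C borel_measurable_add 1 2)
  then show ?thesis
    by (rule measurable_cong[THEN iffD1, rotated])
      (auto simp: space_pair_measure space_restrict_space INF[symmetric])
qed

locale base_jump =
  fixes \<pi> :: "'a::{metric_space, second_countable_topology} measure"
    and \<kappa> :: "'a \<Rightarrow> 'a measure" and N :: nat
  assumes base: "jump_structure UNIV (\<lambda>x y. ennreal (dist x y)) \<pi> \<kappa>"
    and N: "N > 0"
begin

lemma sets_base [measurable_cong]: "sets \<pi> = sets borel"
  and finite_base: "finite_measure \<pi>"
  and sets_rate [measurable_cong]: "sets (\<kappa> x) = sets borel"
  and rate_self: "emeasure (\<kappa> x) {x} = 0"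
  and rate_bound_finite: "rate_bound UNIV (\<lambda>x y. ennreal (dist x y)) \<kappa> < \<infinity>"
  and rate_integral_measurable: "f \<in> borel_measurable borel \<Longrightarrow> bounded (range f) \<Longrightarrow>
        (\<lambda>x. set_lebesgue_integral (\<kappa> x) (UNIV - {x}) (\<lambda>y. f y * enn2real (min 1 ((ennreal (dist x y))\<^sup>2))))
          \<in> borel_measurable borel"
  and rate_detailed_balance: "E \<in> sets (borel \<Otimes>\<^sub>M borel) \<Longrightarrow>
        (\<integral>\<^sup>+ x. emeasure (\<kappa> x) {y. (x, y) \<in> E} \<partial>\<pi>) = (\<integral>\<^sup>+ x. emeasure (\<kappa> x) {y. (y, x) \<in> E} \<partial>\<pi>)"
  using base unfolding jump_structure_def metric_borel_dist by simp_all

abbreviation "c\<^sub>\<kappa> \<equiv> rate_bound UNIV (\<lambda>x y. ennreal (dist x y)) \<kappa>"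

definition weight :: "'a \<Rightarrow> 'a \<Rightarrow> ennreal" where
  "weight x y = min 1 ((ennreal (dist x y))\<^sup>2)"

text \<open>Dividing by the bound plus one gives total mass at most 1, as the Giry monad demands;
  the added one avoids a division by zero when the bound is zero.\<close>

definition bounded_rate :: "'a \<Rightarrow> 'a measure" where
  "bounded_rate x = density (\<kappa> x) (\<lambda>y. weight x y / (c\<^sub>\<kappa> + 1))"

lemma space_rate: "space (\<kappa> x) = UNIV"
  using sets_eq_imp_space_eq[OF sets_rate] by simp

lemma weight_measurable [measurable]:
  "(\<lambda>p. weight (fst p) (snd p)) \<in> borel_measurable (borel \<Otimes>\<^sub>M borel)"
  unfolding weight_def by measurable

lemma weight_measurable2 [measurable]: "weight x \<in> borel_measurable borel"
  unfolding weight_def by measurable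

lemma weight_le_1: "weight x y \<le> 1"
  by (simp add: weight_def)

lemma nn_integral_weight_le: "(\<integral>\<^sup>+ y. weight x y \<partial>\<kappa> x) \<le> c\<^sub>\<kappa>"
  unfolding rate_bound_def weight_def by (rule SUP_upper) simp

text \<open>The structural hypothesis concerns Bochner integrals over the complement of the
  diagonal. For an indicator these equal the nonnegative integrals defining
  \<open>bounded_rate\<close>: the weight vanishes on the diagonal and has finite integral.\<close>

lemma bounded_rate_measurable [measurable]: "bounded_rate \<in> borel \<rightarrow>\<^sub>M subprob_algebra borel"
proof (rule measurable_subprob_algebra)
  let ?C = "c\<^sub>\<kappa> + 1"
  show sets: "sets (bounded_rate x) = sets borel" for x
    by (simp add: bounded_rate_def sets_rate)
  have em: "emeasure (bounded_rate x) A = (\<integral>\<^sup>+ y. weight x y * indicator A y \<partial>\<kappa> x) / ?C"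
    if A [measurable]: "A \<in> sets borel" for A x
  proof -
    have "emeasure (bounded_rate x) A = (\<integral>\<^sup>+ y. (weight x y * indicator A y) * (1 / ?C) \<partial>\<kappa> x)"
      using A unfolding bounded_rate_def
      by (subst emeasure_density) (auto simp: sets_rate divide_ennreal_def mult_ac intro!: nn_integral_cong)
    also have "\<dots> = (\<integral>\<^sup>+ y. weight x y * indicator A y \<partial>\<kappa> x) * (1 / ?C)"
      using A by (intro nn_integral_multc) measurable
    finally show ?thesis by (simp add: divide_ennreal_def)
  qed
  show "subprob_space (bounded_rate x)" for x
  proof (rule subprob_spaceI)
    have "emeasure (bounded_rate x) (space (bounded_rate x)) = (\<integral>\<^sup>+ y. weight x y \<partial>\<kappa> x) / ?C"
      using em[of UNIV x] sets_eq_imp_space_eq[OF sets] by simp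
    also have "\<dots> \<le> ?C / ?C"
      by (rule divide_right_mono_ennreal, rule order_trans[OF nn_integral_weight_le])
        (metis add.right_neutral add_left_mono zero_le)
    also have "\<dots> = 1" using rate_bound_finite by (intro ennreal_divide_self) auto
    finally show "emeasure (bounded_rate x) (space (bounded_rate x)) \<le> 1" .
  qed (simp add: bounded_rate_def space_rate)
  fix A :: "'a set" assume A [measurable]: "A \<in> sets borel"
  have "(\<integral>\<^sup>+ y. weight x y * indicator A y \<partial>\<kappa> x) =
    ennreal (set_lebesgue_integral (\<kappa> x) (UNIV - {x}) (\<lambda>y. indicator A y * enn2real (weight x y)))" for x
  proof -
    let ?f = "\<lambda>y. indicator (UNIV - {x}) y *\<^sub>R (indicator A y * enn2real (weight x y))"
    have eq: "ennreal (?f y) = weight x y * indicator A y" for y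
      using le_less_trans[OF weight_le_1[of x y] ennreal_one_less_top]
      by (cases "y = x") (auto simp: indicator_def weight_def ennreal_enn2real_if)
    have "(\<integral>\<^sup>+ y. weight x y * indicator A y \<partial>\<kappa> x) \<le> (\<integral>\<^sup>+ y. weight x y \<partial>\<kappa> x)"
      by (intro nn_integral_mono) (auto simp: indicator_def)
    also have "\<dots> < \<infinity>" using nn_integral_weight_le rate_bound_finite by (rule le_less_trans)
    finally have fin: "(\<integral>\<^sup>+ y. ennreal (?f y) \<partial>\<kappa> x) < \<infinity>" unfolding eq .
    have "integrable (\<kappa> x) ?f"
    proof (rule integrableI_nonneg)
      show "?f \<in> borel_measurable (\<kappa> x)" by measurable
    qed (use fin in simp_all)
    from nn_integral_eq_integral[OF this] show ?thesis
      unfolding set_lebesgue_integral_def eq by simp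
  qed
  moreover have "bounded (range (indicator A :: 'a \<Rightarrow> real))"
    by (rule bounded_subset[of "{0..1}"]) (auto simp: indicator_def)
  ultimately have "(\<lambda>x. \<integral>\<^sup>+ y. weight x y * indicator A y \<partial>\<kappa> x) \<in> borel_measurable borel"
    using rate_integral_measurable[of "indicator A", folded weight_def] by simp
  then show "(\<lambda>x. emeasure (bounded_rate x) A) \<in> borel_measurable borel"
    unfolding em[OF A] by measurable
qed

text \<open>The kernel \<open>\<kappa>\<close> itself need not be uniformly \<open>\<sigma>\<close>-finite; joint measurability is obtained
  from the bounded kernel \<open>(1 \<and> d\<^sup>2) \<kappa>\<close> by dividing the weight out again.\<close>

lemma nn_integral_rate_measurable:
  assumes H [measurable]: "(\<lambda>(s, y). H s y) \<in> borel_measurable (M \<Otimes>\<^sub>M borel)"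
    and g [measurable]: "g \<in> M \<rightarrow>\<^sub>M borel"
  shows "(\<lambda>s. \<integral>\<^sup>+ y. H s y \<partial>\<kappa> (g s)) \<in> borel_measurable M"
proof -
  let ?C = "c\<^sub>\<kappa> + 1"
  have eq: "(\<integral>\<^sup>+ y. H s y \<partial>\<kappa> (g s)) = (\<integral>\<^sup>+ y. H s y * (?C / weight (g s) y) \<partial>bounded_rate (g s))"
    if s: "s \<in> space M" for s
  proof -
    have Hs [measurable]: "H s \<in> borel_measurable borel"
      using measurable_compose[OF measurable_Pair1'[OF s] H] by simp
    \<comment> \<open>The diagonal is the only place where the weight is zero and dividing it out
      fails; \<open>\<kappa>\<close> does not charge it.\<close>
    have "{g s} \<in> null_sets (\<kappa> (g s))" by (simp add: null_sets_def rate_self sets_rate)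
    then have ne: "AE y in \<kappa> (g s). y \<notin> {g s}" by (rule AE_not_in)
    have "(\<integral>\<^sup>+ y. H s y * (?C / weight (g s) y) \<partial>bounded_rate (g s)) =
      (\<integral>\<^sup>+ y. weight (g s) y / ?C * (H s y * (?C / weight (g s) y)) \<partial>\<kappa> (g s))"
      unfolding bounded_rate_def by (rule nn_integral_density) measurable
    also have "\<dots> = (\<integral>\<^sup>+ y. H s y \<partial>\<kappa> (g s))"
    proof (rule nn_integral_cong_AE, use ne in eventually_elim)
      fix y assume y: "y \<notin> {g s}"
      have w: "weight (g s) y \<noteq> 0" "weight (g s) y \<noteq> top"
        using y le_less_trans[OF weight_le_1[of "g s" y] ennreal_one_less_top]
        by (auto simp: weight_def min_def split: if_splits)
      have C: "?C \<noteq> 0" "?C \<noteq> top" using rate_bound_finite by auto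
      have "weight (g s) y / ?C * (H s y * (?C / weight (g s) y)) =
          H s y * ((weight (g s) y * inverse (weight (g s) y)) * (?C * inverse ?C))"
        by (simp add: divide_ennreal_def mult_ac)
      also have "\<dots> = H s y"
        using w C ennreal_divide_self[of "weight (g s) y"] ennreal_divide_self[of ?C]
        by (simp add: divide_ennreal_def top.not_eq_extremum)
      finally show "weight (g s) y / ?C * (H s y * (?C / weight (g s) y)) = H s y" .
    qed
    finally show ?thesis ..
  qed
  have "(\<lambda>s. \<integral>\<^sup>+ y. H s y * (?C / weight (g s) y) \<partial>bounded_rate (g s)) \<in> borel_measurable M"
  proof (rule nn_integral_measurable_subprob_algebra2)
    have [measurable]: "(\<lambda>p. weight (g (fst p)) (snd p)) \<in> borel_measurable (M \<Otimes>\<^sub>M borel)"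
      using measurable_compose[of "\<lambda>p. (g (fst p), snd p)" "M \<Otimes>\<^sub>M borel", OF _ weight_measurable] by simp
    have [measurable]: "(\<lambda>p. H (fst p) (snd p)) \<in> borel_measurable (M \<Otimes>\<^sub>M borel)"
      using H by (simp add: case_prod_beta')
    show "(\<lambda>(s, y). H s y * (?C / weight (g s) y)) \<in> borel_measurable (M \<Otimes>\<^sub>M borel)"
      unfolding case_prod_beta' by measurable
    show "(\<lambda>s. bounded_rate (g s)) \<in> M \<rightarrow>\<^sub>M subprob_algebra borel" by measurable
  qed
  then show ?thesis
    by (rule measurable_cong[THEN iffD1, rotated]) (simp add: eq)
qed

end

section \<open>The lifted kernel\<close>

text \<open>By Markov's inequality the sets where \<open>f\<close> is at least
  \<open>1 / Suc n\<close> have finite measure, and with the null set \<open>f = 0\<close> they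
  cover the space.\<close>

lemma sigma_finite_measureI_nn_integral:
  assumes f [measurable]: "f \<in> borel_measurable M" and fin: "(\<integral>\<^sup>+ x. f x \<partial>M) < \<infinity>"
    and null: "{x \<in> space M. f x = 0} \<in> null_sets M"
  shows "sigma_finite_measure M"
proof
  let ?A = "\<lambda>n. {x \<in> space M. 1 \<le> of_nat (Suc n) * f x}"
  show "\<exists>A. countable A \<and> A \<subseteq> sets M \<and> \<Union>A = space M \<and> (\<forall>a\<in>A. emeasure M a \<noteq> \<infinity>)"
  proof (intro exI[of _ "insert {x \<in> space M. f x = 0} (range ?A)"] conjI ballI)
    show "insert {x \<in> space M. f x = 0} (range ?A) \<subseteq> sets M"
      by (auto simp del: of_nat_Suc)
    show "\<Union> (insert {x \<in> space M. f x = 0} (range ?A)) = space M"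
    proof (intro equalityI subsetI)
      fix x assume x: "x \<in> space M"
      show "x \<in> \<Union> (insert {x \<in> space M. f x = 0} (range ?A))"
      proof (cases "f x = 0")
        case False
        have "\<exists>n. 1 \<le> of_nat (Suc n) * f x"
        proof (cases "f x")
          case (real r)
          then have r: "r > 0" using False by (cases "r = 0") auto
          obtain n where "1 / r \<le> real n" using real_arch_simple by blast
          then have "1 \<le> real (Suc n) * r" using r by (simp add: field_simps)
          then have "ennreal 1 \<le> ennreal (real (Suc n) * r)" by (rule ennreal_leI)
          then have "1 \<le> of_nat (Suc n) * f x"
            using real r by (simp add: ennreal_mult ennreal_of_nat_eq_real_of_nat del: of_nat_Suc)
          then show ?thesis by blast
        next
          case top
          then show ?thesis by (intro exI[of _ 0]) simp
        qed
        then show ?thesis using x by blast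
      qed (use x in blast)
    qed auto
    fix a assume "a \<in> insert {x \<in> space M. f x = 0} (range ?A)"
    then show "emeasure M a \<noteq> \<infinity>"
    proof
      assume "a \<in> range ?A"
      then obtain n where a: "a = ?A n" by blast
      have "emeasure M (?A n) \<le> of_nat (Suc n) * (\<integral>\<^sup>+ x. f x * indicator (space M) x \<partial>M)"
        by (rule nn_integral_Markov_inequality) measurable
      also have "(\<integral>\<^sup>+ x. f x * indicator (space M) x \<partial>M) = (\<integral>\<^sup>+ x. f x \<partial>M)"
        by (intro nn_integral_cong) simp
      also have "of_nat (Suc n) * (\<integral>\<^sup>+ x. f x \<partial>M) < \<infinity>"
        using fin by (simp add: ennreal_mult_less_top of_nat_less_top del: of_nat_Suc)
      finally show ?thesis by (simp add: a)
    qed (use null in auto)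
  qed auto
qed

context base_jump
begin

lemma upd_measurable [measurable]:
  fixes z :: "nat \<Rightarrow> 'a"
  shows "(\<lambda>y. empirical N (z(i := y))) \<in> borel \<rightarrow>\<^sub>M W2_borel"
  proof (rule empirical_measurable[OF N, of "fun_upd z i"])
  show "(\<lambda>y. (z(i := y)) j) \<in> borel \<rightarrow>\<^sub>M borel" for j
    by (cases "i = j") simp_all
qed

definition jump_law :: "(nat \<Rightarrow> 'a) \<Rightarrow> nat \<Rightarrow> 'a measure measure" where
  "jump_law z i = distr (\<kappa> (z i)) W2_borel (\<lambda>y. empirical N (z(i := y)))"

lemma nn_integral_jump_law:
  assumes "h \<in> borel_measurable W2_borel"
  shows "(\<integral>\<^sup>+ \<eta>. h \<eta> \<partial>jump_law z i) = (\<integral>\<^sup>+ y. h (empirical N (z(i := y))) \<partial>\<kappa> (z i))"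
  unfolding jump_law_def using assms by (subst nn_integral_distr) (simp_all, measurable)

lemma sets_jump_law [simp]: "sets (jump_law z i) = sets W2_borel"
  by (simp add: jump_law_def)

text \<open>\<open>lifted_rate\<close> is introduced as a bare set function. At an empirical measure
  it is a mean of genuine measures, one per particle, and countable additivity is read off from this
  form.\<close>

lemma lifted_rate_empirical:
  assumes E: "E \<in> sets W2_borel"
  shows "lifted_rate N \<kappa> (empirical N z) E = (\<Sum>i<N. emeasure (jump_law z i) E) / of_nat N"
proof -
  have "emeasure (jump_law z i) E = (\<integral>\<^sup>+ y. indicator E (empirical N (z(i := y))) \<partial>\<kappa> (z i))" for i
    using nn_integral_jump_law[of "indicator E" z i] E by simp
  then show ?thesis
    by (simp add: lifted_rate_def empirical_measures_def nn_integral_empirical move_mass_empirical)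
qed

lemma lifted_rate_measure_space:
  assumes "\<nu> \<in> prob_measures"
  shows "measure_space prob_measures (sets W2_borel) (lifted_rate N \<kappa> \<nu>)"
  unfolding measure_space_def
proof (intro conjI)
  show "sigma_algebra prob_measures (sets (W2_borel :: 'a measure measure))"
    using sets.sigma_algebra_axioms[of "W2_borel :: 'a measure measure"] by simp
  show "positive (sets W2_borel) (lifted_rate N \<kappa> \<nu>)"
    by (simp add: positive_def lifted_rate_def)
  show "countably_additive (sets W2_borel) (lifted_rate N \<kappa> \<nu>)"
  proof (cases "\<nu> \<in> empirical_measures N")
    case True
    then obtain z where z: "\<nu> = empirical N z" by (auto simp: empirical_measures_def)
    show ?thesis
    proof (rule countably_additiveI)
      fix F :: "nat \<Rightarrow> 'a measure set"
      assume F: "range F \<subseteq> sets W2_borel" "disjoint_family F" "(\<Union>k. F k) \<in> sets W2_borel"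
      have "(\<Sum>k. lifted_rate N \<kappa> \<nu> (F k)) = (\<Sum>i<N. \<Sum>k. emeasure (jump_law z i) (F k)) / of_nat N"
        using F(1) by (simp add: z lifted_rate_empirical range_subsetD divide_ennreal_def suminf_sum)
      also have "\<dots> = lifted_rate N \<kappa> \<nu> (\<Union>k. F k)"
        unfolding z lifted_rate_empirical[OF F(3)]
        using F by (intro arg_cong[where f = "\<lambda>x. x / of_nat N"] sum.cong suminf_emeasure) auto
      finally show "(\<Sum>k. lifted_rate N \<kappa> \<nu> (F k)) = lifted_rate N \<kappa> \<nu> (\<Union>k. F k)" .
    qed
  qed (simp add: countably_additive_def lifted_rate_def)
qed

lemma sets_lifted_kernel [simp]: "sets (lifted_kernel N \<kappa> \<nu>) = sets W2_borel"
  using sets.sigma_sets_eq[of "W2_borel :: 'a measure measure"] sets.space_closed[of "W2_borel :: 'a measure measure"]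
  by (simp add: lifted_kernel_def)

lemma space_lifted_kernel [simp]: "space (lifted_kernel N \<kappa> \<nu>) = prob_measures"
  using sets_eq_imp_space_eq[OF sets_lifted_kernel] by simp

lemma emeasure_lifted_kernel:
  assumes \<nu>: "\<nu> \<in> prob_measures" and E: "E \<in> sets W2_borel"
  shows "emeasure (lifted_kernel N \<kappa> \<nu>) E = lifted_rate N \<kappa> \<nu> E"
  using lifted_rate_measure_space[OF \<nu>] E unfolding lifted_kernel_def measure_space_def
  by (intro emeasure_measure_of_sigma) auto

lemma nn_integral_lifted_kernel_empirical:
  assumes h: "h \<in> borel_measurable W2_borel"
  shows "(\<integral>\<^sup>+ \<eta>. h \<eta> \<partial>lifted_kernel N \<kappa> (empirical N z)) =
    (\<Sum>i<N. \<integral>\<^sup>+ y. h (empirical N (z(i := y))) \<partial>\<kappa> (z i)) / of_nat N"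
proof -
  have "(\<integral>\<^sup>+ \<eta>. h \<eta> \<partial>lifted_kernel N \<kappa> (empirical N z)) =
      (\<Sum>i<N. \<integral>\<^sup>+ \<eta>. h \<eta> \<partial>jump_law z i) * inverse (of_nat N)"
  proof (rule nn_integral_sum_measures)
    show "emeasure (lifted_kernel N \<kappa> (empirical N z)) A = (\<Sum>i<N. emeasure (jump_law z i) A) * inverse (of_nat N)"
      if "A \<in> sets (lifted_kernel N \<kappa> (empirical N z))" for A
      using that by (simp add: emeasure_lifted_kernel empirical_in_prob_measures[OF N] lifted_rate_empirical divide_ennreal_def)
    show "h \<in> borel_measurable (lifted_kernel N \<kappa> (empirical N z))"
      using h by (simp add: measurable_cong_sets[OF sets_lifted_kernel refl])
    show "inverse (of_nat N) < (top :: ennreal)"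
      using N by (simp add: top.not_eq_extremum[symmetric])
  qed simp_all
  then show ?thesis by (simp add: nn_integral_jump_law[OF h] divide_ennreal_def)
qed

lemma nn_integral_lifted_kernel_outside:
  assumes "\<nu> \<in> prob_measures" "\<nu> \<notin> empirical_measures N"
  shows "(\<integral>\<^sup>+ \<eta>. h \<eta> \<partial>lifted_kernel N \<kappa> \<nu>) = 0"
proof -
  have "emeasure (lifted_kernel N \<kappa> \<nu>) (space (lifted_kernel N \<kappa> \<nu>)) = 0"
    using assms sets.top[of "W2_borel :: 'a measure measure", unfolded space_metric_borel]
    by (simp add: emeasure_lifted_kernel lifted_rate_def)
  then have "space (lifted_kernel N \<kappa> \<nu>) \<in> null_sets (lifted_kernel N \<kappa> \<nu>)"
    by (intro null_setsI sets.top)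
  then have "AE \<eta> in lifted_kernel N \<kappa> \<nu>. \<eta> \<notin> space (lifted_kernel N \<kappa> \<nu>)" by (rule AE_not_in)
  then have "AE \<eta> in lifted_kernel N \<kappa> \<nu>. h \<eta> = 0" using AE_space by eventually_elim simp
  then have "(\<integral>\<^sup>+ \<eta>. h \<eta> \<partial>lifted_kernel N \<kappa> \<nu>) = (\<integral>\<^sup>+ \<eta>. 0 \<partial>lifted_kernel N \<kappa> \<nu>)" by (rule nn_integral_cong_AE)
  then show ?thesis by simp
qed

abbreviation Emp :: "'a measure measure" where
  "Emp \<equiv> restrict_space W2_borel (empirical_measures N)"

lemma space_Emp: "space Emp = empirical_measures N"
  using empirical_measures_subset[OF N] by (auto simp: space_restrict_space)

lemma measurable_Emp_W2_borel: "(\<lambda>\<nu>. \<nu>) \<in> Emp \<rightarrow>\<^sub>M W2_borel"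
  by (rule measurable_restrict_space1) simp

text \<open>At an empirical measure the integral unfolds into one over the target \<open>y\<close>
  against \<open>\<kappa> x\<close>, followed by one over the atom \<open>x\<close> against
  \<open>\<nu>\<close>. The first is measurable through the bounded rate, the second because
  \<open>\<nu>\<close>, as a function of itself, is a kernel.\<close>

lemma nn_integral_lifted_kernel_measurable:
  assumes H: "(\<lambda>(\<nu>, \<eta>). H \<nu> \<eta>) \<in> borel_measurable (Emp \<Otimes>\<^sub>M W2_borel)"
  shows "(\<lambda>\<nu>. \<integral>\<^sup>+ \<eta>. H \<nu> \<eta> \<partial>lifted_kernel N \<kappa> \<nu>) \<in> borel_measurable W2_borel"
proof -
  \<comment> \<open>Off the atoms the subtraction in \<open>move_mass\<close> may truncate, so there
    \<open>\<nu>\<close> is left unchanged. All values are then empirical, as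
    \<open>measurable_W2_borel_empirical\<close> requires, and the integral against
    \<open>\<nu>\<close> is the same.\<close>
  define mv where "mv p y = (if emeasure (fst p) {snd p} > 0 then move_mass N (fst p) (snd p) y else fst p)"
    for p :: "'a measure \<times> 'a" and y
  let ?EB = "Emp \<Otimes>\<^sub>M (borel :: 'a measure)"
  have id_prob: "(\<lambda>\<nu>. \<nu>) \<in> Emp \<rightarrow>\<^sub>M prob_algebra borel"
    by (rule measurable_restrict_space1[OF id_measurable_W2_prob_algebra])
  have id_sub [measurable]: "(\<lambda>\<nu>. \<nu>) \<in> Emp \<rightarrow>\<^sub>M subprob_algebra borel"
    by (rule measurable_prob_algebraD[OF id_prob])
  have mv_emp: "mv (empirical N z, z i) y = empirical N (z(i := y))" if "i < N" for z i y
    using that by (simp add: mv_def emeasure_empirical_pos_iff[OF N] move_mass_empirical)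
  have mv_cases: "\<exists>z i. i < N \<and> mv p y = empirical N (z(i := y)) \<and> p = (empirical N z, z i) \<and> emeasure (fst p) {snd p} \<noteq> 0
      \<or> emeasure (fst p) {snd p} = 0 \<and> mv p y = fst p"
    if p: "fst p \<in> empirical_measures N" for p y
  proof (cases "emeasure (fst p) {snd p} > 0")
    case True
    obtain z where z: "fst p = empirical N z" using p by (auto simp: empirical_measures_def)
    then obtain i where i: "i < N" "snd p = z i" using True by (auto simp: emeasure_empirical_pos_iff[OF N])
    then have "p = (empirical N z, z i)" using z by (simp add: prod_eq_iff)
    then show ?thesis using mv_emp[OF i(1)] i(1) True by auto
  qed (simp add: mv_def not_gr_zero)
  have atom [measurable]: "(\<lambda>p. emeasure (fst p) {snd p}) \<in> borel_measurable ?EB"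
  proof (rule emeasure_measurable_subprob_algebra2)
    \<comment> \<open>The mass of a varying singleton is measurable because the diagonal of
      \<open>S\<close> is.\<close>
    have "(SIGMA p:space ?EB. {snd p}) = {q \<in> space (?EB \<Otimes>\<^sub>M (borel :: 'a measure)). snd (fst q) = snd q}"
      by (auto simp: space_pair_measure)
    also have "\<dots> \<in> sets (?EB \<Otimes>\<^sub>M borel)" by measurable
    finally show "(SIGMA p:space ?EB. {snd p}) \<in> sets (?EB \<Otimes>\<^sub>M (borel :: 'a measure))" .
  qed measurable
  have mv_meas: "(\<lambda>(p, y). mv p y) \<in> ?EB \<Otimes>\<^sub>M (borel :: 'a measure) \<rightarrow>\<^sub>M W2_borel"
  proof (rule measurable_W2_borel_empirical[OF N])
    have rng: "mv p y \<in> empirical_measures N" if "p \<in> space ?EB" for p y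
    proof -
      have p: "fst p \<in> empirical_measures N" using that by (auto simp: space_pair_measure space_Emp)
      then show ?thesis using mv_cases[OF p, of y] by (auto simp: empirical_measures_def)
    qed
    then show "(\<lambda>(p, y). mv p y) q \<in> empirical_measures N" if "q \<in> space (?EB \<Otimes>\<^sub>M (borel :: 'a measure))" for q
      using that by (auto simp: space_pair_measure)
    have pm: "mv p y \<in> prob_measures" if "p \<in> space ?EB" for p y
      using rng[OF that] empirical_measures_subset[OF N] by blast
    show "(\<lambda>(p, y). mv p y) \<in> ?EB \<Otimes>\<^sub>M (borel :: 'a measure) \<rightarrow>\<^sub>M prob_algebra borel"
    proof (rule measurable_prob_algebraI)
      show "prob_space ((\<lambda>(p, y). mv p y) q)" if "q \<in> space (?EB \<Otimes>\<^sub>M (borel :: 'a measure))" for q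
        using that prob_measuresD(1)[OF pm] by (auto simp: space_pair_measure)
      show "(\<lambda>(p, y). mv p y) \<in> ?EB \<Otimes>\<^sub>M (borel :: 'a measure) \<rightarrow>\<^sub>M subprob_algebra borel"
      proof (rule measurable_subprob_algebra)
        fix q assume "q \<in> space (?EB \<Otimes>\<^sub>M (borel :: 'a measure))"
        then have "(\<lambda>(p, y). mv p y) q \<in> prob_measures" using pm by (auto simp: space_pair_measure)
        from prob_measuresD[OF this] show "subprob_space ((\<lambda>(p, y). mv p y) q)"
          "sets ((\<lambda>(p, y). mv p y) q) = sets borel"
          by (auto intro: prob_space_imp_subprob_space)
      next
        fix A :: "'a set" assume A [measurable]: "A \<in> sets borel"
        let ?g = "\<lambda>q :: ('a measure \<times> 'a) \<times> 'a. if emeasure (fst (fst q)) {snd (fst q)} > 0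
          then emeasure (fst (fst q)) A + indicator A (snd q) / of_nat N - indicator A (snd (fst q)) / of_nat N
          else emeasure (fst (fst q)) A"
        have eA: "(\<lambda>\<nu>. emeasure \<nu> A) \<in> borel_measurable Emp"
          using measurable_compose[OF id_sub measurable_emeasure_subprob_algebra[OF A]] .
        have [measurable]: "(\<lambda>q. emeasure (fst (fst q)) A) \<in> borel_measurable (?EB \<Otimes>\<^sub>M (borel :: 'a measure))"
          by (rule measurable_compose[OF _ eA]) measurable
        have [measurable]: "(\<lambda>q. emeasure (fst (fst q)) {snd (fst q)}) \<in> borel_measurable (?EB \<Otimes>\<^sub>M (borel :: 'a measure))"
          by (rule measurable_compose[OF _ atom]) measurable
        have "?g \<in> borel_measurable (?EB \<Otimes>\<^sub>M (borel :: 'a measure))" by measurable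
        moreover have "emeasure ((\<lambda>(p, y). mv p y) q) A = ?g q" if "q \<in> space (?EB \<Otimes>\<^sub>M (borel :: 'a measure))" for q
        proof -
          obtain p y where q: "q = (p, y)" by (cases q)
          then have p: "fst p \<in> empirical_measures N" using that by (auto simp: space_pair_measure space_Emp)
          show ?thesis
            using mv_cases[OF p, of y]
            by (auto simp: q emeasure_empirical_upd[OF A] emeasure_empirical_pos_iff[OF N])
        qed
        ultimately show "(\<lambda>q. emeasure ((\<lambda>(p, y). mv p y) q) A) \<in> borel_measurable (?EB \<Otimes>\<^sub>M (borel :: 'a measure))"
          by (rule measurable_cong[THEN iffD2, rotated])
      qed
    qed
  qed
  have "(\<lambda>q. (fst (fst q), mv (fst q) (snd q))) \<in> ?EB \<Otimes>\<^sub>M (borel :: 'a measure) \<rightarrow>\<^sub>M Emp \<Otimes>\<^sub>M W2_borel"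
    using mv_meas by (intro measurable_Pair) (measurable, simp add: case_prod_beta')
  from measurable_compose[OF this H]
  have "(\<lambda>p. \<integral>\<^sup>+ y. H (fst p) (mv p y) \<partial>\<kappa> (snd p)) \<in> borel_measurable ?EB"
    by (intro nn_integral_rate_measurable) (simp_all add: case_prod_beta')
  then have "(\<lambda>\<nu>. \<integral>\<^sup>+ x. (\<integral>\<^sup>+ y. H \<nu> (mv (\<nu>, x) y) \<partial>\<kappa> x) \<partial>\<nu>) \<in> borel_measurable Emp"
    by (intro nn_integral_measurable_subprob_algebra2[OF _ id_sub]) (simp add: case_prod_beta')
  moreover have "(\<integral>\<^sup>+ x. (\<integral>\<^sup>+ y. H \<nu> (mv (\<nu>, x) y) \<partial>\<kappa> x) \<partial>\<nu>) = (\<integral>\<^sup>+ \<eta>. H \<nu> \<eta> \<partial>lifted_kernel N \<kappa> \<nu>)"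
    if \<nu>: "\<nu> \<in> space Emp" for \<nu>
  proof -
    obtain z where z: "\<nu> = empirical N z" using \<nu> unfolding space_Emp by (auto simp: empirical_measures_def)
    have "H \<nu> \<in> borel_measurable W2_borel"
      using measurable_compose[OF measurable_Pair1'[OF \<nu>] H] by simp
    then show ?thesis
      unfolding z by (simp add: nn_integral_lifted_kernel_empirical nn_integral_empirical mv_emp)
  qed
  ultimately have "(\<lambda>\<nu>. \<integral>\<^sup>+ \<eta>. H \<nu> \<eta> \<partial>lifted_kernel N \<kappa> \<nu>) \<in> borel_measurable Emp"
    by (rule measurable_cong[THEN iffD1, rotated])
  \<comment> \<open>Extension by zero from the measurable set of empirical measures; this is the
    true value outside, where the kernel vanishes.\<close>
  then have "(\<lambda>\<nu>. (\<integral>\<^sup>+ \<eta>. H \<nu> \<eta> \<partial>lifted_kernel N \<kappa> \<nu>) * indicator (empirical_measures N) \<nu>) \<in> borel_measurable W2_borel"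
    using empirical_measures_in_W2_borel[OF N, where 'a = 'a]
    by (subst (asm) borel_measurable_restrict_space_iff_ennreal)
      (simp_all add: Int_absorb2[OF empirical_measures_subset[OF N]])
  then show ?thesis
    by (rule measurable_cong[THEN iffD1, rotated])
      (auto simp: nn_integral_lifted_kernel_outside indicator_def)
qed

end

section \<open>Structural properties of the lifted objects\<close>

lemma min_1_mono_ennreal: "(a::ennreal) \<le> b \<Longrightarrow> min 1 a \<le> min 1 b"
  by (rule min.mono) simp_all

context base_jump
begin

lemma W2_empirical_upd_squared_le:
  fixes z :: "nat \<Rightarrow> 'a"
  assumes i: "i < N"
  shows "(W2 (empirical N z) (empirical N (z(i := y))))\<^sup>2 \<le> (ennreal (dist (z i) y))\<^sup>2"
proof -
  have "(W2 (empirical N z) (empirical N (z(i := y))))\<^sup>2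
      \<le> (\<Sum>j<N. ennreal ((dist (z j) ((z(i := y)) j))\<^sup>2)) / of_nat N"
    by (rule W2_empirical_squared_le[OF N])
  also have "(\<Sum>j<N. ennreal ((dist (z j) ((z(i := y)) j))\<^sup>2)) = (\<Sum>j<N. if j = i then ennreal ((dist (z i) y)\<^sup>2) else 0)"
    by (intro sum.cong) auto
  also have "\<dots> = ennreal ((dist (z i) y)\<^sup>2)" using i by simp
  also have "ennreal ((dist (z i) y)\<^sup>2) / of_nat N = ennreal ((dist (z i) y)\<^sup>2 / real N)"
    using N by (simp add: divide_ennreal ennreal_of_nat_eq_real_of_nat)
  \<comment> \<open>The gain of \<open>1 / N\<close> is given away here: what remains is the base
    distance, and averaging over the particles reproduces the constant of \<open>\<kappa>\<close>
    exactly.\<close>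
  also have "\<dots> \<le> ennreal ((dist (z i) y)\<^sup>2)"
    using N mult_left_mono[of 1 "real N" "(dist (z i) y)\<^sup>2"] by (intro ennreal_leI) (simp add: field_simps)
  finally show ?thesis by (simp only: ennreal_power[OF zero_le_dist])
qed

lemma truncated_W2_measurable [measurable]:
  fixes \<nu> :: "'a measure"
  shows "(\<lambda>\<eta>. min 1 ((W2 \<nu> \<eta>)\<^sup>2)) \<in> borel_measurable W2_borel"
  by (subst W2_commute) measurable

lemma lifted_kernel_rate_le:
  assumes \<nu>: "\<nu> \<in> prob_measures"
  shows "(\<integral>\<^sup>+ \<eta>. min 1 ((W2 \<nu> \<eta>)\<^sup>2) \<partial>lifted_kernel N \<kappa> \<nu>) \<le> c\<^sub>\<kappa>"
proof (cases "\<nu> \<in> empirical_measures N")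
  case True
  then obtain z where z: "\<nu> = empirical N z" by (auto simp: empirical_measures_def)
  have "(\<integral>\<^sup>+ \<eta>. min 1 ((W2 \<nu> \<eta>)\<^sup>2) \<partial>lifted_kernel N \<kappa> \<nu>) =
      (\<Sum>i<N. \<integral>\<^sup>+ y. min 1 ((W2 \<nu> (empirical N (z(i := y))))\<^sup>2) \<partial>\<kappa> (z i)) / of_nat N"
    unfolding z by (rule nn_integral_lifted_kernel_empirical) measurable
  also have "\<dots> \<le> (\<Sum>i<N. c\<^sub>\<kappa>) / of_nat N"
  proof (intro divide_right_mono_ennreal sum_mono)
    fix i assume "i \<in> {..<N}"
    then have "(\<integral>\<^sup>+ y. min 1 ((W2 \<nu> (empirical N (z(i := y))))\<^sup>2) \<partial>\<kappa> (z i)) \<le> (\<integral>\<^sup>+ y. weight (z i) y \<partial>\<kappa> (z i))"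
      unfolding weight_def z by (intro nn_integral_mono min_1_mono_ennreal W2_empirical_upd_squared_le) simp
    also have "\<dots> \<le> c\<^sub>\<kappa>" by (rule nn_integral_weight_le)
    finally show "(\<integral>\<^sup>+ y. min 1 ((W2 \<nu> (empirical N (z(i := y))))\<^sup>2) \<partial>\<kappa> (z i)) \<le> c\<^sub>\<kappa>" .
  qed
  also have "\<dots> = c\<^sub>\<kappa>"
    using N by (simp add: mult_divide_eq_ennreal mult.commute[of "of_nat N"])
  finally show ?thesis .
qed (simp add: nn_integral_lifted_kernel_outside[OF \<nu>])

lemma lifted_rate_bound_le: "rate_bound prob_measures W2 (lifted_kernel N \<kappa>) \<le> c\<^sub>\<kappa>"
  unfolding rate_bound_def[of prob_measures] by (intro SUP_least lifted_kernel_rate_le)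

text \<open>Moving an atom elsewhere lowers the multiplicity of its old position. Staying put is
  thus the only move fixing the measure, and it has rate zero because \<open>\<kappa>\<close> does
  not charge the diagonal.\<close>

lemma empirical_upd_eq_iff:
  fixes z :: "nat \<Rightarrow> 'a"
  assumes i: "i < N"
  shows "empirical N (z(i := y)) = empirical N z \<longleftrightarrow> y = z i"
proof
  assume eq: "empirical N (z(i := y)) = empirical N z"
  show "y = z i"
  proof (rule ccontr)
    assume ne: "y \<noteq> z i"
    have "card {j\<in>{..<N}. (z(i := y)) j \<in> {z i}} = card {j\<in>{..<N}. z j \<in> {z i}}"
      using emeasure_empirical_card[of "{z i}" N "z(i := y)"] emeasure_empirical_card[of "{z i}" N z] N eq
      by (simp del: fun_upd_apply)
    moreover have "{j\<in>{..<N}. (z(i := y)) j \<in> {z i}} \<subset> {j\<in>{..<N}. z j \<in> {z i}}"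
      using i ne by auto
    then have "card {j\<in>{..<N}. (z(i := y)) j \<in> {z i}} < card {j\<in>{..<N}. z j \<in> {z i}}"
      by (rule psubset_card_mono[rotated]) simp
    ultimately show False by simp
  qed
qed simp

lemma lifted_kernel_self:
  assumes \<nu>: "\<nu> \<in> prob_measures"
  shows "emeasure (lifted_kernel N \<kappa> \<nu>) {\<nu>} = 0"
proof -
  have s: "{\<nu>} \<in> sets W2_borel" by (rule singleton_in_W2_borel[OF \<nu>])
  have "(\<integral>\<^sup>+ \<eta>. indicator {\<nu>} \<eta> \<partial>lifted_kernel N \<kappa> \<nu>) = 0"
  proof (cases "\<nu> \<in> empirical_measures N")
    case True
    then obtain z where z: "\<nu> = empirical N z" by (auto simp: empirical_measures_def)
    have "(\<integral>\<^sup>+ y. indicator {\<nu>} (empirical N (z(i := y))) \<partial>\<kappa> (z i)) = 0" if "i < N" for i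
    proof -
      have "(\<integral>\<^sup>+ y. indicator {\<nu>} (empirical N (z(i := y))) \<partial>\<kappa> (z i)) = (\<integral>\<^sup>+ y. indicator {z i} y \<partial>\<kappa> (z i))"
        by (intro nn_integral_cong) (simp add: indicator_def z empirical_upd_eq_iff[OF that])
      also have "\<dots> = 0" by (simp add: sets_rate rate_self)
      finally show ?thesis .
    qed
    then show ?thesis
      using s unfolding z by (subst nn_integral_lifted_kernel_empirical) simp_all
  qed (simp add: nn_integral_lifted_kernel_outside[OF \<nu>])
  then show ?thesis using s by simp
qed

text \<open>The truncated squared distance from \<open>\<nu>\<close> is integrable by the rate bound
  and vanishes only at \<open>\<nu>\<close>, which is a null point.\<close>

lemma lifted_kernel_sigma_finite:
  assumes \<nu>: "\<nu> \<in> prob_measures"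
  shows "sigma_finite_measure (lifted_kernel N \<kappa> \<nu>)"
proof (rule sigma_finite_measureI_nn_integral)
  show "(\<lambda>\<eta>. min 1 ((W2 \<nu> \<eta>)\<^sup>2)) \<in> borel_measurable (lifted_kernel N \<kappa> \<nu>)"
    using truncated_W2_measurable by (simp add: measurable_cong_sets[OF sets_lifted_kernel refl])
  show "(\<integral>\<^sup>+ \<eta>. min 1 ((W2 \<nu> \<eta>)\<^sup>2) \<partial>lifted_kernel N \<kappa> \<nu>) < \<infinity>"
    using lifted_kernel_rate_le[OF \<nu>] rate_bound_finite by (rule le_less_trans)
  have "min 1 ((W2 \<nu> \<eta>)\<^sup>2) = 0 \<longleftrightarrow> W2 \<nu> \<eta> = 0" for \<eta> by (auto simp: min_def)
  then have "{\<eta> \<in> space (lifted_kernel N \<kappa> \<nu>). min 1 ((W2 \<nu> \<eta>)\<^sup>2) = 0} = {\<nu>}"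
    using \<nu> by (auto intro: W2_refl dest: W2_eq_0D)
  then show "{\<eta> \<in> space (lifted_kernel N \<kappa> \<nu>). min 1 ((W2 \<nu> \<eta>)\<^sup>2) = 0} \<in> null_sets (lifted_kernel N \<kappa> \<nu>)"
    using lifted_kernel_self[OF \<nu>] singleton_in_W2_borel[OF \<nu>] by (simp add: null_sets_def)
qed

lemma snd_measurable_Emp: "f \<in> borel_measurable W2_borel \<Longrightarrow> (\<lambda>(\<nu>, \<eta>). f \<eta>) \<in> borel_measurable (Emp \<Otimes>\<^sub>M W2_borel)"
  unfolding case_prod_beta' by (rule measurable_compose[OF measurable_snd])

lemma emeasure_lifted_kernel_measurable:
  assumes E: "E \<in> sets W2_borel"
  shows "(\<lambda>\<nu>. emeasure (lifted_kernel N \<kappa> \<nu>) E) \<in> borel_measurable W2_borel"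
  using nn_integral_lifted_kernel_measurable[OF snd_measurable_Emp[of "indicator E"]] E by simp

text \<open>The Bochner integral is a difference of the integrals of positive and negative parts,
  finite since a multiple of the truncated squared distance dominates the integrand. Joint
  measurability is required only for empirical \<open>\<nu>\<close>, where it is available.\<close>

lemma lifted_kernel_integral_measurable:
  fixes f :: "'a measure \<Rightarrow> real"
  assumes f [measurable]: "f \<in> borel_measurable W2_borel" and bdd: "bounded (f ` prob_measures)"
  shows "(\<lambda>\<nu>. set_lebesgue_integral (lifted_kernel N \<kappa> \<nu>) (prob_measures - {\<nu>})
      (\<lambda>\<eta>. f \<eta> * enn2real (min 1 ((W2 \<nu> \<eta>)\<^sup>2)))) \<in> borel_measurable W2_borel"
proof -
  define k where "k \<nu> \<eta> = f \<eta> * enn2real (min 1 ((W2 \<nu> \<eta>)\<^sup>2))" for \<nu> \<eta>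
  obtain B where B: "\<And>\<eta>. \<eta> \<in> prob_measures \<Longrightarrow> \<bar>f \<eta>\<bar> \<le> B"
    using bdd by (auto simp: bounded_iff)
  have k_meas: "(\<lambda>(\<nu>, \<eta>). k \<nu> \<eta>) \<in> borel_measurable (Emp \<Otimes>\<^sub>M W2_borel)"
  proof -
    have [measurable]: "(\<lambda>p. f (snd p)) \<in> borel_measurable (Emp \<Otimes>\<^sub>M W2_borel)" by measurable
    have [measurable]: "(\<lambda>p. W2 (fst p) (snd p)) \<in> borel_measurable (Emp \<Otimes>\<^sub>M W2_borel)"
      using W2_empirical_joint_measurable[OF N, where 'a = 'a] by (simp add: case_prod_beta')
    show ?thesis unfolding k_def case_prod_beta' by measurable
  qed
  have m1: "(\<lambda>\<nu>. \<integral>\<^sup>+ \<eta>. ennreal (k \<nu> \<eta>) \<partial>lifted_kernel N \<kappa> \<nu>) \<in> borel_measurable W2_borel"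
    using k_meas by (intro nn_integral_lifted_kernel_measurable) (simp add: case_prod_beta')
  have m2: "(\<lambda>\<nu>. \<integral>\<^sup>+ \<eta>. ennreal (- k \<nu> \<eta>) \<partial>lifted_kernel N \<kappa> \<nu>) \<in> borel_measurable W2_borel"
    using k_meas by (intro nn_integral_lifted_kernel_measurable) (simp add: case_prod_beta')
  have eq: "set_lebesgue_integral (lifted_kernel N \<kappa> \<nu>) (prob_measures - {\<nu>}) (k \<nu>) =
      enn2real (\<integral>\<^sup>+ \<eta>. ennreal (k \<nu> \<eta>) \<partial>lifted_kernel N \<kappa> \<nu>)
      - enn2real (\<integral>\<^sup>+ \<eta>. ennreal (- k \<nu> \<eta>) \<partial>lifted_kernel N \<kappa> \<nu>)"
    if \<nu>: "\<nu> \<in> prob_measures" for \<nu>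
  proof -
    let ?K = "lifted_kernel N \<kappa> \<nu>"
    have k\<nu>: "k \<nu> \<in> borel_measurable ?K"
      unfolding measurable_cong_sets[OF sets_lifted_kernel refl] k_def by measurable
    \<comment> \<open>Removing \<open>\<nu>\<close> from the domain changes nothing, because the
      integrand is zero at distance zero.\<close>
    have "set_lebesgue_integral ?K (prob_measures - {\<nu>}) (k \<nu>) = integral\<^sup>L ?K (k \<nu>)"
      unfolding set_lebesgue_integral_def
      by (intro Bochner_Integration.integral_cong) (auto simp: indicator_def k_def W2_refl[OF \<nu>])
    moreover have "integrable ?K (k \<nu>)"
    proof (rule integrableI_bounded[OF k\<nu>])
      have "(\<integral>\<^sup>+ \<eta>. ennreal (norm (k \<nu> \<eta>)) \<partial>?K) \<le> (\<integral>\<^sup>+ \<eta>. ennreal B * min 1 ((W2 \<nu> \<eta>)\<^sup>2) \<partial>?K)"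
      proof (rule nn_integral_mono)
        fix \<eta> assume "\<eta> \<in> space ?K"
        then have \<eta>: "\<bar>f \<eta>\<bar> \<le> B" using B by simp
        have fin: "min 1 ((W2 \<nu> \<eta>)\<^sup>2) < top"
          by (rule le_less_trans[OF min.cobounded1 ennreal_one_less_top])
        have "ennreal (norm (k \<nu> \<eta>)) = ennreal \<bar>f \<eta>\<bar> * ennreal (enn2real (min 1 ((W2 \<nu> \<eta>)\<^sup>2)))"
          by (simp add: k_def abs_mult ennreal_mult)
        also have "\<dots> = ennreal \<bar>f \<eta>\<bar> * min 1 ((W2 \<nu> \<eta>)\<^sup>2)"
          using fin by (simp only: ennreal_enn2real)
        also have "\<dots> \<le> ennreal B * min 1 ((W2 \<nu> \<eta>)\<^sup>2)"
          using \<eta> by (intro mult_right_mono ennreal_leI) auto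
        finally show "ennreal (norm (k \<nu> \<eta>)) \<le> ennreal B * min 1 ((W2 \<nu> \<eta>)\<^sup>2)" .
      qed
      also have "\<dots> = ennreal B * (\<integral>\<^sup>+ \<eta>. min 1 ((W2 \<nu> \<eta>)\<^sup>2) \<partial>?K)"
        by (intro nn_integral_cmult)
          (simp only: measurable_cong_sets[OF sets_lifted_kernel refl] truncated_W2_measurable)
      also have "\<dots> < \<infinity>"
        using le_less_trans[OF lifted_kernel_rate_le[OF \<nu>] rate_bound_finite]
        by (simp add: ennreal_mult_less_top)
      finally show "(\<integral>\<^sup>+ \<eta>. ennreal (norm (k \<nu> \<eta>)) \<partial>?K) < \<infinity>" .
    qed
    ultimately show ?thesis by (simp add: real_lebesgue_integral_def)
  qed
  have "(\<lambda>\<nu>. enn2real (\<integral>\<^sup>+ \<eta>. ennreal (k \<nu> \<eta>) \<partial>lifted_kernel N \<kappa> \<nu>)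
      - enn2real (\<integral>\<^sup>+ \<eta>. ennreal (- k \<nu> \<eta>) \<partial>lifted_kernel N \<kappa> \<nu>)) \<in> borel_measurable W2_borel"
    using m1 m2 by measurable
  then show ?thesis
    unfolding k_def[symmetric] by (rule measurable_cong[THEN iffD2, rotated]) (simp add: eq)
qed

lemma empirical_measurable_PiM: "empirical N \<in> (\<Pi>\<^sub>M i\<in>{..<N}. \<pi>) \<rightarrow>\<^sub>M W2_borel"
  by (rule empirical_measurable[OF N, of "\<lambda>z. z"]) (simp add: measurable_cong_sets[OF refl sets_base, symmetric])

lemma finite_lifted_measure: "finite_measure (lifted_measure N \<pi>)"
proof -
  interpret finite_measure \<pi> by (rule finite_base)
  interpret product_sigma_finite "\<lambda>_::nat. \<pi>" ..
  have "emeasure (\<Pi>\<^sub>M i\<in>{..<N}. \<pi>) (space (\<Pi>\<^sub>M i\<in>{..<N}. \<pi>)) = (\<Prod>i<N. emeasure \<pi> (space \<pi>))"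
    unfolding space_PiM by (rule emeasure_PiM) auto
  also have "\<dots> \<noteq> \<infinity>" by (simp add: emeasure_eq_measure ennreal_power)
  finally have "finite_measure (\<Pi>\<^sub>M i\<in>{..<N}. \<pi>)" by (rule finite_measureI)
  then show ?thesis
    unfolding lifted_measure_def using empirical_measurable_PiM by (rule finite_measure.finite_measure_distr)
qed


section \<open>Detailed balance, one particle at a time\<close>

abbreviation P\<^sub>N :: "(nat \<Rightarrow> 'a) measure" where
  "P\<^sub>N \<equiv> \<Pi>\<^sub>M i\<in>{..<N}. \<pi>"

lemma section_in_borel:
  fixes w z :: "nat \<Rightarrow> 'a"
  assumes F: "F \<in> sets (W2_borel \<Otimes>\<^sub>M W2_borel)"
  shows "{y. (empirical N w, empirical N (z(i := y))) \<in> F} \<in> sets borel"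
proof -
  have "(\<lambda>y. (empirical N w, empirical N (z(i := y)))) \<in> borel \<rightarrow>\<^sub>M W2_borel \<Otimes>\<^sub>M W2_borel"
    by (intro measurable_Pair measurable_const upd_measurable) (simp add: empirical_in_prob_measures[OF N])
  from measurable_sets[OF this F] show ?thesis by (simp add: vimage_def)
qed

lemma section_integral:
  fixes w z :: "nat \<Rightarrow> 'a"
  assumes F: "F \<in> sets (W2_borel \<Otimes>\<^sub>M W2_borel)"
  shows "(\<integral>\<^sup>+ y. indicator F (empirical N w, empirical N (z(i := y))) \<partial>\<kappa> x) =
    emeasure (\<kappa> x) {y. (empirical N w, empirical N (z(i := y))) \<in> F}"
proof -
  let ?A = "{y. (empirical N w, empirical N (z(i := y))) \<in> F}"
  have "(\<integral>\<^sup>+ y. indicator F (empirical N w, empirical N (z(i := y))) \<partial>\<kappa> x) = (\<integral>\<^sup>+ y. indicator ?A y \<partial>\<kappa> x)"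
    by (intro nn_integral_cong) (simp add: indicator_def)
  then show ?thesis using section_in_borel[OF F, of w z i] by (simp add: sets_rate)
qed

lemma one_particle_measurable:
  assumes i: "i < N" and F: "F \<in> sets (W2_borel \<Otimes>\<^sub>M W2_borel)"
  shows "(\<lambda>z. emeasure (\<kappa> (z i)) {y. (empirical N z, empirical N (z(i := y))) \<in> F}) \<in> borel_measurable P\<^sub>N"
proof -
  have comp: "(\<lambda>z. z j) \<in> P\<^sub>N \<rightarrow>\<^sub>M borel" if "j < N" for j
    using that by (simp add: measurable_cong_sets[OF refl sets_base, symmetric])
  have m1: "(\<lambda>q. empirical N (fst q)) \<in> P\<^sub>N \<Otimes>\<^sub>M (borel :: 'a measure) \<rightarrow>\<^sub>M W2_borel"
    by (rule empirical_measurable[OF N]) (rule measurable_compose[OF measurable_fst comp])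
  have m2: "(\<lambda>q. empirical N ((fst q)(i := snd q))) \<in> P\<^sub>N \<Otimes>\<^sub>M (borel :: 'a measure) \<rightarrow>\<^sub>M W2_borel"
  proof (rule empirical_measurable[OF N])
    fix j assume j: "j < N"
    show "(\<lambda>q. ((fst q)(i := snd q)) j) \<in> P\<^sub>N \<Otimes>\<^sub>M borel \<rightarrow>\<^sub>M borel"
      using measurable_compose[OF measurable_fst comp[OF j]] by (cases "j = i") simp_all
  qed
  have "(\<lambda>q. indicator F (empirical N (fst q), empirical N ((fst q)(i := snd q))) :: ennreal)
      \<in> borel_measurable (P\<^sub>N \<Otimes>\<^sub>M borel)"
    by (rule measurable_compose[OF measurable_Pair[OF m1 m2] borel_measurable_indicator[OF F]])
  then have "(\<lambda>z. \<integral>\<^sup>+ y. indicator F (empirical N z, empirical N (z(i := y))) \<partial>\<kappa> (z i)) \<in> borel_measurable P\<^sub>N"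
    by (intro nn_integral_rate_measurable comp[OF i]) (simp add: case_prod_beta')
  then show ?thesis by (simp only: section_integral[OF F])
qed

text \<open>The lifted flow is the mean of the flows in which a single particle jumps, so its
  symmetry can be checked for each coordinate separately.\<close>

lemma lifted_flow:
  assumes F: "F \<in> sets (W2_borel \<Otimes>\<^sub>M W2_borel)"
  shows "(\<integral>\<^sup>+ \<nu>. emeasure (lifted_kernel N \<kappa> \<nu>) {\<eta>\<in>prob_measures. (\<nu>, \<eta>) \<in> F} \<partial>lifted_measure N \<pi>) =
    (\<Sum>i<N. \<integral>\<^sup>+ z. emeasure (\<kappa> (z i)) {y. (empirical N z, empirical N (z(i := y))) \<in> F} \<partial>P\<^sub>N) / of_nat N"
proof -
  have Pair: "(\<lambda>\<eta>. (\<nu>, \<eta>)) \<in> W2_borel \<rightarrow>\<^sub>M W2_borel \<Otimes>\<^sub>M W2_borel" if "\<nu> \<in> prob_measures" for \<nu> :: "'a measure"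
    using that by (intro measurable_Pair measurable_const) simp_all
  have sec: "(\<integral>\<^sup>+ \<eta>. indicator F (\<nu>, \<eta>) \<partial>lifted_kernel N \<kappa> \<nu>) =
      emeasure (lifted_kernel N \<kappa> \<nu>) {\<eta>\<in>prob_measures. (\<nu>, \<eta>) \<in> F}" if "\<nu> \<in> prob_measures" for \<nu>
  proof -
    have "{\<eta>\<in>prob_measures. (\<nu>, \<eta>) \<in> F} \<in> sets (lifted_kernel N \<kappa> \<nu>)"
      using measurable_sets[OF Pair[OF that] F] by (simp add: vimage_def Int_def conj_commute)
    moreover have "(\<integral>\<^sup>+ \<eta>. indicator F (\<nu>, \<eta>) \<partial>lifted_kernel N \<kappa> \<nu>) =
        (\<integral>\<^sup>+ \<eta>. indicator {\<eta>\<in>prob_measures. (\<nu>, \<eta>) \<in> F} \<eta> \<partial>lifted_kernel N \<kappa> \<nu>)"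
      by (intro nn_integral_cong) (simp add: indicator_def)
    ultimately show ?thesis by simp
  qed
  have "(\<lambda>q. (fst q, snd q)) \<in> Emp \<Otimes>\<^sub>M W2_borel \<rightarrow>\<^sub>M W2_borel \<Otimes>\<^sub>M W2_borel"
    by (intro measurable_Pair measurable_compose[OF measurable_fst measurable_Emp_W2_borel] measurable_snd)
  from measurable_compose[OF this borel_measurable_indicator[OF F]]
  have m: "(\<lambda>\<nu>. \<integral>\<^sup>+ \<eta>. indicator F (\<nu>, \<eta>) \<partial>lifted_kernel N \<kappa> \<nu>) \<in> borel_measurable W2_borel"
    by (intro nn_integral_lifted_kernel_measurable) (simp add: case_prod_beta')
  have "(\<integral>\<^sup>+ \<nu>. emeasure (lifted_kernel N \<kappa> \<nu>) {\<eta>\<in>prob_measures. (\<nu>, \<eta>) \<in> F} \<partial>lifted_measure N \<pi>) =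
      (\<integral>\<^sup>+ \<nu>. \<integral>\<^sup>+ \<eta>. indicator F (\<nu>, \<eta>) \<partial>lifted_kernel N \<kappa> \<nu> \<partial>lifted_measure N \<pi>)"
    by (intro nn_integral_cong) (simp add: sec lifted_measure_def)
  also have "\<dots> = (\<integral>\<^sup>+ z. \<integral>\<^sup>+ \<eta>. indicator F (empirical N z, \<eta>) \<partial>lifted_kernel N \<kappa> (empirical N z) \<partial>P\<^sub>N)"
    unfolding lifted_measure_def using m by (intro nn_integral_distr empirical_measurable_PiM) simp
  also have "\<dots> = (\<integral>\<^sup>+ z. (\<Sum>i<N. emeasure (\<kappa> (z i)) {y. (empirical N z, empirical N (z(i := y))) \<in> F}) / of_nat N \<partial>P\<^sub>N)"
  proof (rule nn_integral_cong)
    fix z :: "nat \<Rightarrow> 'a"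
    have "(\<integral>\<^sup>+ \<eta>. indicator F (empirical N z, \<eta>) \<partial>lifted_kernel N \<kappa> (empirical N z)) =
        (\<Sum>i<N. \<integral>\<^sup>+ y. indicator F (empirical N z, empirical N (z(i := y))) \<partial>\<kappa> (z i)) / of_nat N"
      by (rule nn_integral_lifted_kernel_empirical)
        (rule measurable_compose[OF Pair borel_measurable_indicator[OF F]], rule empirical_in_prob_measures[OF N])
    then show "(\<integral>\<^sup>+ \<eta>. indicator F (empirical N z, \<eta>) \<partial>lifted_kernel N \<kappa> (empirical N z)) =
        (\<Sum>i<N. emeasure (\<kappa> (z i)) {y. (empirical N z, empirical N (z(i := y))) \<in> F}) / of_nat N"
      by (simp only: section_integral[OF F])
  qed
  also have "\<dots> = (\<Sum>i<N. \<integral>\<^sup>+ z. emeasure (\<kappa> (z i)) {y. (empirical N z, empirical N (z(i := y))) \<in> F} \<partial>P\<^sub>N) / of_nat N"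
    using one_particle_measurable[OF _ F]
    by (subst nn_integral_divide, simp, subst nn_integral_sum) simp_all
  finally show ?thesis .
qed

text \<open>Moving one particle is reversible by the detailed balance of \<open>\<kappa>\<close>, the other particles
  being frozen by Fubini.\<close>

lemma one_particle_detailed_balance:
  assumes i: "i < N" and F: "F \<in> sets (W2_borel \<Otimes>\<^sub>M W2_borel)" and F': "F' \<in> sets (W2_borel \<Otimes>\<^sub>M W2_borel)"
    and swap: "\<And>\<nu> \<eta>. (\<nu>, \<eta>) \<in> F' \<longleftrightarrow> (\<eta>, \<nu>) \<in> F"
  shows "(\<integral>\<^sup>+ z. emeasure (\<kappa> (z i)) {y. (empirical N z, empirical N (z(i := y))) \<in> F} \<partial>P\<^sub>N) =
    (\<integral>\<^sup>+ z. emeasure (\<kappa> (z i)) {y. (empirical N z, empirical N (z(i := y))) \<in> F'} \<partial>P\<^sub>N)"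
proof -
  interpret finite_measure \<pi> by (rule finite_base)
  interpret product_sigma_finite "\<lambda>_::nat. \<pi>" ..
  let ?J = "{..<N} - {i}"
  have J: "insert i ?J = {..<N}" using i by auto
  \<comment> \<open>Overwriting coordinate \<open>i\<close> with \<open>y\<close> forgets the
    \<open>x\<close> placed there before. With the other coordinates frozen, the integrand is
    therefore the section at \<open>x\<close> of one fixed set of pairs in \<open>S\<close>.\<close>
  have fubini: "(\<integral>\<^sup>+ z. emeasure (\<kappa> (z i)) {y. (empirical N z, empirical N (z(i := y))) \<in> G} \<partial>P\<^sub>N) =
      (\<integral>\<^sup>+ z. \<integral>\<^sup>+ x. emeasure (\<kappa> x) {y. (empirical N (z(i := x)), empirical N (z(i := y))) \<in> G} \<partial>\<pi> \<partial>(\<Pi>\<^sub>M i\<in>?J. \<pi>))"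
    if G: "G \<in> sets (W2_borel \<Otimes>\<^sub>M W2_borel)" for G
    using product_nn_integral_insert[of ?J i, unfolded J, OF _ _ one_particle_measurable[OF i G]] by simp
  have "(\<integral>\<^sup>+ x. emeasure (\<kappa> x) {y. (empirical N (z(i := x)), empirical N (z(i := y))) \<in> F} \<partial>\<pi>) =
    (\<integral>\<^sup>+ x. emeasure (\<kappa> x) {y. (empirical N (z(i := x)), empirical N (z(i := y))) \<in> F'} \<partial>\<pi>)" for z :: "nat \<Rightarrow> 'a"
  proof -
    have "(\<lambda>q. (empirical N (z(i := fst q)), empirical N (z(i := snd q)))) \<in> borel \<Otimes>\<^sub>M borel \<rightarrow>\<^sub>M W2_borel \<Otimes>\<^sub>M W2_borel"
      by (intro measurable_Pair measurable_compose[OF measurable_fst upd_measurable]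
          measurable_compose[OF measurable_snd upd_measurable])
    from measurable_sets[OF this F]
    have "{q. (empirical N (z(i := fst q)), empirical N (z(i := snd q))) \<in> F} \<in> sets (borel \<Otimes>\<^sub>M borel)"
      by (simp add: vimage_def space_pair_measure)
    \<comment> \<open>Exchanging \<open>x\<close> and \<open>y\<close> in that set exchanges the two
      empirical measures, which replaces \<open>F\<close> by its transpose.\<close>
    from rate_detailed_balance[OF this] show ?thesis by (simp add: swap)
  qed
  then show ?thesis
    unfolding fubini[OF F] fubini[OF F'] by simp
qed

lemma lifted_detailed_balance:
  assumes E: "E \<in> sets (W2_borel \<Otimes>\<^sub>M W2_borel)"
  shows "(\<integral>\<^sup>+ \<nu>. emeasure (lifted_kernel N \<kappa> \<nu>) {\<eta>\<in>prob_measures. (\<nu>, \<eta>) \<in> E} \<partial>lifted_measure N \<pi>) =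
    (\<integral>\<^sup>+ \<nu>. emeasure (lifted_kernel N \<kappa> \<nu>) {\<eta>\<in>prob_measures. (\<eta>, \<nu>) \<in> E} \<partial>lifted_measure N \<pi>)"
proof -
  define E' where "E' = (\<lambda>p. (snd p, fst p)) -` E \<inter> space (W2_borel \<Otimes>\<^sub>M (W2_borel :: 'a measure measure))"
  have "(\<lambda>p. (snd p, fst p)) \<in> W2_borel \<Otimes>\<^sub>M W2_borel \<rightarrow>\<^sub>M W2_borel \<Otimes>\<^sub>M (W2_borel :: 'a measure measure)"
    by measurable
  then have E': "E' \<in> sets (W2_borel \<Otimes>\<^sub>M W2_borel)"
    unfolding E'_def using E by (rule measurable_sets)
  have swap: "(\<nu>, \<eta>) \<in> E' \<longleftrightarrow> (\<eta>, \<nu>) \<in> E" for \<nu> \<eta>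
    using sets.sets_into_space[OF E] by (auto simp: E'_def space_pair_measure)
  have "(\<integral>\<^sup>+ \<nu>. emeasure (lifted_kernel N \<kappa> \<nu>) {\<eta>\<in>prob_measures. (\<nu>, \<eta>) \<in> E} \<partial>lifted_measure N \<pi>) =
    (\<integral>\<^sup>+ \<nu>. emeasure (lifted_kernel N \<kappa> \<nu>) {\<eta>\<in>prob_measures. (\<nu>, \<eta>) \<in> E'} \<partial>lifted_measure N \<pi>)"
    unfolding lifted_flow[OF E] lifted_flow[OF E']
    using one_particle_detailed_balance[OF _ E E' swap] by simp
  then show ?thesis by (simp add: swap)
qed

lemma lifted_jump_structure:
  "jump_structure prob_measures W2 (lifted_measure N \<pi>) (lifted_kernel N \<kappa>)"
  unfolding jump_structure_def
proof (intro conjI ballI allI impI)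
  show "sets (lifted_measure N \<pi>) = sets W2_borel" by (simp add: lifted_measure_def)
  show "rate_bound prob_measures W2 (lifted_kernel N \<kappa>) < \<infinity>"
    using lifted_rate_bound_le rate_bound_finite by (rule le_less_trans)
qed (simp_all add: finite_lifted_measure lifted_kernel_sigma_finite singleton_in_W2_borel lifted_kernel_self
    emeasure_lifted_kernel_measurable lifted_kernel_integral_measurable lifted_detailed_balance)

end

section \<open>Separability of \<open>W2\<close>\<close>

text \<open>The joint law of two random variables on a common space couples their laws.\<close>

lemma W2_distr_squared_le:
  fixes f g :: "'b \<Rightarrow> 'a::{metric_space, second_countable_topology}"
  assumes M: "prob_space M" and f [measurable]: "f \<in> M \<rightarrow>\<^sub>M borel" and g [measurable]: "g \<in> M \<rightarrow>\<^sub>M borel"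
  shows "(W2 (distr M borel f) (distr M borel g))\<^sup>2 \<le> (\<integral>\<^sup>+ x. ennreal ((dist (f x) (g x))\<^sup>2) \<partial>M)"
proof -
  let ?\<gamma> = "distr M borel (\<lambda>x. (f x, g x))"
  have m: "(\<lambda>x. (f x, g x)) \<in> M \<rightarrow>\<^sub>M borel" unfolding borel_prod[symmetric] by measurable
  have "?\<gamma> \<in> couplings (distr M borel f) (distr M borel g)"
  proof (rule couplingsI)
    show "prob_space (distr M borel f)" by (rule prob_space.prob_space_distr[OF M f])
    fix A :: "'a set" assume A: "A \<in> sets borel"
    show "emeasure ?\<gamma> (A \<times> UNIV) = emeasure (distr M borel f) A"
      using A m f Times_in_borel[of A UNIV] by (simp add: emeasure_distr vimage_def)
    show "emeasure ?\<gamma> (UNIV \<times> A) = emeasure (distr M borel g) A"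
      using A m g Times_in_borel[of UNIV A] by (simp add: emeasure_distr vimage_def)
  qed simp_all
  from W2_squared_le[OF this] show ?thesis
    unfolding coupling_cost_def by (subst (asm) nn_integral_distr[OF m]) (simp_all only: measurable_distr_eq1 measurable_cost fst_conv snd_conv)
qed

section \<open>Quantization by empirical measures\<close>

definition cell_mass :: "'a measure \<Rightarrow> ('a \<Rightarrow> nat) \<Rightarrow> nat \<Rightarrow> real" where
  "cell_mass \<mu> T k = measure \<mu> (T -` {k})"

text \<open>On a null cell with \<open>k < n\<close> the value is \<open>0 / 0 = 0\<close>.\<close>

definition kept_fraction :: "'a measure \<Rightarrow> ('a \<Rightarrow> nat) \<Rightarrow> nat \<Rightarrow> nat \<Rightarrow> real" where
  "kept_fraction \<mu> T n k =
    (if k < n then \<lfloor>real n * cell_mass \<mu> T k\<rfloor> / (real n * cell_mass \<mu> T k) else 0)"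

lemma kept_fraction_bounds: "0 \<le> kept_fraction \<mu> T n k" "kept_fraction \<mu> T n k \<le> 1"
proof -
  have p: "cell_mass \<mu> T k \<ge> 0" by (simp add: cell_mass_def)
  then show "0 \<le> kept_fraction \<mu> T n k" by (simp add: kept_fraction_def)
  show "kept_fraction \<mu> T n k \<le> 1"
    using p by (cases "real n * cell_mass \<mu> T k = 0") (auto simp: kept_fraction_def divide_le_eq_1)
qed

text \<open>Rounding \<open>n\<close> times the cell mass down loses less than 1, a relative loss
  that tends to zero when the cell has positive mass.\<close>

lemma kept_fraction_tendsto:
  assumes "cell_mass \<mu> T k > 0"
  shows "(\<lambda>n. kept_fraction \<mu> T n k) \<longlonglongrightarrow> 1"
proof (rule tendsto_sandwich[OF _ _ _ tendsto_const])
  let ?p = "cell_mass \<mu> T k"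
  show "eventually (\<lambda>n. 1 - 1 / (real n * ?p) \<le> kept_fraction \<mu> T n k) sequentially"
    using eventually_gt_at_top[of k]
  proof eventually_elim
    case (elim n)
    then have pos: "real n * ?p > 0" using assms by simp
    have "real n * ?p - 1 \<le> \<lfloor>real n * ?p\<rfloor>" by linarith
    then have "(real n * ?p - 1) / (real n * ?p) \<le> \<lfloor>real n * ?p\<rfloor> / (real n * ?p)"
      using pos by (intro divide_right_mono) auto
    moreover have "(real n * ?p - 1) / (real n * ?p) = 1 - 1 / (real n * ?p)"
      using less_imp_neq[OF pos, symmetric] by (subst diff_divide_distrib, subst divide_self) simp_all
    ultimately show ?case using elim by (simp add: kept_fraction_def)
  qed
  have "(\<lambda>n. 1 - inverse (real n) * (1 / ?p)) \<longlonglongrightarrow> 1 - 0 * (1 / ?p)"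
    by (intro tendsto_intros lim_inverse_n)
  then show "(\<lambda>n. 1 - 1 / (real n * ?p)) \<longlonglongrightarrow> 1" by (simp add: field_simps)
qed (simp_all add: kept_fraction_bounds)

text \<open>Transports a fraction of each of the first \<open>n\<close> cells to its centre and all the rest to \<open>D 0\<close>,
  the fraction being such that every centre receives a multiple of \<open>1 / n\<close>. The Boolean coordinate
  records which of the two moves is made.\<close>

lemma quantization:
  fixes \<mu> :: "'a::{metric_space, second_countable_topology} measure"
  assumes \<mu>: "\<mu> \<in> prob_measures" and T [measurable]: "T \<in> borel \<rightarrow>\<^sub>M count_space UNIV"
    and D: "\<And>x. dist x (D (T x)) < e" and n: "n > 0"
  shows "\<exists>z\<in>{..<n} \<rightarrow>\<^sub>E range D. (W2 \<mu> (empirical n z))\<^sup>2 \<le> ennreal (e\<^sup>2) +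
    (\<integral>\<^sup>+ x. ennreal (1 - kept_fraction \<mu> T n (T x)) * ennreal ((dist (D 0) x)\<^sup>2) \<partial>\<mu>)"
proof -
  note \<mu>' = prob_measuresD[OF \<mu>]
  interpret m: prob_space \<mu> by fact
  note [measurable_cong] = \<mu>'(2)
  let ?w = "\<lambda>x. kept_fraction \<mu> T n (T x)"
  have [measurable]: "kept_fraction \<mu> T n \<in> count_space UNIV \<rightarrow>\<^sub>M borel" "D \<in> count_space UNIV \<rightarrow>\<^sub>M borel" by simp_all
  have Tk [measurable]: "T -` {k} \<in> sets borel" for k using measurable_sets[OF T, of "{k}"] by simp
  let ?B = "count_space (UNIV :: bool set)"
  interpret b: sigma_finite_measure ?B by (rule sigma_finite_measure_count_space_finite) simp
  \<comment> \<open>For each \<open>x\<close> the weights of \<open>True\<close> and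
    \<open>False\<close> add up to 1, so forgetting the Boolean recovers
    \<open>\<mu>\<close>.\<close>
  define d :: "'a \<times> bool \<Rightarrow> ennreal" where
    "d q = ennreal (if snd q then ?w (fst q) else 1 - ?w (fst q))" for q
  define \<Omega> where "\<Omega> = density (\<mu> \<Otimes>\<^sub>M ?B) d"
  have d_meas [measurable]: "d \<in> borel_measurable (borel \<Otimes>\<^sub>M ?B)" unfolding d_def by measurable
  have sets_\<Omega> [measurable_cong]: "sets \<Omega> = sets (borel \<Otimes>\<^sub>M ?B)"
    unfolding \<Omega>_def sets_density by (rule sets_pair_measure_cong[OF \<mu>'(2) refl])
  have int: "(\<integral>\<^sup>+ q. h q \<partial>\<Omega>) = (\<integral>\<^sup>+ x. ennreal (?w x) * h (x, True) + ennreal (1 - ?w x) * h (x, False) \<partial>\<mu>)"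
    if h [measurable]: "h \<in> borel_measurable (borel \<Otimes>\<^sub>M ?B)" for h
  proof -
    have "(\<integral>\<^sup>+ q. h q \<partial>\<Omega>) = (\<integral>\<^sup>+ q. d q * h q \<partial>(\<mu> \<Otimes>\<^sub>M ?B))"
      unfolding \<Omega>_def by (rule nn_integral_density) measurable
    also have "\<dots> = (\<integral>\<^sup>+ x. \<integral>\<^sup>+ b. d (x, b) * h (x, b) \<partial>?B \<partial>\<mu>)"
      by (rule b.nn_integral_fst[symmetric]) measurable
    also have "\<dots> = (\<integral>\<^sup>+ x. ennreal (?w x) * h (x, True) + ennreal (1 - ?w x) * h (x, False) \<partial>\<mu>)"
      by (simp add: nn_integral_count_space_finite UNIV_bool d_def add.commute)
    finally show ?thesis .
  qed
  have split: "ennreal (?w x) * c + ennreal (1 - ?w x) * c = c" for x c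
    using kept_fraction_bounds[of \<mu> T n "T x"] by (simp flip: distrib_right ennreal_plus)
  have "prob_space \<Omega>"
    using int[of "\<lambda>_. 1"] split[of _ 1] m.emeasure_space_1 by (intro prob_spaceI) simp
  have \<mu>_distr: "distr \<Omega> borel fst = \<mu>"
  proof (rule measure_eqI)
    fix A assume "A \<in> sets (distr \<Omega> borel fst)"
    then have A [measurable]: "A \<in> sets borel" by simp
    have "emeasure (distr \<Omega> borel fst) A = (\<integral>\<^sup>+ q. indicator A (fst q) \<partial>\<Omega>)"
      using nn_integral_distr[of fst \<Omega> borel "indicator A"] by simp
    also have "\<dots> = emeasure \<mu> A" using A by (subst int) (simp_all add: split \<mu>'(2))
    finally show "emeasure (distr \<Omega> borel fst) A = emeasure \<mu> A" .
  qed (simp add: \<mu>'(2))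
  define g where "g q = (if snd q then D (T (fst q)) else D 0)" for q :: "'a \<times> bool"
  have g [measurable]: "g \<in> borel \<Otimes>\<^sub>M ?B \<rightarrow>\<^sub>M borel" unfolding g_def by measurable
  define \<nu> where "\<nu> = distr \<Omega> borel g"
  have g\<Omega>: "g \<in> \<Omega> \<rightarrow>\<^sub>M borel" by measurable
  have \<nu>: "\<nu> \<in> prob_measures"
    unfolding \<nu>_def using prob_space.prob_space_distr[OF \<open>prob_space \<Omega>\<close> g\<Omega>] by (simp add: prob_measures_def)
  have \<nu>_eq: "emeasure \<nu> A = (\<integral>\<^sup>+ x. ennreal (?w x) * indicator A (D (T x)) \<partial>\<mu>)
      + (\<integral>\<^sup>+ x. ennreal (1 - ?w x) \<partial>\<mu>) * indicator A (D 0)" if A [measurable]: "A \<in> sets borel" for A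
  proof -
    have "emeasure \<nu> A = (\<integral>\<^sup>+ q. indicator A (g q) \<partial>\<Omega>)"
      unfolding \<nu>_def using nn_integral_distr[OF g\<Omega>, of "indicator A"] by simp
    also have "\<dots> = (\<integral>\<^sup>+ x. ennreal (?w x) * indicator A (D (T x)) + ennreal (1 - ?w x) * indicator A (D 0) \<partial>\<mu>)"
      by (subst int) (simp_all add: g_def)
    finally show ?thesis by (simp add: nn_integral_add nn_integral_multc)
  qed
  \<comment> \<open>The number of portions of size \<open>1 / n\<close> that stay with the centre
    \<open>D k\<close>.\<close>
  define a where "a k = nat \<lfloor>real n * cell_mass \<mu> T k\<rfloor>" for k
  have a: "kept_fraction \<mu> T n k * cell_mass \<mu> T k = real (a k) / real n" if "k < n" for k
  proof -
    have "cell_mass \<mu> T k \<ge> 0" by (simp add: cell_mass_def)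
    then show ?thesis using that n
      by (cases "cell_mass \<mu> T k = 0") (auto simp: kept_fraction_def a_def field_simps)
  qed
  have kept: "(\<integral>\<^sup>+ x. ennreal (?w x) * indicator A (D (T x)) \<partial>\<mu>) =
      ennreal ((\<Sum>k<n. real (a k) * indicator A (D k)) / real n)" for A
  proof -
    have "ennreal (?w x) * indicator A (D (T x)) =
        (\<Sum>k<n. ennreal (kept_fraction \<mu> T n k * indicator A (D k)) * indicator (T -` {k}) x)" for x
    proof -
      have "(\<Sum>k<n. ennreal (kept_fraction \<mu> T n k * indicator A (D k)) * indicator (T -` {k}) x) =
          (\<Sum>k<n. if k = T x then ennreal (?w x) * indicator A (D (T x)) else 0)"
        by (intro sum.cong) (auto simp: indicator_def)
      then show ?thesis by (simp add: kept_fraction_def)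
    qed
    then have "(\<integral>\<^sup>+ x. ennreal (?w x) * indicator A (D (T x)) \<partial>\<mu>) =
        (\<integral>\<^sup>+ x. (\<Sum>k<n. ennreal (kept_fraction \<mu> T n k * indicator A (D k)) * indicator (T -` {k}) x) \<partial>\<mu>)"
      by (simp only:)
    also have "\<dots> = (\<Sum>k<n. \<integral>\<^sup>+ x. ennreal (kept_fraction \<mu> T n k * indicator A (D k)) * indicator (T -` {k}) x \<partial>\<mu>)"
      using Tk by (intro nn_integral_sum borel_measurable_times_ennreal borel_measurable_indicator) (auto simp: \<mu>'(2))
    also have "\<dots> = (\<Sum>k<n. ennreal (kept_fraction \<mu> T n k * indicator A (D k)) * emeasure \<mu> (T -` {k}))"
      using Tk by (intro sum.cong nn_integral_cmult_indicator) (simp_all add: \<mu>'(2))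
    also have "\<dots> = (\<Sum>k<n. ennreal (real (a k) * indicator A (D k) / real n))"
    proof (rule sum.cong)
      fix k assume "k \<in> {..<n}"
      then have "kept_fraction \<mu> T n k * indicator A (D k) * cell_mass \<mu> T k = real (a k) * indicator A (D k) / real n"
        using a[of k] by (simp add: field_simps)
      then show "ennreal (kept_fraction \<mu> T n k * indicator A (D k)) * emeasure \<mu> (T -` {k}) =
          ennreal (real (a k) * indicator A (D k) / real n)"
        using kept_fraction_bounds[of \<mu> T n k]
        by (simp add: m.emeasure_eq_measure cell_mass_def ennreal_mult[symmetric])
    qed simp
    also have "\<dots> = ennreal ((\<Sum>k<n. real (a k) * indicator A (D k)) / real n)"
      by (subst sum_ennreal, simp) (simp only: sum_divide_distrib)
    finally show ?thesis .
  qed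
  have total: "ennreal (real (\<Sum>k<n. a k) / real n) + (\<integral>\<^sup>+ x. ennreal (1 - ?w x) \<partial>\<mu>) = 1"
    using \<nu>_eq[of UNIV] kept[of UNIV] prob_space.emeasure_space_1[OF prob_measuresD(1)[OF \<nu>]]
    by (simp add: prob_measuresD(3)[OF \<nu>])
  then have "ennreal (real (\<Sum>k<n. a k) / real n) \<le> ennreal 1"
    by (metis ennreal_1 le_iff_add)
  then have a_le: "(\<Sum>k<n. a k) \<le> n"
    using n by (subst (asm) ennreal_le_iff) (simp_all add: field_simps flip: of_nat_sum)
  have rest: "(\<integral>\<^sup>+ x. ennreal (1 - ?w x) \<partial>\<mu>) = ennreal (real (n - (\<Sum>k<n. a k)) / real n)"
  proof -
    have "(\<integral>\<^sup>+ x. ennreal (1 - ?w x) \<partial>\<mu>) = 1 - ennreal (real (\<Sum>k<n. a k) / real n)"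
      using total by (metis ennreal_add_diff_cancel_left ennreal_neq_top infinity_ennreal_def)
    also have "\<dots> = ennreal (1 - real (\<Sum>k<n. a k) / real n)"
      by (subst ennreal_minus[symmetric]) (simp_all add: sum_nonneg)
    also have "1 - real (\<Sum>k<n. a k) / real n = real (n - (\<Sum>k<n. a k)) / real n"
      using n a_le by (simp add: field_simps of_nat_diff)
    finally show ?thesis .
  qed
  have nat: "real n * measure \<nu> A \<in> \<nat>" if A: "A \<in> sets borel" for A
  proof -
    \<comment> \<open>The portions left for \<open>D 0\<close>; the natural subtraction is exact by
      \<open>a_le\<close>. Every Borel set thus receives a whole number of portions, which is what
      the criterion for empirical measures asks for.\<close>
    let ?r = "n - (\<Sum>k<n. a k)"
    let ?m = "(\<Sum>k<n. a k * of_bool (D k \<in> A)) + ?r * of_bool (D 0 \<in> A)"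
    let ?S = "\<Sum>k<n. real (a k) * indicator A (D k)"
    have m: "real ?m = ?S + real ?r * indicator A (D 0)"
      by (simp add: indicator_def del: of_nat_diff)
    have S: "?S \<ge> 0" by (intro sum_nonneg) simp
    have "emeasure \<nu> A = ennreal (?S / real n) + ennreal (real ?r / real n) * indicator A (D 0)"
      unfolding \<nu>_eq[OF A] kept rest ..
    also have "\<dots> = ennreal (real ?m / real n)"
      using S unfolding m by (cases "D 0 \<in> A") (simp_all only: indicator_simps simp_thms div_0 mult_1_right mult_zero_right
        add_0_right add_divide_distrib ennreal_plus divide_nonneg_nonneg of_nat_0_le_iff)
    finally obtain m :: nat where "emeasure \<nu> A = ennreal (real m / real n)" by blast
    then have "measure \<nu> A = real m / real n" by (simp add: measure_def)
    then have "real n * measure \<nu> A = real m" using n by simp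
    then show ?thesis by (simp only: of_nat_in_Nats)
  qed
  obtain \<B> :: "'a set set" where \<B>: "countable \<B>" "topological_basis \<B>"
    using ex_countable_basis by blast
  have "\<nu> \<in> empirical_measures n"
    using topological_basis_open[OF \<B>(2)] by (intro empirical_if_basis_Nats[OF \<nu> n \<B>] nat) simp
  then obtain z where z: "\<nu> = empirical n z" by (auto simp: empirical_measures_def)
  \<comment> \<open>The new measure gives no mass to a point outside the range of \<open>D\<close>,
    whereas every atom of an empirical measure has positive mass.\<close>
  have zD: "z i \<in> range D" if i: "i < n" for i
  proof (rule ccontr)
    assume "z i \<notin> range D"
    then have "D k \<noteq> z i" for k by (metis rangeI)
    then have "emeasure \<nu> {z i} = 0" by (subst \<nu>_eq) (simp_all add: indicator_def)
    moreover have "emeasure \<nu> {z i} > 0" using i by (simp add: z emeasure_empirical_pos_iff[OF n])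
    ultimately show False by simp
  qed
  have zr: "empirical n (restrict z {..<n}) = \<nu>"
    unfolding z by (rule measure_eqI) (simp_all add: emeasure_empirical)
  have "(W2 \<mu> \<nu>)\<^sup>2 \<le> (\<integral>\<^sup>+ q. ennreal ((dist (fst q) (g q))\<^sup>2) \<partial>\<Omega>)"
    using W2_distr_squared_le[OF \<open>prob_space \<Omega>\<close>, of fst g] g\<Omega> unfolding \<nu>_def[symmetric] \<mu>_distr
    by measurable
  also have "\<dots> = (\<integral>\<^sup>+ x. ennreal (?w x) * ennreal ((dist x (D (T x)))\<^sup>2)
      + ennreal (1 - ?w x) * ennreal ((dist (D 0) x)\<^sup>2) \<partial>\<mu>)"
    by (subst int) (simp_all add: g_def dist_commute)
  also have "\<dots> \<le> (\<integral>\<^sup>+ x. ennreal (e\<^sup>2) + ennreal (1 - ?w x) * ennreal ((dist (D 0) x)\<^sup>2) \<partial>\<mu>)"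
  proof (intro nn_integral_mono add_right_mono)
    fix x
    have "ennreal (?w x) * ennreal ((dist x (D (T x)))\<^sup>2) \<le> ennreal 1 * ennreal (e\<^sup>2)"
      using kept_fraction_bounds[of \<mu> T n "T x"] D[of x]
      by (intro mult_mono ennreal_leI power_mono) auto
    then show "ennreal (?w x) * ennreal ((dist x (D (T x)))\<^sup>2) \<le> ennreal (e\<^sup>2)" by simp
  qed
  also have "\<dots> = ennreal (e\<^sup>2) + (\<integral>\<^sup>+ x. ennreal (1 - ?w x) * ennreal ((dist (D 0) x)\<^sup>2) \<partial>\<mu>)"
    by (subst nn_integral_add) (simp_all add: m.emeasure_space_1)
  finally show ?thesis
    using zD zr by (intro bexI[of _ "restrict z {..<n}"]) auto
qed

lemma prob_measures2_second_moment:
  fixes \<mu> :: "'a::{metric_space, second_countable_topology} measure"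
  assumes "\<mu> \<in> prob_measures2"
  shows "(\<integral>\<^sup>+ x. ennreal ((dist b x)\<^sup>2) \<partial>\<mu>) < \<infinity>"
proof -
  obtain a where \<mu>: "\<mu> \<in> prob_measures" and a: "(\<integral>\<^sup>+ x. ennreal ((dist a x)\<^sup>2) \<partial>\<mu>) < \<infinity>"
    using assms by (auto simp: prob_measures2_def)
  note \<mu>' = prob_measuresD[OF \<mu>]
  interpret prob_space \<mu> by fact
  note [measurable_cong] = \<mu>'(2)
  have "(\<integral>\<^sup>+ x. ennreal ((dist b x)\<^sup>2) \<partial>\<mu>) \<le> (\<integral>\<^sup>+ x. ennreal (2 * (dist b a)\<^sup>2) + 2 * ennreal ((dist a x)\<^sup>2) \<partial>\<mu>)"
  proof (rule nn_integral_mono)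
    fix x
    have "(dist b x)\<^sup>2 \<le> (dist b a + dist a x)\<^sup>2" by (intro power_mono dist_triangle) simp
    also have "\<dots> \<le> 2 * (dist b a)\<^sup>2 + 2 * (dist a x)\<^sup>2"
      using sum_squares_bound[of "dist b a" "dist a x"] by (simp add: power2_eq_square algebra_simps)
    finally have "ennreal ((dist b x)\<^sup>2) \<le> ennreal (2 * (dist b a)\<^sup>2 + 2 * (dist a x)\<^sup>2)" by (rule ennreal_leI)
    then show "ennreal ((dist b x)\<^sup>2) \<le> ennreal (2 * (dist b a)\<^sup>2) + 2 * ennreal ((dist a x)\<^sup>2)"
      by (simp add: ennreal_mult)
  qed
  also have "\<dots> = ennreal (2 * (dist b a)\<^sup>2) + 2 * (\<integral>\<^sup>+ x. ennreal ((dist a x)\<^sup>2) \<partial>\<mu>)"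
    by (subst nn_integral_add) (simp_all add: nn_integral_cmult emeasure_space_1)
  also have "\<dots> < \<infinity>" using a by (simp add: ennreal_mult_less_top)
  finally show ?thesis .
qed

text \<open>Both measures are compared with a Dirac mass, to which the transport cost is a second
  moment.\<close>

lemma W2_finite:
  fixes \<mu> \<nu> :: "'a::{metric_space, second_countable_topology} measure"
  assumes "\<mu> \<in> prob_measures2" "\<nu> \<in> prob_measures2"
  shows "W2 \<mu> \<nu> < top"
proof -
  \<comment> \<open>Any base point will do, since finiteness of the second moment does not depend on
    it.\<close>
  define a :: 'a where "a = undefined"
  have fin: "W2 \<rho> (return borel a) < top" if \<rho>: "\<rho> \<in> prob_measures2" for \<rho> :: "'a measure"
  proof -
    have \<rho>': "prob_space \<rho>" "sets \<rho> = sets borel" "space \<rho> = UNIV"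
      using \<rho> prob_measuresD[of \<rho>] by (auto simp: prob_measures2_def)
    interpret prob_space \<rho> by fact
    note [measurable_cong] = \<rho>'(2)
    have 1: "distr \<rho> borel (\<lambda>x. x) = \<rho>" using \<rho>'(2) by (intro distr_id2) simp
    have 2: "distr \<rho> borel (\<lambda>x. a) = return borel a"
      using emeasure_space_1 by (intro measure_eqI) (auto simp: emeasure_distr indicator_def \<rho>'(3))
    have "(W2 \<rho> (return borel a))\<^sup>2 \<le> (\<integral>\<^sup>+ x. ennreal ((dist a x)\<^sup>2) \<partial>\<rho>)"
      using W2_distr_squared_le[OF \<rho>'(1), of "\<lambda>x. x" "\<lambda>_. a"] unfolding 1 2 by (simp add: dist_commute)
    also have "\<dots> < \<infinity>" by (rule prob_measures2_second_moment[OF \<rho>])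
    finally show ?thesis by (cases "W2 \<rho> (return borel a)") auto
  qed
  have "W2 \<mu> \<nu> \<le> W2 \<mu> (return borel a) + W2 \<nu> (return borel a)"
    using W2_triangle[of \<mu> \<nu> "return borel a"] by (simp add: W2_commute[of \<nu>])
  also have "\<dots> < top" using fin assms by (simp add: ennreal_add_less_top)
  finally show ?thesis .
qed

section \<open>The finite metric on measures of finite second moment, and its separability\<close>

lemma Metric_space_W2:
  "Metric_space (prob_measures2 :: 'a::{metric_space, second_countable_topology} measure set)
    (\<lambda>\<mu> \<nu>. enn2real (W2 \<mu> \<nu>))"
proof
  fix \<mu> \<nu> :: "'a measure"
  show "0 \<le> enn2real (W2 \<mu> \<nu>)" by simp
  show "enn2real (W2 \<mu> \<nu>) = enn2real (W2 \<nu> \<mu>)" by (simp add: W2_commute)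
  assume \<mu>\<nu>: "\<mu> \<in> prob_measures2" "\<nu> \<in> prob_measures2"
  then have p: "\<mu> \<in> prob_measures" "\<nu> \<in> prob_measures" by (auto simp: prob_measures2_def)
  show "enn2real (W2 \<mu> \<nu>) = 0 \<longleftrightarrow> \<mu> = \<nu>"
    using W2_finite[OF \<mu>\<nu>] W2_refl[OF p(1)] W2_eq_0D[OF p] by (auto simp: enn2real_eq_0_iff)
  fix \<rho> :: "'a measure" assume \<rho>: "\<rho> \<in> prob_measures2"
  have "enn2real (W2 \<mu> \<rho>) \<le> enn2real (W2 \<mu> \<nu> + W2 \<nu> \<rho>)"
    using W2_finite[OF \<mu>\<nu>] W2_finite[OF \<mu>\<nu>(2) \<rho>]
    by (intro enn2real_mono W2_triangle) (simp add: ennreal_add_less_top)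
  also have "\<dots> = enn2real (W2 \<mu> \<nu>) + enn2real (W2 \<nu> \<rho>)"
    using W2_finite[OF \<mu>\<nu>] W2_finite[OF \<mu>\<nu>(2) \<rho>] by (rule enn2real_plus)
  finally show "enn2real (W2 \<mu> \<rho>) \<le> enn2real (W2 \<mu> \<nu>) + enn2real (W2 \<nu> \<rho>)" .
qed

lemma empirical_in_prob_measures2:
  fixes z :: "nat \<Rightarrow> 'a::metric_space"
  assumes "n > 0"
  shows "empirical n z \<in> prob_measures2"
proof -
  have "(\<integral>\<^sup>+ x. ennreal ((dist (z 0) x)\<^sup>2) \<partial>empirical n z) < \<infinity>"
    using assms by (simp add: nn_integral_empirical sum_ennreal ennreal_of_nat_eq_real_of_nat divide_ennreal sum_nonneg)
  then show ?thesis using empirical_in_prob_measures[OF assms] by (auto simp: prob_measures2_def)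
qed

text \<open>The empirical measures of all sizes with atoms in one dense sequence are countably many.
  They are dense by \<open>quantization\<close>: displacement within cells costs at most
  \<open>e\<^sup>2\<close>, and the cost of the discarded mass tends to zero, dominated by the
  second moment.\<close>

lemma separable_metric_W2:
  "separable_metric (prob_measures2 :: 'a::{metric_space, second_countable_topology} measure set)
    (\<lambda>\<mu> \<nu>. enn2real (W2 \<mu> \<nu>))"
proof -
  interpret Metric_space "prob_measures2 :: 'a measure set" "\<lambda>\<mu> \<nu>. enn2real (W2 \<mu> \<nu>)"
    by (rule Metric_space_W2)
  obtain D :: "nat \<Rightarrow> 'a" where D: "\<And>e. e > 0 \<Longrightarrow> \<exists>T. T \<in> borel \<rightarrow>\<^sub>M count_space UNIV \<and> (\<forall>x. dist x (D (T x)) < e)"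
    using small_partition by blast
  define C where "C = (\<Union>n\<in>{0<..}. empirical n ` ({..<n} \<rightarrow>\<^sub>E range D))"
  have C: "countable C" unfolding C_def by (intro countable_UN countable_image countable_PiE) auto
  have C2: "C \<subseteq> prob_measures2" unfolding C_def using empirical_in_prob_measures2 by auto
  have dense: "\<exists>\<nu>\<in>C. enn2real (W2 \<mu> \<nu>) < r" if \<mu>: "\<mu> \<in> prob_measures2" and r: "r > 0" for \<mu> r
  proof -
    have p: "\<mu> \<in> prob_measures" using \<mu> by (simp add: prob_measures2_def)
    note \<mu>' = prob_measuresD[OF p]
    interpret m: prob_space \<mu> by fact
    note [measurable_cong] = \<mu>'(2)
    \<comment> \<open>The two errors are each at most \<open>e\<^sup>2\<close>, in total
      \<open>r\<^sup>2 / 2\<close>, which is strictly below \<open>r\<^sup>2\<close>.\<close>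
    define e where "e = r / 2"
    have e: "e > 0" using r by (simp add: e_def)
    obtain T where T [measurable]: "T \<in> borel \<rightarrow>\<^sub>M count_space UNIV" and DT: "\<And>x. dist x (D (T x)) < e"
      using D[OF e] by blast
    have Tk: "T -` {k} \<in> sets \<mu>" for k using measurable_sets[OF T, of "{k}"] \<mu>'(2) by simp
    have [measurable]: "kept_fraction \<mu> T n \<in> count_space UNIV \<rightarrow>\<^sub>M borel" for n by simp
    \<comment> \<open>On a null cell the kept fraction is zero for every \<open>n\<close>, so the
      convergence to 1 holds only almost everywhere.\<close>
    have pos: "AE x in \<mu>. cell_mass \<mu> T (T x) > 0"
    proof -
      have "AE x in \<mu>. \<forall>k. cell_mass \<mu> T k = 0 \<longrightarrow> T x \<noteq> k"
        unfolding AE_all_countable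
      proof
        fix k
        show "AE x in \<mu>. cell_mass \<mu> T k = 0 \<longrightarrow> T x \<noteq> k"
        proof (cases "cell_mass \<mu> T k = 0")
          case True
          then have "T -` {k} \<in> null_sets \<mu>"
            using Tk by (simp add: cell_mass_def null_sets_def m.emeasure_eq_measure)
          from AE_not_in[OF this] show ?thesis by auto
        qed simp
      qed
      then show ?thesis
        by eventually_elim (metis cell_mass_def measure_nonneg order_le_less)
    qed
    let ?f = "\<lambda>n x. ennreal (1 - kept_fraction \<mu> T n (T x)) * ennreal ((dist (D 0) x)\<^sup>2)"
    have "(\<lambda>n. \<integral>\<^sup>+ x. ?f n x \<partial>\<mu>) \<longlonglongrightarrow> (\<integral>\<^sup>+ x. 0 \<partial>\<mu>)"
    proof (rule nn_integral_dominated_convergence)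
      show "(\<integral>\<^sup>+ x. ennreal ((dist (D 0) x)\<^sup>2) \<partial>\<mu>) < \<infinity>"
        by (rule prob_measures2_second_moment[OF \<mu>])
      show "AE x in \<mu>. ?f n x \<le> ennreal ((dist (D 0) x)\<^sup>2)" for n
        using kept_fraction_bounds[of \<mu> T n]
        by (intro AE_I2) (simp add: mult_left_le_one_le flip: ennreal_mult')
      show "AE x in \<mu>. (\<lambda>n. ?f n x) \<longlonglongrightarrow> 0"
        using pos
      proof eventually_elim
        case (elim x)
        have "(\<lambda>n. ennreal ((1 - kept_fraction \<mu> T n (T x)) * (dist (D 0) x)\<^sup>2)) \<longlonglongrightarrow> ennreal ((1 - 1) * (dist (D 0) x)\<^sup>2)"
          by (intro tendsto_ennrealI tendsto_intros kept_fraction_tendsto elim)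
        then show ?case using kept_fraction_bounds[of \<mu> T] by (simp add: ennreal_mult)
      qed
    qed measurable
    then have "eventually (\<lambda>n. (\<integral>\<^sup>+ x. ?f n x \<partial>\<mu>) < ennreal (e\<^sup>2)) sequentially"
      using e by (intro order_tendstoD(2)) auto
    from eventually_happens'[OF sequentially_bot eventually_conj[OF this eventually_gt_at_top[of 0]]]
    obtain n where n: "n > 0" "(\<integral>\<^sup>+ x. ?f n x \<partial>\<mu>) < ennreal (e\<^sup>2)"
      by blast
    obtain z where z: "z \<in> {..<n} \<rightarrow>\<^sub>E range D"
      "(W2 \<mu> (empirical n z))\<^sup>2 \<le> ennreal (e\<^sup>2) + (\<integral>\<^sup>+ x. ?f n x \<partial>\<mu>)"
      using quantization[OF p T DT n(1)] by blast
    have "(W2 \<mu> (empirical n z))\<^sup>2 \<le> ennreal (e\<^sup>2) + ennreal (e\<^sup>2)"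
      using z(2) n(2) by (meson add_left_mono less_imp_le order_trans)
    also have "\<dots> < ennreal (r\<^sup>2)"
      using r by (simp add: e_def power_divide flip: ennreal_plus) (simp add: ennreal_less_iff)
    finally have "(W2 \<mu> (empirical n z))\<^sup>2 < ennreal (r\<^sup>2)" .
    then have "enn2real (W2 \<mu> (empirical n z)) < r"
      using r by (cases "W2 \<mu> (empirical n z)")
        (auto simp: ennreal_power ennreal_less_iff intro: power_less_imp_less_base[of _ 2])
    moreover have "empirical n z \<in> C" using z(1) n(1) by (auto simp: C_def)
    ultimately show ?thesis by blast
  qed
  have "mtopology closure_of C = topspace mtopology"
    using dense C2 by (fastforce simp: metric_closure_of)
  then have "separable_space mtopology"
    unfolding separable_space_def using C C2 by auto
  then show ?thesis unfolding separable_metric_def using Metric_space_W2 by blast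
qed

lemma prob_measures2_eq_if_bounded:
  assumes "bounded (UNIV :: 'a::{metric_space, second_countable_topology} set)"
  shows "(prob_measures2 :: 'a measure set) = prob_measures"
proof -
  obtain a :: 'a and B where B: "\<And>x. dist a x \<le> B" using assms by (auto simp: bounded_def)
  have "(\<integral>\<^sup>+ x. ennreal ((dist a x)\<^sup>2) \<partial>\<mu>) < \<infinity>" if "\<mu> \<in> prob_measures" for \<mu>
  proof -
    interpret prob_space \<mu> by (rule prob_measuresD(1)[OF that])
    have "(\<integral>\<^sup>+ x. ennreal ((dist a x)\<^sup>2) \<partial>\<mu>) \<le> (\<integral>\<^sup>+ x. ennreal (B\<^sup>2) \<partial>\<mu>)"
      using B by (intro nn_integral_mono ennreal_leI power_mono) auto
    also have "\<dots> < \<infinity>" by (simp add: emeasure_space_1)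
    finally show ?thesis .
  qed
  then show ?thesis by (auto simp: prob_measures2_def)
qed

text \<open>On an unbounded space \<open>W2\<close> may be infinite, and \<open>enn2real\<close>
  would collapse that value to zero. Separability as a real metric is therefore stated where
  \<open>W2\<close> is finite, that is for finite second moments and on all of P(S) when
  \<open>S\<close> is bounded; the structural assertions use the extended metric on all of
  P(S).\<close>

theorem proposition6p1:
  fixes \<pi> :: "'a::{metric_space, second_countable_topology} measure"
    and \<kappa> :: "'a \<Rightarrow> 'a measure"
    and N :: nat
  assumes inner_regular: "\<And>M :: 'a measure.
      sets M = sets borel \<Longrightarrow> finite_measure M \<Longrightarrow> inner_regular_measure M"
    and base: "jump_structure UNIV (\<lambda>x y. ennreal (dist x y)) \<pi> \<kappa>"
    and N: "N \<ge> 2"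
  shows "ext_metric (prob_measures :: 'a measure set) W2 \<and>
    separable_metric (prob_measures2 :: 'a measure set) (\<lambda>\<mu> \<nu>. enn2real (W2 \<mu> \<nu>)) \<and>
    (bounded (UNIV :: 'a set) \<longrightarrow>
      separable_metric (prob_measures :: 'a measure set) (\<lambda>\<mu> \<nu>. enn2real (W2 \<mu> \<nu>))) \<and>
    empirical N \<in> (\<Pi>\<^sub>M i\<in>{..<N}. \<pi>) \<rightarrow>\<^sub>M metric_borel prob_measures W2 \<and>
    (\<forall>\<nu>\<in>prob_measures. measure_space prob_measures
      (sets (metric_borel prob_measures W2)) (lifted_rate N \<kappa> \<nu>)) \<and>
    jump_structure prob_measures W2 (lifted_measure N \<pi>) (lifted_kernel N \<kappa>) \<and>
    rate_bound prob_measures W2 (lifted_kernel N \<kappa>)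
      \<le> rate_bound UNIV (\<lambda>x y. ennreal (dist x y)) \<kappa>"
proof -
  interpret base_jump \<pi> \<kappa> N
    using base N by unfold_locales simp_all
  have "bounded (UNIV :: 'a set) \<longrightarrow>
      separable_metric (prob_measures :: 'a measure set) (\<lambda>\<mu> \<nu>. enn2real (W2 \<mu> \<nu>))"
    using separable_metric_W2 prob_measures2_eq_if_bounded by metis
  then show ?thesis
    by (intro conjI ballI ext_metric_W2 separable_metric_W2 empirical_measurable_PiM
        lifted_rate_measure_space lifted_jump_structure lifted_rate_bound_le)
qed

end
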